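(* There exists an absolute constant $c_1>0$ such that, for every $n\geq 2$ and every convex body $K$ in $\mathbb{R}^n$, $$|K|^{\frac{1}{n}}\,\min_{\xi\in S^{n-1}}S(P_{\xi^{\perp}}(K))\leq \frac{2b_n\partial_K}{n\omega_n^{\frac{1}{n}}}\,S(K)\leq\frac{c_1\partial_K}{\sqrt{n}}\,S(K).$$
   Context: A convex body in $\mathbb{R}^n$ is a compact convex set with non-empty interior. $|\cdot|$ denotes volume (in the appropriate dimension), $\omega_m$ is the volume of the Euclidean unit ball $B_2^m$ in $\mathbb{R}^m$, and $S^{n-1}$ is the Euclidean unit sphere. $P_{\xi^{\perp}}$ is the orthogonal projection onto the hyperplane $\xi^{\perp}$. $S(A)$ is the surface area of a convex body $A$; $P_{\xi^\perp}(K)$ is regarded as a convex body in the $(n-1)$-dimensional Euclidean space $\xi^\perp$, and its surface area is taken there. In dimension $m$ one has $S(A)=mV((A,m-1),(B_2^m,1))$ (a mixed volume); in particular the surface area of a segment in a one-dimensional space is $2$. The constant $b_n$ is $$b_n=\frac{(n-1)\omega_{n-1}}{n\omega_n^{\frac{n-1}{n}}},$$ and the minimal surface area parameter of $K$ is $$\partial_K:=\min\Big\{ S(T(K))/|T(K)|^{\frac{n-1}{n}}:T\in GL(n)\Big\}.$$ "Absolute constant" means a constant independent of $n$ and of $K$. *)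

theory Defs
  imports "HOL-Analysis.Analysis"
begin

text \<open>
  The dimension is a bound natural number in the main statement, so \<open>\<real>\<^sup>n\<close> is the carrier of the
  library's \<^const>\<open>Euclidean_space\<close> \<open>n\<close>: sequences \<open>x :: nat \<Rightarrow> real\<close> with \<open>x i = 0\<close> for all \<open>i \<ge> n\<close>.
\<close>

abbreviation Rn :: "nat \<Rightarrow> (nat \<Rightarrow> real) set" where
  "Rn n \<equiv> topspace (Euclidean_space n)"

definition dot :: "nat \<Rightarrow> (nat \<Rightarrow> real) \<Rightarrow> (nat \<Rightarrow> real) \<Rightarrow> real" where
  "dot n x y = (\<Sum>i<n. x i * y i)"

definition unit_ball :: "nat \<Rightarrow> (nat \<Rightarrow> real) set" where
  "unit_ball n = {x \<in> Rn n. L2_set x {..<n} \<le> 1}"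

definition unit_sphere :: "nat \<Rightarrow> (nat \<Rightarrow> real) set" where
  "unit_sphere n = {x \<in> Rn n. L2_set x {..<n} = 1}"

definition convex_body :: "nat \<Rightarrow> (nat \<Rightarrow> real) set \<Rightarrow> bool" where
  "convex_body n K \<longleftrightarrow>
     compactin (Euclidean_space n) K \<and>
     (\<forall>x\<in>K. \<forall>y\<in>K. \<forall>t\<in>{0..1}. (\<lambda>i. (1 - t) * x i + t * y i) \<in> K) \<and>
     Euclidean_space n interior_of K \<noteq> {}"

text \<open>
  Lebesgue measure on \<open>\<real>\<^sup>n\<close> is the \<open>n\<close>-fold product of \<^const>\<open>lborel\<close>, which lives on extensional
  functions on \<open>{..<n}\<close>; the restriction only changes the junk values outside \<open>{..<n}\<close>.
\<close>

definition vol :: "nat \<Rightarrow> (nat \<Rightarrow> real) set \<Rightarrow> real" where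
  "vol n A = measure (\<Pi>\<^sub>M i\<in>{..<n}. lborel) ((\<lambda>x. restrict x {..<n}) ` A)"

text \<open>The library's \<^const>\<open>unit_ball_vol\<close> is the constant \<open>\<omega>\<^sub>n\<close>:\<close>

lemma vol_unit_ball: "vol n (unit_ball n) = unit_ball_vol (real n)"
proof -
  have "(\<lambda>x. restrict x {..<n}) ` unit_ball n =
    {f. sqrt (\<Sum>i\<in>{..<n}. (f i)\<^sup>2) \<le> 1} \<inter> space (\<Pi>\<^sub>M i\<in>{..<n}. lborel)" (is "?L = ?R")
  proof (intro equalityI subsetI)
    fix f assume "f \<in> ?L"
    then show "f \<in> ?R"
      by (auto simp: unit_ball_def L2_set_def space_PiM PiE_def extensional_def)
  next
    fix f :: "nat \<Rightarrow> real" assume f: "f \<in> ?R"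
    define x where "x = (\<lambda>i. if i < n then f i else 0)"
    have "x \<in> unit_ball n"
      using f by (simp add: unit_ball_def L2_set_def topspace_Euclidean_space x_def)
    moreover have "f = restrict x {..<n}"
      using f by (auto simp: x_def space_PiM PiE_def extensional_def fun_eq_iff)
    ultimately show "f \<in> ?L" by blast
  qed
  then show ?thesis
    using emeasure_cball_aux[of "{..<n}" 1]
    by (simp add: vol_def measure_def unit_ball_vol_nonneg)
qed

definition parallel_body :: "nat \<Rightarrow> (nat \<Rightarrow> real) set \<Rightarrow> real \<Rightarrow> (nat \<Rightarrow> real) set" where
  "parallel_body m A \<epsilon> = {(\<lambda>i. a i + \<epsilon> * b i) | a b. a \<in> A \<and> b \<in> unit_ball m}"

text \<open>
  Surface area in dimension \<open>m\<close> in Minkowski's sense, the right derivative at \<open>0\<close> of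
  \<open>\<epsilon> \<mapsto> |A + \<epsilon>B|\<close>. By Steiner's formula the limit exists for every compact convex \<open>A\<close> and equals
  \<open>m V((A,m-1),(B,1))\<close>; for a segment in dimension one it is \<open>2\<close>.
\<close>

definition surface_area :: "nat \<Rightarrow> (nat \<Rightarrow> real) set \<Rightarrow> real" where
  "surface_area m A =
     Lim (at_right 0) (\<lambda>\<epsilon>. (vol m (parallel_body m A \<epsilon>) - vol m A) / \<epsilon>)"

text \<open>Orthogonal projection onto \<open>\<xi>\<^sup>\<bottom>\<close>, for a unit vector \<open>\<xi>\<close>.\<close>

definition proj_perp :: "nat \<Rightarrow> (nat \<Rightarrow> real) \<Rightarrow> (nat \<Rightarrow> real) \<Rightarrow> (nat \<Rightarrow> real)" where
  "proj_perp n \<xi> x = (\<lambda>i. x i - dot n x \<xi> * \<xi> i)"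

text \<open>For \<open>\<xi> \<noteq> 0\<close>, \<open>n - 1\<close> orthonormal vectors in \<open>\<xi>\<^sup>\<bottom>\<close> automatically span it.\<close>

definition orthonormal_basis_perp ::
    "nat \<Rightarrow> (nat \<Rightarrow> real) \<Rightarrow> (nat \<Rightarrow> nat \<Rightarrow> real) \<Rightarrow> bool" where
  "orthonormal_basis_perp n \<xi> u \<longleftrightarrow>
     (\<forall>i<n-1. u i \<in> Rn n \<and> dot n (u i) \<xi> = 0) \<and>
     (\<forall>i<n-1. \<forall>j<n-1. dot n (u i) (u j) = (if i = j then 1 else 0))"

text \<open>
  The \<open>(n-1)\<close>-dimensional surface area of \<open>A \<subseteq> \<xi>\<^sup>\<bottom>\<close>: the Euclidean space \<open>\<xi>\<^sup>\<bottom>\<close> is identified with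
  \<open>\<real>\<^sup>n\<^sup>-\<^sup>1\<close> by orthonormal coordinates. The choice of basis is irrelevant, since two choices differ by
  an orthogonal map of \<open>\<real>\<^sup>n\<^sup>-\<^sup>1\<close>.
\<close>

definition perp_coords :: "nat \<Rightarrow> (nat \<Rightarrow> real) \<Rightarrow> (nat \<Rightarrow> real) \<Rightarrow> (nat \<Rightarrow> real)" where
  "perp_coords n \<xi> =
     (let u = (SOME u. orthonormal_basis_perp n \<xi> u)
      in (\<lambda>x i. if i < n - 1 then dot n x (u i) else 0))"

definition surface_area_perp :: "nat \<Rightarrow> (nat \<Rightarrow> real) \<Rightarrow> (nat \<Rightarrow> real) set \<Rightarrow> real" where
  "surface_area_perp n \<xi> A = surface_area (n - 1) (perp_coords n \<xi> ` A)"

text \<open>Linear bijections of \<open>\<real>\<^sup>n\<close>; values outside \<open>\<real>\<^sup>n\<close> are unconstrained.\<close>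

definition GL :: "nat \<Rightarrow> ((nat \<Rightarrow> real) \<Rightarrow> (nat \<Rightarrow> real)) set" where
  "GL n = {T. bij_betw T (Rn n) (Rn n) \<and>
     (\<forall>x\<in>Rn n. \<forall>y\<in>Rn n. T (\<lambda>i. x i + y i) = (\<lambda>i. T x i + T y i)) \<and>
     (\<forall>a. \<forall>x\<in>Rn n. T (\<lambda>i. a * x i) = (\<lambda>i. a * T x i))}"

text \<open>
  The minimum is written as an infimum of nonnegative reals over a nonempty set; the two agree
  because the minimum is attained.
\<close>

definition min_surface_param :: "nat \<Rightarrow> (nat \<Rightarrow> real) set \<Rightarrow> real" where
  "min_surface_param n K =
     (INF T\<in>GL n. surface_area n (T ` K) / vol n (T ` K) powr ((real n - 1) / real n))"

definition b_const :: "nat \<Rightarrow> real" where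
  "b_const n = (real n - 1) * unit_ball_vol (real n - 1) /
     (real n * unit_ball_vol (real n) powr ((real n - 1) / real n))"

end

theory Submission
  imports Defs "HOL-Library.Function_Algebras"
begin

text \<open>
  Write \<open>growth n K u = |K + [0, u]| - |K|\<close>; for a unit vector \<open>\<xi>\<close> this is the volume of the projection of \<open>K\<close>
  onto \<open>\<xi>\<^sup>\<bottom>\<close>. Approximating the Euclidean ball by zonotopes \<open>\<Sum>\<^sub>i [-u\<^sub>i, u\<^sub>i]\<close>, obtained by discretizing
  an integral over the ball, expresses the surface area of \<open>K\<close> as a limit of \<open>2 \<Sum>\<^sub>i growth n K u\<^sub>i\<close>.

  For a linear image \<open>T K\<close> with \<open>|det T| = 1\<close> this sum is at least \<open>2 \<Sum>\<^sub>i |T\<^sup>-\<^sup>1 u\<^sub>i|\<close> times the minimal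
  projection \<open>M\<close> of \<open>K\<close>, and the integral of \<open>|T\<^sup>-\<^sup>1 x|\<close> over the ball is at least that of \<open>|x|\<close>. Hence
  \<open>M \<le> (\<omega>\<^sub>n\<^sub>-\<^sub>1 / (n \<omega>\<^sub>n)) \<partial>\<^sub>K |K|\<^bsup>(n-1)/n\<^esup>\<close>.

  It remains to show \<open>|K| S(P K) \<le> (2 (n - 1) / n) |P K| S(K)\<close> for a hyperplane projection \<open>P\<close>. Both surface areas
  are combinations of \<open>growth\<close>, so it suffices to treat one direction \<open>u\<close> in the hyperplane. Slicing along the plane
  spanned by \<open>u\<close> and the normal reduces this to a Berwald inequality
  \<open>|G| \<integral> a\<^sup>2 \<le> (2 (n - 1) / n) (\<integral> a)\<^sup>2\<close> for the chord lengths \<open>a\<close> over the \<open>(n - 2)\<close>-dimensional projection \<open>G\<close>,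
  which follows from the Brunn-Minkowski inequality for the covariogram.
\<close>

section \<open>Vectors and Lebesgue measure\<close>

text \<open>Mixed volumes and surface area measures never appear; \<open>growth\<close> replaces
  them. It is computed by slicing, is homogeneous in the direction, increases with the body, and
  scales by \<open>absdet\<close> under linear maps. Monotonicity is what lets a sum of growths act
  as a surface area: adding segments to \<open>K\<close> one at a time raises the volume by at least
  twice the growths of \<open>K\<close> and at most twice those of a slightly dilated copy. This
  also settles that the limit behind \<open>surface_area\<close> exists, which \<open>Lim\<close> by
  itself does not provide.

  The estimate for a single projection holds in every direction, with
  \<open>growth n K \<xi>\<close> as the volume of the projection, so infima may be taken on both
  sides and no minimizer is produced. The product of 2(n-1)/n and \<omega>_{n-1}/(n \<omega>_n) is
  exactly 2 b_n/(n \<omega>_n^{1/n}). The absolute constant 2 comes from 2(n-1)/n \<le> 2 and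
  \<omega>_{n-1} \<le> sqrt(n) \<omega>_n, the latter by log-convexity of Gamma.\<close>

instantiation "fun" :: (type, real_vector) real_vector
begin

definition "c *\<^sub>R f = (\<lambda>x. c *\<^sub>R f x)"

instance
  by standard (auto simp: scaleR_fun_def fun_eq_iff algebra_simps)

end

lemma scaleR_fun_apply [simp]: "(c *\<^sub>R f) x = c *\<^sub>R f x"
  by (simp add: scaleR_fun_def)

lemma sum_fun_apply [simp]: "(\<Sum>i\<in>I. f i) x = (\<Sum>i\<in>I. f i x)"
  by (induction I rule: infinite_finite_induct) auto

lemmas vec_apply = scaleR_fun_apply plus_fun_apply minus_apply uminus_apply
  sum_fun_apply zero_fun_apply

section \<open>Zero-padded sequences as vectors; coordinatewise measurability and continuity\<close>

type_synonym vec = "nat \<Rightarrow> real"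

lemma Rn_iff: "x \<in> Rn n \<longleftrightarrow> (\<forall>i\<ge>n. x i = 0)"
  by (simp add: topspace_Euclidean_space)

lemma subspace_Rn: "subspace (Rn n)"
  by (auto simp: subspace_def Rn_iff)

lemmas Rn_intros [intro, simp] =
  subspace_0[OF subspace_Rn] subspace_add[OF subspace_Rn] subspace_diff[OF subspace_Rn]
  subspace_scale[OF subspace_Rn]  subspace_neg[OF subspace_Rn] subspace_sum[OF subspace_Rn]

definition unit_vec :: "nat \<Rightarrow> vec" where
  "unit_vec i = (\<lambda>j. if j = i then 1 else 0)"

lemma unit_vec_in_Rn [simp]: "i < n \<Longrightarrow> unit_vec i \<in> Rn n"
  by (simp add: unit_vec_def Rn_iff)

text \<open>It plays two roles. On \<open>Rn (Suc n)\<close> it is the orthogonal projection along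
  the last axis; precomposed with a map that is constrained only on \<open>Rn n\<close>, it gives a
  total measurable map.\<close>

definition trunc :: "nat \<Rightarrow> vec \<Rightarrow> vec" where
  "trunc n x = (\<lambda>i. if i < n then x i else 0)"

lemma trunc_in_Rn [simp]: "trunc n x \<in> Rn n"
  by (simp add: trunc_def Rn_iff)

lemma trunc_id: "x \<in> Rn n \<Longrightarrow> trunc n x = x"
  by (force simp: trunc_def Rn_iff)

lemma trunc_add: "trunc n (x + y) = trunc n x + trunc n y"
  and trunc_scaleR: "trunc n (c *\<^sub>R x) = c *\<^sub>R trunc n x"
  by (auto simp: trunc_def)

lemma trunc_eq_sum: "trunc n x = (\<Sum>i<n. x i *\<^sub>R unit_vec i)"
  by (auto simp: trunc_def unit_vec_def fun_eq_iff if_distrib cong: if_cong)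

lemma borel_measurable_vecI:
  fixes f :: "'a \<Rightarrow> vec"
  assumes "\<And>i. (\<lambda>x. f x i) \<in> borel_measurable M"
  shows "f \<in> borel_measurable M"
  using assms by (rule measurable_coordinatewise_then_product)

lemma measurable_vec_coord [measurable (raw)]:
  fixes f :: "'a \<Rightarrow> vec"
  assumes "f \<in> borel_measurable M"
  shows "(\<lambda>x. f x i) \<in> borel_measurable M"
  using assms by (rule measurable_product_then_coordinatewise)

lemma measurable_vec_add [measurable (raw)]:
  fixes f g :: "'a \<Rightarrow> vec"
  assumes [measurable]: "f \<in> borel_measurable M" "g \<in> borel_measurable M"
  shows "(\<lambda>x. f x + g x) \<in> borel_measurable M"
  by (rule borel_measurable_vecI) simp

lemma measurable_vec_diff [measurable (raw)]:
  fixes f g :: "'a \<Rightarrow> vec"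
  assumes [measurable]: "f \<in> borel_measurable M" "g \<in> borel_measurable M"
  shows "(\<lambda>x. f x - g x) \<in> borel_measurable M"
  by (rule borel_measurable_vecI) simp

lemma measurable_vec_scaleR [measurable (raw)]:
  fixes f :: "'a \<Rightarrow> vec"
  assumes [measurable]: "f \<in> borel_measurable M" "c \<in> borel_measurable M"
  shows "(\<lambda>x. c x *\<^sub>R f x) \<in> borel_measurable M"
  by (rule borel_measurable_vecI) simp

lemma measurable_vec_sum [measurable (raw)]:
  fixes f :: "'i \<Rightarrow> 'a \<Rightarrow> vec"
  assumes [measurable]: "\<And>i. i \<in> I \<Longrightarrow> f i \<in> borel_measurable M"
  shows "(\<lambda>x. \<Sum>i\<in>I. f i x) \<in> borel_measurable M"
  by (rule borel_measurable_vecI) simp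

lemma measurable_vec_upd [measurable (raw)]:
  fixes f :: "'a \<Rightarrow> vec"
  assumes [measurable]: "f \<in> borel_measurable M" "c \<in> borel_measurable M"
  shows "(\<lambda>x. (f x)(k := c x)) \<in> borel_measurable M"
  by (rule borel_measurable_vecI) auto

lemma measurable_trunc [measurable]: "trunc n \<in> borel_measurable borel"
  by (rule borel_measurable_vecI) (auto simp: trunc_def)

lemma continuous_on_vec_add [continuous_intros]:
  fixes f g :: "'a::topological_space \<Rightarrow> vec"
  shows "continuous_on S f \<Longrightarrow> continuous_on S g \<Longrightarrow> continuous_on S (\<lambda>x. f x + g x)"
  by (rule continuous_on_coordinatewise_then_product)
    (auto intro!: continuous_intros intro: continuous_on_product_then_coordinatewise)

lemma continuous_on_vec_diff [continuous_intros]: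
  fixes f g :: "'a::topological_space \<Rightarrow> vec"
  shows "continuous_on S f \<Longrightarrow> continuous_on S g \<Longrightarrow> continuous_on S (\<lambda>x. f x - g x)"
  by (rule continuous_on_coordinatewise_then_product)
    (auto intro!: continuous_intros intro: continuous_on_product_then_coordinatewise)

lemma continuous_on_vec_scaleR [continuous_intros]:
  fixes f :: "'a::topological_space \<Rightarrow> vec"
  shows "continuous_on S f \<Longrightarrow> continuous_on S c \<Longrightarrow> continuous_on S (\<lambda>x. c x *\<^sub>R f x)"
  by (rule continuous_on_coordinatewise_then_product)
    (auto intro!: continuous_intros intro: continuous_on_product_then_coordinatewise)

lemma continuous_on_vec_sum [continuous_intros]:
  fixes f :: "'i \<Rightarrow> 'a::topological_space \<Rightarrow> vec"
  assumes "\<And>i. i \<in> I \<Longrightarrow> continuous_on S (f i)"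
  shows "continuous_on S (\<lambda>x. \<Sum>i\<in>I. f i x)"
proof (rule continuous_on_coordinatewise_then_product)
  show "continuous_on S (\<lambda>x. (\<Sum>i\<in>I. f i x) j)" for j
    using assms by (simp add: continuous_on_sum continuous_on_product_then_coordinatewise)
qed

lemma continuous_on_vec_upd [continuous_intros]:
  fixes f :: "'a::topological_space \<Rightarrow> vec"
  assumes "continuous_on S f" "continuous_on S c"
  shows "continuous_on S (\<lambda>x. (f x)(k := c x))"
proof (rule continuous_on_coordinatewise_then_product)
  show "continuous_on S (\<lambda>x. ((f x)(k := c x)) i)" for i
    using assms by (cases "i = k") (auto intro: continuous_on_product_then_coordinatewise)
qed

lemma continuous_on_vec_coord:
  fixes f :: "'a::topological_space \<Rightarrow> vec"
  shows "continuous_on S f \<Longrightarrow> continuous_on S (\<lambda>x. f x i)"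
  by (rule continuous_on_product_then_coordinatewise)

lemma continuous_on_trunc [continuous_intros]:
  fixes f :: "'a::topological_space \<Rightarrow> vec"
  shows "continuous_on S f \<Longrightarrow> continuous_on S (\<lambda>x. trunc n (f x))"
  unfolding trunc_eq_sum
  by (intro continuous_on_vec_sum continuous_on_vec_scaleR continuous_on_vec_coord continuous_on_const)

lemma closed_Rn [simp]: "closed (Rn n)"
  by (rule closedin_Euclidean_imp_closed[OF closedin_topspace])

lemma compactin_Euclidean_iff: "compactin (Euclidean_space n) K \<longleftrightarrow> compact K \<and> K \<subseteq> Rn n"
  by (simp add: Euclidean_space_def compactin_subtopology euclidean_product_topology)

text \<open>Lebesgue measure of \<open>\<real>\<^sup>n\<close>, carried to zero-padded sequences so
  that all dimensions share one type. A slice in the last coordinate is then simply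
  \<open>x(n := t)\<close>.\<close>

definition lam :: "nat \<Rightarrow> vec measure" where
  "lam n = distr (\<Pi>\<^sub>M i\<in>{..<n}. lborel) borel (\<lambda>x i. if i < n then x i else 0)"

lemma sets_lam [simp, measurable_cong]: "sets (lam n) = sets borel"
  by (simp add: lam_def)

lemma space_lam [simp]: "space (lam n) = UNIV"
  by (simp add: lam_def)

lemma measurable_pad [measurable]:
  "(\<lambda>x i. if i < n then x i else 0) \<in> measurable (\<Pi>\<^sub>M i\<in>{..<n}. lborel) (borel :: vec measure)"
proof (rule borel_measurable_vecI)
  fix i
  show "(\<lambda>x. if i < n then x i else 0) \<in> borel_measurable (\<Pi>\<^sub>M i\<in>{..<n}. lborel)"
    by (cases "i < n") (simp_all add: measurable_component_singleton)
qed

lemma vol_eq_lam: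
  assumes [measurable]: "A \<in> sets borel" and "A \<subseteq> Rn n"
  shows "vol n A = measure (lam n) A"
proof -
  let ?pad = "\<lambda>x i. if i < n then x i else (0::real)"
  have "(\<lambda>x. restrict x {..<n}) ` A = ?pad -` A \<inter> space (\<Pi>\<^sub>M i\<in>{..<n}. lborel)" (is "?L = ?R")
  proof (intro equalityI subsetI)
    fix f assume "f \<in> ?L"
    then obtain x where x: "x \<in> A" "f = restrict x {..<n}" by auto
    with assms have "?pad f = x"
      by (fastforce simp: Rn_iff fun_eq_iff)
    then have "?pad f \<in> A" "f \<in> extensional {..<n}"
      using x by simp_all
    then show "f \<in> ?R"
      by (simp add: space_PiM PiE_def)
  next
    fix f assume f: "f \<in> ?R"
    then have "f = restrict (?pad f) {..<n}"
      by (auto simp: space_PiM PiE_def extensional_def fun_eq_iff)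
    with f show "f \<in> ?L" by blast
  qed
  then show ?thesis
    by (simp add: vol_def lam_def measure_distr)
qed

lemma nn_integral_lam_0:
  assumes [measurable]: "f \<in> borel_measurable borel"
  shows "(\<integral>\<^sup>+x. f x \<partial>lam 0) = f 0"
  unfolding lam_def
  by (subst nn_integral_distr)
     (auto simp: PiM_empty nn_integral_count_space_finite zero_fun_def)

text \<open>Tonelli for the last coordinate. It carries the induction on the dimension for
  translations, dilations and the Brunn-Minkowski inequality.\<close>

lemma nn_integral_lam_Suc:
  assumes [measurable]: "f \<in> borel_measurable borel"
  shows "(\<integral>\<^sup>+x. f x \<partial>lam (Suc n)) = (\<integral>\<^sup>+x. \<integral>\<^sup>+t. f (x(n := t)) \<partial>lborel \<partial>lam n)"
proof -
  interpret product_sigma_finite "\<lambda>_::nat. lborel :: real measure" ..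
  let ?pad = "\<lambda>m x i. if i < m then x i else (0::real)"
  have "(\<integral>\<^sup>+x. f x \<partial>lam (Suc n)) = (\<integral>\<^sup>+x. f (?pad (Suc n) x) \<partial>(\<Pi>\<^sub>M i\<in>{..<Suc n}. lborel))"
    unfolding lam_def by (rule nn_integral_distr) auto
  also have "\<dots> = (\<integral>\<^sup>+x. \<integral>\<^sup>+t. f (?pad (Suc n) (x(n := t))) \<partial>lborel \<partial>(\<Pi>\<^sub>M i\<in>{..<n}. lborel))"
    unfolding lessThan_Suc
    by (rule product_nn_integral_insert)
       (use measurable_compose[OF measurable_pad[of "Suc n"], of f borel] in \<open>auto simp: lessThan_Suc\<close>)
  also have "\<dots> = (\<integral>\<^sup>+x. \<integral>\<^sup>+t. f ((?pad n x)(n := t)) \<partial>lborel \<partial>(\<Pi>\<^sub>M i\<in>{..<n}. lborel))"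
  proof -
    have "?pad (Suc n) (x(n := t)) = (?pad n x)(n := t)" for x :: vec and t
      by (auto simp: fun_eq_iff)
    then show ?thesis by simp
  qed
  also have "\<dots> = (\<integral>\<^sup>+x. \<integral>\<^sup>+t. f (x(n := t)) \<partial>lborel \<partial>lam n)"
    unfolding lam_def by (subst nn_integral_distr) auto
  finally show ?thesis .
qed

lemma emeasure_lam_Suc:
  assumes [measurable]: "A \<in> sets borel"
  shows "emeasure (lam (Suc n)) A = (\<integral>\<^sup>+x. emeasure lborel {t. x(n := t) \<in> A} \<partial>lam n)"
proof -
  have "emeasure (lam (Suc n)) A = (\<integral>\<^sup>+x. \<integral>\<^sup>+t. indicator A (x(n := t)) \<partial>lborel \<partial>lam n)"
    by (subst nn_integral_lam_Suc[symmetric]) auto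
  also have "\<dots> = (\<integral>\<^sup>+x. \<integral>\<^sup>+t. indicator {t. x(n := t) \<in> A} t \<partial>lborel \<partial>lam n)"
    by (simp add: indicator_def)
  also have "\<dots> = (\<integral>\<^sup>+x. emeasure lborel {t. x(n := t) \<in> A} \<partial>lam n)"
  proof (rule nn_integral_cong)
    fix x :: vec
    have "{t\<in>space lborel. x(n := t) \<in> A} \<in> sets lborel" by measurable
    then show "(\<integral>\<^sup>+t. indicator {t. x(n := t) \<in> A} t \<partial>lborel) = emeasure lborel {t. x(n := t) \<in> A}"
      by (simp add: nn_integral_indicator)
  qed
  finally show ?thesis .
qed

lemma AE_lam_Rn: "AE x in lam n. x \<in> Rn n"
proof -
  have "AE x in lam n. n \<le> i \<longrightarrow> x i = 0" for i
  proof (cases "n \<le> i")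
    case True
    have [measurable]: "Measurable.pred borel (\<lambda>x::vec. x i = 0)"
      by measurable
    show ?thesis
      unfolding lam_def by (subst AE_distr_iff) (use True in \<open>simp_all add: pred_def\<close>)
  qed simp
  then have "AE x in lam n. \<forall>i. n \<le> i \<longrightarrow> x i = 0"
    by (rule AE_all_countable[THEN iffD2, rule_format])
  then show ?thesis
    by (simp only: Rn_iff)
qed

lemma nn_integral_lam_cong:
  "(\<And>x. x \<in> Rn n \<Longrightarrow> f x = g x) \<Longrightarrow> (\<integral>\<^sup>+x. f x \<partial>lam n) = (\<integral>\<^sup>+x. g x \<partial>lam n)"
  by (rule nn_integral_cong_AE, rule eventually_mono[OF AE_lam_Rn]) blast

lemma nn_integral_lam_mono:
  "(\<And>x. x \<in> Rn n \<Longrightarrow> f x \<le> g x) \<Longrightarrow> (\<integral>\<^sup>+x. f x \<partial>lam n) \<le> (\<integral>\<^sup>+x. g x \<partial>lam n)"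
  by (rule nn_integral_mono_AE, rule eventually_mono[OF AE_lam_Rn]) blast

section \<open>The Euclidean norm and its balls\<close>

abbreviation vnorm :: "nat \<Rightarrow> vec \<Rightarrow> real" where
  "vnorm n x \<equiv> L2_set x {..<n}"

lemma continuous_on_vnorm: "continuous_on S (\<lambda>x::vec. vnorm n x)"
  unfolding L2_set_def
  by (intro continuous_on_real_sqrt continuous_on_sum continuous_on_power continuous_on_vec_coord
      continuous_on_id)

lemma measurable_vnorm [measurable]: "vnorm n \<in> borel_measurable borel"
  by (intro borel_measurable_continuous_onI continuous_on_vnorm)

lemma vnorm_scaleR: "vnorm n (c *\<^sub>R x) = \<bar>c\<bar> * vnorm n x"
  by (simp add: L2_set_def power_mult_distrib sum_distrib_left[symmetric] real_sqrt_mult)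

lemma vnorm_add_le: "vnorm n (x + y) \<le> vnorm n x + vnorm n y"
  using L2_set_triangle_ineq[of x y "{..<n}"] by (simp add: plus_fun_def)

lemma vnorm_minus: "vnorm n (- x) = vnorm n x"
  by (simp add: L2_set_def)

lemma vnorm_diff_commute: "vnorm n (x - y) = vnorm n (y - x)"
  using vnorm_minus[of "x - y" n] by simp

lemma vnorm_diff_le: "\<bar>vnorm n x - vnorm n y\<bar> \<le> vnorm n (x - y)"
  using vnorm_add_le[of "x - y" y n] vnorm_add_le[of "y - x" x n] vnorm_diff_commute[of x y n]
  by simp

lemma vnorm_zero [simp]: "vnorm n 0 = 0"
  by (simp add: L2_set_def)

lemma vnorm_pos: "x \<in> Rn n \<Longrightarrow> x \<noteq> 0 \<Longrightarrow> vnorm n x > 0"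
proof -
  assume x: "x \<in> Rn n" "x \<noteq> 0"
  have "vnorm n x \<noteq> 0"
  proof
    assume "vnorm n x = 0"
    then have "\<forall>i<n. x i = 0"
      by (subst (asm) L2_set_eq_0_iff) auto
    with x(1) have "x = 0"
      by (metis Rn_iff ext not_le zero_fun_apply)
    with x(2) show False by simp
  qed
  then show ?thesis
    by (simp add: less_le L2_set_nonneg)
qed

lemma unit_ball_iff: "x \<in> unit_ball n \<longleftrightarrow> x \<in> Rn n \<and> vnorm n x \<le> 1"
  by (simp add: unit_ball_def)

lemma abs_coord_le_vnorm: "i < n \<Longrightarrow> \<bar>x i\<bar> \<le> vnorm n x"
  using member_le_L2_set[of "{..<n}" i "\<lambda>i. \<bar>x i\<bar>"] by (simp add: L2_set_def)

text \<open>The topology on sequences is the product topology, where the ball is a closed subset of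
  the cube of sequences with values in [-1, 1]; the cube is compact by Tychonoff.\<close>

lemma compact_unit_ball [simp]: "compact (unit_ball n)"
proof -
  have "compact_space (product_topology (\<lambda>i::nat. subtopology euclideanreal {-1..1}) UNIV)"
    by (subst compact_space_product_topology) (auto simp: compact_space_subtopology)
  then have "compactin (product_topology (\<lambda>i::nat. euclideanreal) UNIV) (\<Pi>\<^sub>E i\<in>UNIV. {-1..1})"
    by (simp add: subtopology_product_topology[symmetric] compactin_subspace)
  then have *: "compact (\<Pi>\<^sub>E i\<in>(UNIV::nat set). {-1..1::real})"
    by (simp add: euclidean_product_topology)
  have "closed (unit_ball n)"
  proof -
    have "unit_ball n = Rn n \<inter> {x. vnorm n x \<le> 1}"
      by (auto simp: unit_ball_iff)
    moreover have "closed {x. vnorm n x \<le> 1}"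
      by (intro closed_Collect_le continuous_on_vnorm continuous_on_const)
    ultimately show ?thesis
      using closed_Rn[of n] by (metis closed_Int)
  qed
  moreover have "unit_ball n \<subseteq> (\<Pi>\<^sub>E i\<in>UNIV. {-1..1})"
  proof
    fix x assume x: "x \<in> unit_ball n"
    have "\<bar>x i\<bar> \<le> 1" for i
    proof (cases "i < n")
      case True
      with x show ?thesis
        using abs_coord_le_vnorm[of i n x] by (simp add: unit_ball_iff)
    next
      case False
      with x show ?thesis
        by (simp add: unit_ball_iff Rn_iff)
    qed
    then show "x \<in> (\<Pi>\<^sub>E i\<in>UNIV. {-1..1})"
      by (simp add: PiE_UNIV_domain abs_le_iff minus_le_iff)
  qed
  ultimately show ?thesis
    using compact_Int_closed[OF *, of "unit_ball n"] by (simp add: Int_absorb1)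
qed

lemma compact_borel: "compact K \<Longrightarrow> K \<in> sets (borel :: vec measure)"
  by (simp add: compact_imp_closed)

lemma unit_ball_borel [simp, measurable]: "unit_ball n \<in> sets borel"
  by (simp add: compact_borel)

lemma emeasure_unit_ball: "emeasure (lam n) (unit_ball n) = ennreal (unit_ball_vol n)"
proof -
  have "unit_ball n \<subseteq> Rn n"
    by (auto simp: unit_ball_iff)
  then have *: "measure (lam n) (unit_ball n) = unit_ball_vol n"
    using vol_unit_ball[of n] vol_eq_lam[of "unit_ball n" n] by simp
  moreover have "unit_ball_vol (real n) > 0" by simp
  ultimately have "emeasure (lam n) (unit_ball n) \<noteq> \<infinity>"
    by (auto simp: measure_def)
  then show ?thesis
    using * by (simp add: emeasure_eq_ennreal_measure top.not_eq_extremum)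
qed

text \<open>Peeling off the last coordinate leaves a shift of the line; the remaining shift by
  \<open>trunc n y\<close> is the induction hypothesis.\<close>

lemma nn_integral_lam_translate:
  assumes "f \<in> borel_measurable borel" "y \<in> Rn n"
  shows "(\<integral>\<^sup>+x. f (x + y) \<partial>lam n) = (\<integral>\<^sup>+x. f x \<partial>lam n)"
  using assms
proof (induction n arbitrary: f y)
  case 0
  then have "y = 0" by (auto simp: Rn_iff)
  then show ?case by simp
next
  case (Suc n)
  note [measurable] = Suc.prems(1)
  \<comment> \<open>Written as \<open>y n + 1 * t\<close> to fit the affine substitution rule on the
    line.\<close>
  have eq: "x(n := t) + y = (x + trunc n y)(n := y n + 1 * t)" for x t
    using Suc.prems(2) by (auto simp: fun_eq_iff trunc_def Rn_iff)
  have "(\<integral>\<^sup>+x. f (x + y) \<partial>lam (Suc n)) = (\<integral>\<^sup>+x. \<integral>\<^sup>+t. f ((x + trunc n y)(n := y n + 1 * t)) \<partial>lborel \<partial>lam n)"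
    by (subst nn_integral_lam_Suc) (simp_all add: eq)
  also have "\<dots> = (\<integral>\<^sup>+x. \<integral>\<^sup>+t. f ((x + trunc n y)(n := t)) \<partial>lborel \<partial>lam n)"
  proof (rule nn_integral_cong)
    fix x
    have "(\<lambda>t. f ((x + trunc n y)(n := t))) \<in> borel_measurable borel" by measurable
    from nn_integral_real_affine[OF this, of 1 "y n"]
    show "(\<integral>\<^sup>+t. f ((x + trunc n y)(n := y n + 1 * t)) \<partial>lborel) = (\<integral>\<^sup>+t. f ((x + trunc n y)(n := t)) \<partial>lborel)"
      by simp
  qed
  also have "\<dots> = (\<integral>\<^sup>+x. \<integral>\<^sup>+t. f (x(n := t)) \<partial>lborel \<partial>lam n)"
    by (rule Suc.IH[OF _ trunc_in_Rn]) measurable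
  also have "\<dots> = (\<integral>\<^sup>+x. f x \<partial>lam (Suc n))"
    by (subst nn_integral_lam_Suc) simp_all
  finally show ?case .
qed

lemma nn_integral_lam_scale:
  assumes "f \<in> borel_measurable borel" "c > 0"
  shows "ennreal (c ^ n) * (\<integral>\<^sup>+x. f (c *\<^sub>R x) \<partial>lam n) = (\<integral>\<^sup>+x. f x \<partial>lam n)"
  using assms(1)
proof (induction n arbitrary: f)
  case 0
  note [measurable] = 0
  have "(\<lambda>x. f (c *\<^sub>R x)) \<in> borel_measurable borel" by measurable
  then show ?case
    using 0 by (simp only: nn_integral_lam_0 scaleR_zero_right) simp
next
  case (Suc n)
  note [measurable] = Suc.prems(1)
  have eq: "(c *\<^sub>R x)(n := 0 + c * t) = c *\<^sub>R (x(n := t))" for x :: vec and t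
    by (auto simp: fun_eq_iff)
  have "(\<integral>\<^sup>+x. f x \<partial>lam (Suc n)) = (\<integral>\<^sup>+x. \<integral>\<^sup>+t. f (x(n := t)) \<partial>lborel \<partial>lam n)"
    by (subst nn_integral_lam_Suc) simp_all
  also have "\<dots> = ennreal (c ^ n) * (\<integral>\<^sup>+x. \<integral>\<^sup>+t. f ((c *\<^sub>R x)(n := t)) \<partial>lborel \<partial>lam n)"
    by (rule Suc.IH[symmetric]) measurable
  also have "\<dots> = ennreal (c ^ n) * (\<integral>\<^sup>+x. ennreal \<bar>c\<bar> * (\<integral>\<^sup>+t. f ((c *\<^sub>R x)(n := 0 + c * t)) \<partial>lborel) \<partial>lam n)"
    using \<open>c > 0\<close>
    by (intro arg_cong[where f = "\<lambda>x. _ * x"] nn_integral_cong nn_integral_real_affine) auto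
  also have "\<dots> = ennreal (c ^ n) * (ennreal c * (\<integral>\<^sup>+x. \<integral>\<^sup>+t. f (c *\<^sub>R (x(n := t))) \<partial>lborel \<partial>lam n))"
    using \<open>c > 0\<close> unfolding eq by (subst nn_integral_cmult) auto
  also have "\<dots> = ennreal (c ^ Suc n) * (\<integral>\<^sup>+x. f (c *\<^sub>R x) \<partial>lam (Suc n))"
    using \<open>c > 0\<close>
    by (subst nn_integral_lam_Suc) (measurable, simp add: ennreal_mult mult_ac del: vec_apply)
  finally show ?case by (simp del: vec_apply)
qed

lemma image_scaleR_eq_vimage:
  fixes A :: "vec set"
  shows "c \<noteq> 0 \<Longrightarrow> (*\<^sub>R) c ` A = (\<lambda>x. (1 / c) *\<^sub>R x) -` A"
  by (force simp: image_iff intro!: bexI[of _ "(1 / c) *\<^sub>R _"])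

lemma borel_image_scaleR:
  fixes A :: "vec set"
  assumes [measurable]: "A \<in> sets borel" and "c \<noteq> 0"
  shows "(*\<^sub>R) c ` A \<in> sets borel"
proof -
  have "(\<lambda>x::vec. (1 / c) *\<^sub>R x) \<in> borel_measurable borel" by measurable
  from measurable_sets[OF this assms(1)] show ?thesis
    using assms(2) by (simp add: image_scaleR_eq_vimage)
qed

lemma emeasure_lam_scale:
  assumes [measurable]: "A \<in> sets borel" and "c > 0"
  shows "emeasure (lam n) ((*\<^sub>R) c ` A) = ennreal (c ^ n) * emeasure (lam n) A"
proof -
  have [measurable]: "(*\<^sub>R) c ` A \<in> sets borel"
    using assms by (intro borel_image_scaleR) auto
  have "emeasure (lam n) ((*\<^sub>R) c ` A) = (\<integral>\<^sup>+x. indicator ((*\<^sub>R) c ` A) x \<partial>lam n)"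
    by simp
  also have "\<dots> = ennreal (c ^ n) * (\<integral>\<^sup>+x. indicator ((*\<^sub>R) c ` A) (c *\<^sub>R x) \<partial>lam n)"
    using assms by (intro nn_integral_lam_scale[symmetric]) auto
  also have "(\<lambda>x. indicator ((*\<^sub>R) c ` A) (c *\<^sub>R x)) = (indicator A :: vec \<Rightarrow> ennreal)"
    using assms(2) by (intro ext) (auto simp: indicator_def)
  finally show ?thesis by (simp del: vec_apply)
qed

lemma ball_subset_scaled_unit_ball:
  assumes "r > 0"
  shows "{x \<in> Rn n. vnorm n x \<le> r} = (*\<^sub>R) r ` unit_ball n"
  using assms
  by (auto simp: image_scaleR_eq_vimage unit_ball_iff vnorm_scaleR Rn_iff field_simps)

text \<open>The set ignores the coordinates from \<open>n\<close> on, so it is larger than the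
  dilated unit ball. The two agree almost everywhere because \<open>lam n\<close> is concentrated on
  \<open>Rn n\<close>.\<close>

lemma emeasure_lam_ball:
  assumes "r > 0"
  shows "emeasure (lam n) {x. vnorm n x \<le> r} = ennreal (r ^ n * unit_ball_vol n)"
proof -
  have "emeasure (lam n) {x. vnorm n x \<le> r} = emeasure (lam n) ((*\<^sub>R) r ` unit_ball n)"
  proof (rule emeasure_eq_AE)
    show "AE x in lam n. (x \<in> {x. vnorm n x \<le> r}) = (x \<in> (*\<^sub>R) r ` unit_ball n)"
      by (rule eventually_mono[OF AE_lam_Rn])
         (use ball_subset_scaled_unit_ball[OF assms, of n] in blast)
    have "{x\<in>space borel. vnorm n x \<le> r} \<in> sets borel" by measurable
    then show "{x. vnorm n x \<le> r} \<in> sets (lam n)" by simp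
    show "(*\<^sub>R) r ` unit_ball n \<in> sets (lam n)"
      using assms by (simp add: borel_image_scaleR)
  qed
  also have "\<dots> = ennreal (r ^ n * unit_ball_vol n)"
    using assms by (simp add: emeasure_lam_scale emeasure_unit_ball ennreal_mult)
  finally show ?thesis .
qed

lemma sigma_finite_lam: "sigma_finite_measure (lam n)"
proof
  let ?B = "\<lambda>k::nat. {x::vec. vnorm n x \<le> real (Suc k)}"
  have "?B k \<in> sets (lam n)" for k
  proof -
    have "{x\<in>space borel. vnorm n x \<le> real (Suc k)} \<in> sets borel" by measurable
    then show ?thesis by simp
  qed
  moreover have "(\<Union>k. ?B k) = UNIV"
  proof -
    have "\<exists>k. vnorm n x \<le> real (Suc k)" for x
      using real_arch_simple[of "vnorm n x"] by (metis le_SucI of_nat_le_iff order.trans order_refl)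
    then show ?thesis by blast
  qed
  ultimately show "\<exists>A. countable A \<and> A \<subseteq> sets (lam n) \<and> \<Union> A = space (lam n) \<and> (\<forall>a\<in>A. emeasure (lam n) a \<noteq> \<infinity>)"
    by (intro exI[of _ "range ?B"]) (auto simp: emeasure_lam_ball simp del: of_nat_Suc)
qed

lemma compact_bounded_vnorm:
  assumes "compact K"
  obtains r where "r > 0" "\<And>x. x \<in> K \<Longrightarrow> vnorm n x \<le> r"
proof (cases "K = {}")
  case False
  then obtain y where "y \<in> K" "\<And>x. x \<in> K \<Longrightarrow> vnorm n x \<le> vnorm n y"
    using continuous_attains_sup[OF assms, of "vnorm n"] continuous_on_vnorm by blast
  then show ?thesis
    using that[of "vnorm n y + 1"] by (smt (verit) L2_set_nonneg)
qed (use that[of 1] in auto)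

lemma emeasure_lam_compact:
  assumes "compact K"
  shows "emeasure (lam n) K < \<infinity>"
proof -
  obtain r where r: "r > 0" "\<And>x. x \<in> K \<Longrightarrow> vnorm n x \<le> r"
    using compact_bounded_vnorm[OF assms] by blast
  have "{x\<in>space borel. vnorm n x \<le> r} \<in> sets borel" by measurable
  then have "emeasure (lam n) K \<le> emeasure (lam n) {x. vnorm n x \<le> r}"
    using r by (intro emeasure_mono) auto
  also have "\<dots> < \<infinity>" using r by (simp add: emeasure_lam_ball)
  finally show ?thesis .
qed

lemma emeasure_lam_eq_measure:
  "compact K \<Longrightarrow> emeasure (lam n) K = ennreal (measure (lam n) K)"
  using emeasure_lam_compact[of K n] by (simp add: emeasure_eq_ennreal_measure less_top)

section \<open>Linear bijections\<close>

text \<open>Uniqueness of Haar measure in disguise: integrating \<open>f\<close> after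
  \<open>S\<close> is a translation invariant functional of \<open>f\<close>, hence a multiple of
  the integral, and the identity says that \<open>f\<close> and \<open>g\<close> see the same
  multiple. Both sides equal the double integral of f(S x + y) g(y). Integrating over x first
  removes y by invariance; shifting y by - S x first moves \<open>S\<close> from \<open>f\<close> to
  \<open>g\<close>.\<close>

lemma nn_integral_lam_Haar:
  fixes S T :: "vec \<Rightarrow> vec" and f g :: "vec \<Rightarrow> ennreal"
  assumes [measurable]: "S \<in> borel_measurable borel" "f \<in> borel_measurable borel" "g \<in> borel_measurable borel"
    and S: "\<And>x. x \<in> Rn n \<Longrightarrow> S x \<in> Rn n" and T: "\<And>x. x \<in> Rn n \<Longrightarrow> T x \<in> Rn n"
    and ST: "\<And>x. x \<in> Rn n \<Longrightarrow> S (T x) = x"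
    and add: "\<And>x y. x \<in> Rn n \<Longrightarrow> y \<in> Rn n \<Longrightarrow> S (x + y) = S x + S y"
    and sym: "\<And>x. g (- x) = g x"
  shows "(\<integral>\<^sup>+x. f (S x) \<partial>lam n) * (\<integral>\<^sup>+x. g x \<partial>lam n) = (\<integral>\<^sup>+x. f x \<partial>lam n) * (\<integral>\<^sup>+x. g (S x) \<partial>lam n)"
proof -
  interpret sigma_finite_measure "lam n" by (rule sigma_finite_lam)
  interpret P: pair_sigma_finite "lam n" "lam n" ..
  have S0: "S 0 = 0"
    using add[of 0 0] by simp
  \<comment> \<open>As y = S (T y), adding y to the value of \<open>S\<close> amounts to shifting x
    by \<open>T y\<close>.\<close>
  have trans: "(\<integral>\<^sup>+x. h (S x + y) \<partial>lam n) = (\<integral>\<^sup>+x. h (S x) \<partial>lam n)"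
    if [measurable]: "h \<in> borel_measurable borel" and "y \<in> Rn n" for h :: "vec \<Rightarrow> ennreal" and y
  proof -
    have "(\<integral>\<^sup>+x. h (S x + y) \<partial>lam n) = (\<integral>\<^sup>+x. h (S (x + T y)) \<partial>lam n)"
      using that by (intro nn_integral_lam_cong) (simp add: add T ST del: vec_apply)
    also have "\<dots> = (\<integral>\<^sup>+x. h (S x) \<partial>lam n)"
      using that T by (intro nn_integral_lam_translate) auto
    finally show ?thesis .
  qed
  have "(\<integral>\<^sup>+x. f (S x) \<partial>lam n) * (\<integral>\<^sup>+x. g x \<partial>lam n) = (\<integral>\<^sup>+y. (\<integral>\<^sup>+x. f (S x) \<partial>lam n) * g y \<partial>lam n)"
    by (rule nn_integral_cmult[symmetric]) simp
  also have "\<dots> = (\<integral>\<^sup>+y. (\<integral>\<^sup>+x. f (S x + y) * g y \<partial>lam n) \<partial>lam n)"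
  proof (rule nn_integral_lam_cong)
    fix y assume "y \<in> Rn n"
    then have "(\<integral>\<^sup>+x. f (S x + y) \<partial>lam n) = (\<integral>\<^sup>+x. f (S x) \<partial>lam n)"
      by (intro trans) auto
    moreover have "(\<integral>\<^sup>+x. f (S x + y) * g y \<partial>lam n) = (\<integral>\<^sup>+x. f (S x + y) \<partial>lam n) * g y"
      by (rule nn_integral_multc) measurable
    ultimately show "(\<integral>\<^sup>+x. f (S x) \<partial>lam n) * g y = (\<integral>\<^sup>+x. f (S x + y) * g y \<partial>lam n)"
      by simp
  qed
  also have "\<dots> = (\<integral>\<^sup>+x. (\<integral>\<^sup>+y. f (S x + y) * g y \<partial>lam n) \<partial>lam n)"
    using P.Fubini'[of "\<lambda>x y. f (S x + y) * g y"] by measurable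
  \<comment> \<open>Shift y by - S x; the symmetry of \<open>g\<close> absorbs the resulting
    sign.\<close>
  also have "\<dots> = (\<integral>\<^sup>+x. (\<integral>\<^sup>+y. f y * g (S x - y) \<partial>lam n) \<partial>lam n)"
  proof (rule nn_integral_lam_cong)
    fix x assume "x \<in> Rn n"
    then have x: "- S x \<in> Rn n" using S by auto
    have "(\<integral>\<^sup>+y. f (S x + y) * g y \<partial>lam n) = (\<integral>\<^sup>+y. f (S x + (y + - S x)) * g (y + - S x) \<partial>lam n)"
      by (rule nn_integral_lam_translate[OF _ x, symmetric]) measurable
    also have "\<dots> = (\<integral>\<^sup>+y. f y * g (S x - y) \<partial>lam n)"
    proof (rule nn_integral_cong)
      fix y
      have "S x + (y + - S x) = y" "y + - S x = - (S x - y)"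
        by (simp_all add: algebra_simps del: vec_apply)
      then show "f (S x + (y + - S x)) * g (y + - S x) = f y * g (S x - y)"
        by (simp only: sym)
    qed
    finally show "(\<integral>\<^sup>+y. f (S x + y) * g y \<partial>lam n) = (\<integral>\<^sup>+y. f y * g (S x - y) \<partial>lam n)" .
  qed
  also have "\<dots> = (\<integral>\<^sup>+y. (\<integral>\<^sup>+x. f y * g (S x - y) \<partial>lam n) \<partial>lam n)"
    by (rule P.Fubini'[of "\<lambda>x y. f y * g (S x - y)", symmetric]) measurable
  also have "\<dots> = (\<integral>\<^sup>+y. f y * (\<integral>\<^sup>+x. g (S x) \<partial>lam n) \<partial>lam n)"
  proof (rule nn_integral_lam_cong)
    fix y assume "y \<in> Rn n"
    then have "(\<integral>\<^sup>+x. g (S x + - y) \<partial>lam n) = (\<integral>\<^sup>+x. g (S x) \<partial>lam n)"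
      by (intro trans subspace_neg[OF subspace_Rn]) auto
    moreover have "(\<integral>\<^sup>+x. f y * g (S x - y) \<partial>lam n) = f y * (\<integral>\<^sup>+x. g (S x + - y) \<partial>lam n)"
      unfolding add_uminus_conv_diff by (rule nn_integral_cmult) measurable
    ultimately show "(\<integral>\<^sup>+x. f y * g (S x - y) \<partial>lam n) = f y * (\<integral>\<^sup>+x. g (S x) \<partial>lam n)"
      by simp
  qed
  also have "\<dots> = (\<integral>\<^sup>+x. f x \<partial>lam n) * (\<integral>\<^sup>+x. g (S x) \<partial>lam n)"
    by (rule nn_integral_multc) measurable
  finally show ?thesis .
qed

section \<open>The general linear group and its change of variables\<close>

lemma GL_iff:
  "T \<in> GL n \<longleftrightarrow> bij_betw T (Rn n) (Rn n) \<and>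
     (\<forall>x\<in>Rn n. \<forall>y\<in>Rn n. T (x + y) = T x + T y) \<and> (\<forall>a. \<forall>x\<in>Rn n. T (a *\<^sub>R x) = a *\<^sub>R T x)"
  by (simp add: GL_def plus_fun_def scaleR_fun_def)

lemma GLI:
  assumes "\<And>x. x \<in> Rn n \<Longrightarrow> T x \<in> Rn n" "\<And>x. x \<in> Rn n \<Longrightarrow> S x \<in> Rn n"
    "\<And>x. x \<in> Rn n \<Longrightarrow> S (T x) = x" "\<And>x. x \<in> Rn n \<Longrightarrow> T (S x) = x"
    "\<And>x y. x \<in> Rn n \<Longrightarrow> y \<in> Rn n \<Longrightarrow> T (x + y) = T x + T y"
    "\<And>a x. x \<in> Rn n \<Longrightarrow> T (a *\<^sub>R x) = a *\<^sub>R T x"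
  shows "T \<in> GL n"
  unfolding GL_iff using assms by (auto intro!: bij_betwI[of T _ _ S])

lemma GL_image: "T \<in> GL n \<Longrightarrow> T ` Rn n = Rn n"
  and GL_inj: "T \<in> GL n \<Longrightarrow> inj_on T (Rn n)"
  and GL_add: "T \<in> GL n \<Longrightarrow> x \<in> Rn n \<Longrightarrow> y \<in> Rn n \<Longrightarrow> T (x + y) = T x + T y"
  and GL_scaleR: "T \<in> GL n \<Longrightarrow> x \<in> Rn n \<Longrightarrow> T (a *\<^sub>R x) = a *\<^sub>R T x"
  by (auto simp: GL_iff bij_betw_def)

lemma GL_in_Rn: "T \<in> GL n \<Longrightarrow> x \<in> Rn n \<Longrightarrow> T x \<in> Rn n"
  using GL_image by blast

lemma GL_zero: "T \<in> GL n \<Longrightarrow> T 0 = 0"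
  using GL_scaleR[of T n 0 0] by simp

lemma GL_inv_right: "T \<in> GL n \<Longrightarrow> x \<in> Rn n \<Longrightarrow> T (inv_into (Rn n) T x) = x"
  using f_inv_into_f[of x T "Rn n"] by (simp add: GL_image)

lemma GL_inv_left: "T \<in> GL n \<Longrightarrow> x \<in> Rn n \<Longrightarrow> inv_into (Rn n) T (T x) = x"
  by (simp add: GL_inj)

lemma GL_inv: 
  assumes "T \<in> GL n"
  shows "inv_into (Rn n) T \<in> GL n"
proof (rule GLI)
  note [simp] = GL_inv_right[OF assms] GL_inv_left[OF assms] GL_in_Rn[OF assms]
  show S: "inv_into (Rn n) T x \<in> Rn n" if "x \<in> Rn n" for x
    using that by (intro inv_into_into) (simp add: GL_image assms)
  show "T x \<in> Rn n" if "x \<in> Rn n" for x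
    using that by simp
  show "T (inv_into (Rn n) T x) = x" "inv_into (Rn n) T (T x) = x" if "x \<in> Rn n" for x
    using that by simp_all
  show "inv_into (Rn n) T (x + y) = inv_into (Rn n) T x + inv_into (Rn n) T y"
    if "x \<in> Rn n" "y \<in> Rn n" for x y
  proof -
    have "inv_into (Rn n) T (T (inv_into (Rn n) T x + inv_into (Rn n) T y)) = inv_into (Rn n) T x + inv_into (Rn n) T y"
      using that S by (intro GL_inv_left[OF assms]) auto
    then show ?thesis
      using that S by (simp add: GL_add[OF assms] del: vec_apply)
  qed
  show "inv_into (Rn n) T (a *\<^sub>R x) = a *\<^sub>R inv_into (Rn n) T x" if "x \<in> Rn n" for a x
  proof -
    have "inv_into (Rn n) T (T (a *\<^sub>R inv_into (Rn n) T x)) = a *\<^sub>R inv_into (Rn n) T x"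
      using that S by (intro GL_inv_left[OF assms]) auto
    then show ?thesis
      using that S by (simp add: GL_scaleR[OF assms] del: vec_apply)
  qed
qed

lemma GL_sum:
  assumes "T \<in> GL n" "\<And>i. i \<in> I \<Longrightarrow> f i \<in> Rn n"
  shows "T (\<Sum>i\<in>I. f i) = (\<Sum>i\<in>I. T (f i))"
  using assms(2)
  by (induction I rule: infinite_finite_induct) (auto simp: GL_zero[OF assms(1)] GL_add[OF assms(1)] simp del: vec_apply)

lemma GL_trunc:
  assumes "T \<in> GL n"
  shows "T (trunc n x) = (\<Sum>i<n. x i *\<^sub>R T (unit_vec i))"
  unfolding trunc_eq_sum using assms
  by (subst GL_sum) (auto simp: GL_scaleR simp del: vec_apply)

lemma measurable_GL: "T \<in> GL n \<Longrightarrow> (\<lambda>x. T (trunc n x)) \<in> borel_measurable borel"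
  by (simp only: GL_trunc) measurable

lemma continuous_on_GL: 
  assumes "T \<in> GL n"
  shows "continuous_on (Rn n) T"
proof -
  have "continuous_on (Rn n) (\<lambda>x. T (trunc n x))"
    unfolding GL_trunc[OF assms]
    by (intro continuous_on_vec_sum continuous_on_vec_scaleR continuous_on_vec_coord continuous_on_const continuous_on_id)
  then show ?thesis
    by (rule continuous_on_eq) (simp add: trunc_id)
qed

lemma compact_GL: "T \<in> GL n \<Longrightarrow> compact K \<Longrightarrow> K \<subseteq> Rn n \<Longrightarrow> compact (T ` K)"
  by (rule compact_continuous_image[OF continuous_on_subset[OF continuous_on_GL]])

lemma GL_image_eq_vimage:
  assumes "T \<in> GL n" "A \<subseteq> Rn n"
  shows "T ` A = Rn n \<inter> (\<lambda>x. inv_into (Rn n) T (trunc n x)) -` A"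
proof (intro equalityI subsetI)
  fix y assume "y \<in> T ` A"
  then show "y \<in> Rn n \<inter> (\<lambda>x. inv_into (Rn n) T (trunc n x)) -` A"
    using assms by (auto simp: trunc_id GL_inv_left GL_in_Rn subset_eq)
next
  fix y assume "y \<in> Rn n \<inter> (\<lambda>x. inv_into (Rn n) T (trunc n x)) -` A"
  then show "y \<in> T ` A"
    using GL_inv_right[OF assms(1), of y]
    by (auto simp: trunc_id intro!: image_eqI[of _ _ "inv_into (Rn n) T y"])
qed

lemma borel_GL:
  assumes "T \<in> GL n" "A \<in> sets borel" "A \<subseteq> Rn n"
  shows "T ` A \<in> sets borel"
  unfolding GL_image_eq_vimage[OF assms(1,3)]
  using measurable_sets[OF measurable_GL[OF GL_inv[OF assms(1)]] assms(2)]
  by (intro sets.Int) auto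

lemma unit_ball_vol_nat_pos [simp]: "unit_ball_vol (real n) > 0" "unit_ball_vol (real n) \<noteq> 0"
  "\<not> unit_ball_vol (real n) \<le> 0"
  using unit_ball_vol_pos[of "real n"] by linarith+

text \<open>The modulus of the determinant, read off from the image of the unit ball instead of a
  matrix. That every other set is scaled by the same factor is
  \<open>emeasure_lam_GL\<close>.\<close>

definition absdet :: "nat \<Rightarrow> (vec \<Rightarrow> vec) \<Rightarrow> real" where
  "absdet n T = measure (lam n) (T ` unit_ball n) / unit_ball_vol n"

lemma unit_ball_subset_Rn: "unit_ball n \<subseteq> Rn n"
  by (auto simp: unit_ball_iff)

lemma absdet_nonneg: "absdet n T \<ge> 0"
  by (simp add: absdet_def)

text \<open>The Haar identity for the inverse of \<open>T\<close>, tested against the indicator of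
  the unit ball: the ball is symmetric, has positive finite volume, and pulls back to its image
  under \<open>T\<close>.\<close>

lemma nn_integral_lam_GL:
  assumes T: "T \<in> GL n" and f [measurable]: "f \<in> borel_measurable borel"
  shows "ennreal (absdet n T) * (\<integral>\<^sup>+x. f (T (trunc n x)) \<partial>lam n) = (\<integral>\<^sup>+x. f x \<partial>lam n)"
proof -
  define S where "S = (\<lambda>x. inv_into (Rn n) T (trunc n x))"
  have [measurable]: "S \<in> borel_measurable borel" "(\<lambda>x. T (trunc n x)) \<in> borel_measurable borel"
    unfolding S_def by (intro measurable_GL GL_inv T)+
  have SR: "S x \<in> Rn n" for x
    unfolding S_def by (rule GL_in_Rn[OF GL_inv[OF T]]) simp
  have "(\<integral>\<^sup>+x. f (T (trunc n (S x))) \<partial>lam n) * (\<integral>\<^sup>+x. indicator (unit_ball n) x \<partial>lam n) =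
        (\<integral>\<^sup>+x. f (T (trunc n x)) \<partial>lam n) * (\<integral>\<^sup>+x. indicator (unit_ball n) (S x) \<partial>lam n)"
  proof (rule nn_integral_lam_Haar[where T = T and f = "\<lambda>x. f (T (trunc n x))"])
    show "S (x + y) = S x + S y" if "x \<in> Rn n" "y \<in> Rn n" for x y
      using that unfolding S_def trunc_add
      by (intro GL_add[OF GL_inv[OF T]]) (simp_all del: vec_apply)
    show "indicator (unit_ball n) (- x) = (indicator (unit_ball n) x :: ennreal)" for x
      using vnorm_minus[of x n] by (simp add: indicator_def unit_ball_iff Rn_iff)
    show "S x \<in> Rn n" "T x \<in> Rn n" "S (T x) = x" if "x \<in> Rn n" for x
      using that SR[of x] T by (simp_all add: GL_in_Rn) (simp add: S_def trunc_id GL_in_Rn GL_inv_left)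
  qed simp_all
  moreover have "(\<integral>\<^sup>+x. f (T (trunc n (S x))) \<partial>lam n) = (\<integral>\<^sup>+x. f x \<partial>lam n)"
  proof (rule nn_integral_lam_cong)
    fix x assume "x \<in> Rn n"
    then show "f (T (trunc n (S x))) = f x"
      using SR[of x] by (simp add: trunc_id) (simp add: S_def trunc_id GL_inv_right[OF T])
  qed
  moreover have "(\<integral>\<^sup>+x. indicator (unit_ball n) (S x) \<partial>lam n) = ennreal (absdet n T * unit_ball_vol n)"
  proof -
    have TB: "T ` unit_ball n \<in> sets borel"
      by (intro borel_GL[where n = n] T unit_ball_subset_Rn) simp
    have "(\<integral>\<^sup>+x. indicator (unit_ball n) (S x) \<partial>lam n) = (\<integral>\<^sup>+x. indicator (T ` unit_ball n) x \<partial>lam n)"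
      by (rule nn_integral_lam_cong)
         (auto simp: indicator_def GL_image_eq_vimage[OF T unit_ball_subset_Rn] S_def)
    also have "\<dots> = emeasure (lam n) (T ` unit_ball n)"
      using TB by (intro nn_integral_indicator) simp
    also have "\<dots> = ennreal (measure (lam n) (T ` unit_ball n))"
      by (intro emeasure_lam_eq_measure compact_GL[where n = n] T unit_ball_subset_Rn) simp
    finally show ?thesis
      by (simp add: absdet_def)
  qed
  ultimately have "(\<integral>\<^sup>+x. f x \<partial>lam n) * ennreal (unit_ball_vol n) =
      ennreal (unit_ball_vol n) * (ennreal (absdet n T) * (\<integral>\<^sup>+x. f (T (trunc n x)) \<partial>lam n))"
    by (simp add: emeasure_unit_ball ennreal_mult absdet_nonneg mult_ac)
  moreover have "ennreal (unit_ball_vol n) \<noteq> 0"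
    by (simp add: ennreal_eq_0_iff not_le)
  ultimately show ?thesis
    by (metis ennreal_mult_cancel_left ennreal_neq_top infinity_ennreal_def mult.commute)
qed

lemma absdet_pos: 
  assumes "T \<in> GL n"
  shows "absdet n T > 0"
proof (rule ccontr)
  assume "\<not> ?thesis"
  then have "absdet n T = 0"
    using absdet_nonneg[of n T] by simp
  then have "(\<integral>\<^sup>+x. indicator (unit_ball n) x \<partial>lam n) = 0"
    using nn_integral_lam_GL[OF assms, of "indicator (unit_ball n)"] by simp
  then show False
    using emeasure_unit_ball[of n] by (simp add: ennreal_eq_0_iff not_le)
qed

lemma emeasure_lam_GL:
  assumes "T \<in> GL n" "A \<in> sets borel" "A \<subseteq> Rn n"
  shows "emeasure (lam n) (T ` A) = ennreal (absdet n T) * emeasure (lam n) A"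
proof -
  have [measurable]: "T ` A \<in> sets borel" by (rule borel_GL[OF assms])
  have "(\<integral>\<^sup>+x. indicator (T ` A) (T (trunc n x)) \<partial>lam n) = (\<integral>\<^sup>+x. indicator A x \<partial>lam n)"
  proof (rule nn_integral_lam_cong)
    fix x assume "x \<in> Rn n"
    then show "indicator (T ` A) (T (trunc n x)) = (indicator A x :: ennreal)"
      using inj_on_image_mem_iff[OF GL_inj[OF assms(1)] _ assms(3), of x]
      by (simp add: trunc_id indicator_def)
  qed
  then show ?thesis
    using nn_integral_lam_GL[OF assms(1), of "indicator (T ` A)"] assms(2) by simp
qed

lemma measure_lam_GL:
  assumes "T \<in> GL n" "A \<in> sets borel" "A \<subseteq> Rn n"
  shows "measure (lam n) (T ` A) = absdet n T * measure (lam n) A"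
  by (simp add: measure_def emeasure_lam_GL[OF assms] enn2real_mult absdet_nonneg)

lemma absdet_isometry:
  assumes "T \<in> GL n" "\<And>x. x \<in> Rn n \<Longrightarrow> vnorm n (T x) = vnorm n x"
  shows "absdet n T = 1"
proof -
  have "T ` unit_ball n = unit_ball n"
  proof (intro equalityI subsetI)
    fix y assume "y \<in> T ` unit_ball n"
    then show "y \<in> unit_ball n"
      using assms by (auto simp: unit_ball_iff GL_in_Rn)
  next
    fix y assume y: "y \<in> unit_ball n"
    then have "y \<in> T ` Rn n"
      by (simp add: unit_ball_iff GL_image[OF assms(1)])
    with y show "y \<in> T ` unit_ball n"
      using assms by (auto simp: unit_ball_iff)
  qed
  then show ?thesis
    using emeasure_unit_ball[of n] by (simp add: absdet_def measure_def)
qed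

section \<open>Volume growth along a segment\<close>

abbreviation V :: "nat \<Rightarrow> vec set \<Rightarrow> real" where
  "V n A \<equiv> measure (lam n) A"

definition compact_convex :: "nat \<Rightarrow> vec set \<Rightarrow> bool" where
  "compact_convex n K \<longleftrightarrow> compact K \<and> convex K \<and> K \<subseteq> Rn n"

lemma compact_convexD:
  assumes "compact_convex n K"
  shows "compact K" "convex K" "K \<subseteq> Rn n" "K \<in> sets borel"
  using assms by (auto simp: compact_convex_def intro: compact_borel)

lemma V_mono: "compact A \<Longrightarrow> compact B \<Longrightarrow> A \<subseteq> B \<Longrightarrow> V n A \<le> V n B"
  using emeasure_lam_compact[of B n]
  by (intro measure_mono_fmeasurable) (auto simp: fmeasurable_def compact_borel)

lemma compact_translate: "compact A \<Longrightarrow> compact ((+) (y::vec) ` A)"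
  by (intro compact_continuous_image continuous_on_vec_add continuous_on_const continuous_on_id)

lemma compact_scaleR: "compact A \<Longrightarrow> compact ((*\<^sub>R) c ` (A :: vec set))"
  by (intro compact_continuous_image continuous_on_vec_scaleR continuous_on_const continuous_on_id)

lemma V_translate:
  assumes "compact A" "y \<in> Rn n"
  shows "V n ((+) y ` A) = V n A"
proof -
  have [measurable]: "(+) y ` A \<in> sets borel" "A \<in> sets borel"
    using assms by (simp_all add: compact_borel compact_translate del: vec_apply)
  have "(\<integral>\<^sup>+x. indicator ((+) y ` A) (x + y) \<partial>lam n) = (\<integral>\<^sup>+x. indicator ((+) y ` A) x \<partial>lam n)"
    using assms by (intro nn_integral_lam_translate) auto
  moreover have "indicator ((+) y ` A) (x + y) = (indicator A x :: ennreal)" for x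
    by (auto simp: indicator_def add.commute[of y])
  ultimately have "emeasure (lam n) ((+) y ` A) = emeasure (lam n) A"
    by simp
  then show ?thesis by (simp add: measure_def)
qed

lemma V_scaleR: "compact A \<Longrightarrow> c > 0 \<Longrightarrow> V n ((*\<^sub>R) c ` A) = c ^ n * V n A"
  by (simp add: measure_def emeasure_lam_scale compact_borel enn2real_mult)

lemma compact_convex_translate:
  assumes "compact_convex n K" "y \<in> Rn n"
  shows "compact_convex n ((+) y ` K)"
  using assms compact_translate[of K y] convex_translation[of K y]
  by (auto simp: compact_convex_def)

lemma compact_convex_scaleR:
  assumes "compact_convex n K"
  shows "compact_convex n ((*\<^sub>R) c ` K)"
  using assms compact_scaleR[of K c] convex_scaling[of K c]
  by (auto simp: compact_convex_def)

lemma compact_convex_GL: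
  assumes "compact_convex n K" and T: "T \<in> GL n"
  shows "compact_convex n (T ` K)"
  unfolding compact_convex_def
proof (intro conjI)
  have K: "K \<subseteq> Rn n" "convex K" "compact K" using assms by (auto simp: compact_convex_def)
  show "compact (T ` K)" using K T by (intro compact_GL)
  show "T ` K \<subseteq> Rn n" using K GL_in_Rn[OF T] by auto
  show "convex (T ` K)"
  proof (rule convexI)
    fix x y u v assume *: "x \<in> T ` K" "y \<in> T ` K" "0 \<le> u" "0 \<le> v" "u + v = (1::real)"
    then obtain a b where ab: "x = T a" "y = T b" "a \<in> K" "b \<in> K" by auto
    then have "a \<in> Rn n" "b \<in> Rn n" using K by auto
    then have "u *\<^sub>R x + v *\<^sub>R y = T (u *\<^sub>R a + v *\<^sub>R b)"
      unfolding ab by (simp add: GL_add[OF T] GL_scaleR[OF T] subspace_scale[OF subspace_Rn] del: vec_apply)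
    moreover have "u *\<^sub>R a + v *\<^sub>R b \<in> K"
      using K(2) ab * by (intro convexD) auto
    ultimately show "u *\<^sub>R x + v *\<^sub>R y \<in> T ` K" by blast
  qed
qed

lemma V_GL: "T \<in> GL n \<Longrightarrow> compact_convex n K \<Longrightarrow> V n (T ` K) = absdet n T * V n K"
  by (intro measure_lam_GL) (auto dest: compact_convexD)

lemma compact_convex_trunc:
  assumes "compact_convex m K"
  shows "compact_convex n (trunc n ` K)"
  unfolding compact_convex_def
proof (intro conjI)
  show "compact (trunc n ` K)"
    using compact_convexD[OF assms] by (intro compact_continuous_image continuous_on_trunc continuous_on_id)
  show "convex (trunc n ` K)"
  proof (rule convexI)
    fix x y u v assume *: "x \<in> trunc n ` K" "y \<in> trunc n ` K" "0 \<le> u" "0 \<le> v" "u + v = (1::real)"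
    then obtain a b where ab: "x = trunc n a" "y = trunc n b" "a \<in> K" "b \<in> K" by auto
    then have "u *\<^sub>R x + v *\<^sub>R y = trunc n (u *\<^sub>R a + v *\<^sub>R b)"
      by (simp add: trunc_add trunc_scaleR del: vec_apply)
    moreover have "u *\<^sub>R a + v *\<^sub>R b \<in> K"
      using compact_convexD(2)[OF assms] ab * by (intro convexD) auto
    ultimately show "u *\<^sub>R x + v *\<^sub>R y \<in> trunc n ` K" by blast
  qed
qed auto

text \<open>The Minkowski sum K + [0, u]. Its companion \<open>sym_sweep\<close> is K + [-u, u], a
  translate of K + [0, 2u].\<close>

definition sweep :: "vec set \<Rightarrow> vec \<Rightarrow> vec set" where
  "sweep K u = (\<lambda>(x, t). x + t *\<^sub>R u) ` (K \<times> {0..1})"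

definition sym_sweep :: "vec set \<Rightarrow> vec \<Rightarrow> vec set" where
  "sym_sweep K u = (\<lambda>(x, t). x + t *\<^sub>R u) ` (K \<times> {-1..1})"

lemma compact_convex_sweep_aux:
  assumes "compact_convex n K" "u \<in> Rn n"
  shows "compact_convex n ((\<lambda>(x, t). x + t *\<^sub>R u) ` (K \<times> {a..b}))"
  unfolding compact_convex_def
proof (intro conjI)
  note K = compact_convexD[OF assms(1)]
  show "compact ((\<lambda>(x, t). x + t *\<^sub>R u) ` (K \<times> {a..b}))"
    unfolding case_prod_beta using K
    by (intro compact_continuous_image compact_Times continuous_on_vec_add continuous_on_vec_scaleR
      continuous_on_const continuous_on_fst continuous_on_snd continuous_on_id) auto
  show "(\<lambda>(x, t). x + t *\<^sub>R u) ` (K \<times> {a..b}) \<subseteq> Rn n"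
    using K assms(2) by auto
  have "linear (\<lambda>(x, t). x + t *\<^sub>R u)"
    by (rule linearI) (auto simp: algebra_simps scaleR_add_left simp del: vec_apply)
  then show "convex ((\<lambda>(x, t). x + t *\<^sub>R u) ` (K \<times> {a..b}))"
    using K by (intro convex_linear_image convex_Times) auto
qed

lemma compact_convex_sweep: "compact_convex n K \<Longrightarrow> u \<in> Rn n \<Longrightarrow> compact_convex n (sweep K u)"
  and compact_convex_sym_sweep: "compact_convex n K \<Longrightarrow> u \<in> Rn n \<Longrightarrow> compact_convex n (sym_sweep K u)"
  unfolding sweep_def sym_sweep_def by (fact compact_convex_sweep_aux)+

lemma subset_sweep: "K \<subseteq> sweep K u"
proof
  fix x assume "x \<in> K"
  then show "x \<in> sweep K u"
    unfolding sweep_def by (intro image_eqI[of _ _ "(x, 0)"]) auto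
qed

lemma subset_sym_sweep: "K \<subseteq> sym_sweep K u"
proof
  fix x assume "x \<in> K"
  then show "x \<in> sym_sweep K u"
    unfolding sym_sweep_def by (intro image_eqI[of _ _ "(x, 0)"]) auto
qed

lemma sweep_zero: "sweep K 0 = K"
  using subset_sweep[of K 0] by (auto simp: sweep_def)

lemma sweep_GL:
  assumes T: "T \<in> GL n" and "K \<subseteq> Rn n" "u \<in> Rn n"
  shows "T ` sweep K u = sweep (T ` K) (T u)"
proof -
  have "T (x + t *\<^sub>R u) = T x + t *\<^sub>R T u" if "x \<in> K" for x t
    using that assms by (simp add: GL_add[OF T] GL_scaleR[OF T] subset_eq subspace_scale[OF subspace_Rn] del: vec_apply)
  then show ?thesis
    unfolding sweep_def by (fastforce simp: image_iff simp del: vec_apply)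
qed

lemma sweep_scaleR: "(*\<^sub>R) c ` sweep K u = sweep ((*\<^sub>R) c ` K) (c *\<^sub>R u)"
proof -
  have "c *\<^sub>R (x + t *\<^sub>R u) = c *\<^sub>R x + t *\<^sub>R c *\<^sub>R u" for x t
    by (simp add: algebra_simps del: vec_apply)
  then show ?thesis
    unfolding sweep_def by (fastforce simp: image_iff simp del: vec_apply)
qed

lemma sweep_translate: "(+) y ` sweep K u = sweep ((+) y ` K) u"
  unfolding sweep_def by (fastforce simp: image_iff add.assoc simp del: vec_apply)

lemma sym_sweep_eq: "sym_sweep K u = (+) (- u) ` sweep K (2 *\<^sub>R u)"
proof (intro equalityI subsetI)
  fix y assume "y \<in> sym_sweep K u"
  then obtain x t where xt: "x \<in> K" "-1 \<le> t" "t \<le> 1" "y = x + t *\<^sub>R u"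
    by (auto simp: sym_sweep_def)
  then have "y = - u + (x + ((t + 1) / 2) *\<^sub>R (2 *\<^sub>R u))"
    by (auto simp: fun_eq_iff field_simps)
  then show "y \<in> (+) (- u) ` sweep K (2 *\<^sub>R u)"
    using xt unfolding sweep_def by (intro image_eqI[OF _ image_eqI[of _ _ "(x, (t + 1) / 2)"]]) auto
next
  fix y assume "y \<in> (+) (- u) ` sweep K (2 *\<^sub>R u)"
  then obtain x t where xt: "x \<in> K" "0 \<le> t" "t \<le> 1" "y = - u + (x + t *\<^sub>R (2 *\<^sub>R u))"
    by (auto simp: sweep_def)
  then have "y = x + (2 * t - 1) *\<^sub>R u"
    by (auto simp: fun_eq_iff field_simps)
  then show "y \<in> sym_sweep K u"
    using xt unfolding sym_sweep_def by (intro image_eqI[of _ _ "(x, 2 * t - 1)"]) auto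
qed

definition growth :: "nat \<Rightarrow> vec set \<Rightarrow> vec \<Rightarrow> real" where
  "growth n K u = V n (sweep K u) - V n K"

lemma growth_nonneg: "compact_convex n K \<Longrightarrow> u \<in> Rn n \<Longrightarrow> growth n K u \<ge> 0"
  unfolding growth_def
  using V_mono[OF _ _ subset_sweep, of K u n] compact_convex_sweep[of n K u] 
  by (simp add: compact_convex_def)

lemma growth_GL:
  assumes "T \<in> GL n" "compact_convex n K" "u \<in> Rn n"
  shows "growth n (T ` K) (T u) = absdet n T * growth n K u"
  using assms compact_convex_sweep[of n K u] sweep_GL[of T n K u]
  by (simp add: growth_def V_GL[symmetric] right_diff_distrib compact_convexD)

lemma slice_interval:
  assumes "compact_convex m K"
  obtains "{t. x(n := t) \<in> K} = {}" | p q where "p \<le> q" "{t. x(n := t) \<in> K} = {p..q}"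
proof -
  note K = compact_convexD[OF assms]
  let ?I = "{t. x(n := t) \<in> K}"
  have "continuous_on UNIV (\<lambda>t. x(n := t))"
    by (intro continuous_on_vec_upd continuous_on_const continuous_on_id)
  then have "closed ((\<lambda>t. x(n := t)) -` K)"
    using K by (intro closed_vimage) (auto intro: compact_imp_closed)
  moreover have "compact ((\<lambda>y. y n) ` K)"
    using K by (intro compact_continuous_image continuous_on_vec_coord continuous_on_id)
  moreover have "?I \<subseteq> (\<lambda>y. y n) ` K"
    by (force intro: rev_image_eqI)
  ultimately have "compact ?I"
    using compact_Int_closed[of "(\<lambda>y. y n) ` K" ?I] by (simp add: vimage_def Int_absorb1)
  moreover have "convex ?I"
  proof (rule convexI)
    fix s t u v assume *: "s \<in> ?I" "t \<in> ?I" "0 \<le> u" "0 \<le> v" "u + v = (1::real)"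
    then have "u *\<^sub>R x(n := s) + v *\<^sub>R x(n := t) \<in> K"
      using K by (intro convexD) auto
    moreover have "u *\<^sub>R x(n := s) + v *\<^sub>R x(n := t) = x(n := u *\<^sub>R s + v *\<^sub>R t)"
      using * by (auto simp: fun_eq_iff simp flip: distrib_right)
    ultimately show "u *\<^sub>R s + v *\<^sub>R t \<in> ?I" by simp
  qed
  ultimately obtain p q where "?I = {p..q}"
    using connected_compact_interval_1[of ?I] convex_connected by blast
  then show ?thesis
    using that by (cases "p \<le> q") auto
qed

lemma in_trunc_image_iff:
  assumes "K \<subseteq> Rn (Suc n)" "x \<in> Rn n"
  shows "x \<in> trunc n ` K \<longleftrightarrow> (\<exists>t. x(n := t) \<in> K)"
proof
  assume "x \<in> trunc n ` K"
  then obtain y where y: "y \<in> K" "x = trunc n y" by auto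
  then have "x(n := y n) = y"
    using assms by (fastforce simp: trunc_def Rn_iff fun_eq_iff)
  with y show "\<exists>t. x(n := t) \<in> K" by metis
next
  assume "\<exists>t. x(n := t) \<in> K"
  then obtain t where "x(n := t) \<in> K" ..
  moreover have "trunc n (x(n := t)) = x"
    using assms(2) by (auto simp: trunc_def Rn_iff fun_eq_iff)
  ultimately show "x \<in> trunc n ` K" by force
qed

text \<open>A line parallel to the last axis that meets \<open>K\<close> meets it in an interval,
  and the sweep lengthens this interval by \<open>s\<close>. The lines that meet \<open>K\<close>
  are those over its projection.\<close>

lemma V_sweep_last:
  assumes K: "compact_convex (Suc n) K" and "s \<ge> 0"
  shows "V (Suc n) (sweep K (s *\<^sub>R unit_vec n)) = V (Suc n) K + s * V n (trunc n ` K)"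
proof -
  let ?S = "sweep K (s *\<^sub>R unit_vec n)"
  have S: "compact_convex (Suc n) ?S"
    using K by (intro compact_convex_sweep) auto
  have P: "compact_convex n (trunc n ` K)"
    by (rule compact_convex_trunc[OF K])
  note [measurable] = compact_convexD(4)[OF K] compact_convexD(4)[OF S] compact_convexD(4)[OF P]
  have mem: "x(n := t) \<in> ?S \<longleftrightarrow> (\<exists>r\<in>{0..1}. x(n := t - r * s) \<in> K)" for x t
  proof -
    have eq: "y + r *\<^sub>R (s *\<^sub>R unit_vec n) = y(n := y n + r * s)" for y :: vec and r
      by (auto simp: fun_eq_iff unit_vec_def)
    show ?thesis
    proof
      assume "x(n := t) \<in> ?S"
      then obtain y r where yr: "y \<in> K" "r \<in> {0..1}" "x(n := t) = y(n := y n + r * s)"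
        unfolding sweep_def eq by auto
      then have "x(n := t - r * s) = y"
        by (metis add_diff_cancel_right' fun_upd_apply fun_upd_triv fun_upd_upd)
      with yr show "\<exists>r\<in>{0..1}. x(n := t - r * s) \<in> K" by blast
    next
      assume "\<exists>r\<in>{0..1}. x(n := t - r * s) \<in> K"
      then obtain r where r: "r \<in> {0..1}" "x(n := t - r * s) \<in> K" by blast
      then show "x(n := t) \<in> ?S"
        unfolding sweep_def eq by (intro image_eqI[of _ _ "(x(n := t - r * s), r)"]) auto
    qed
  qed
  have slice: "emeasure lborel {t. x(n := t) \<in> ?S} =
      emeasure lborel {t. x(n := t) \<in> K} + ennreal s * indicator (trunc n ` K) x" if "x \<in> Rn n" for x
  proof (rule slice_interval[OF K, of x n])
    assume "{t. x(n := t) \<in> K} = {}"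
    then have "{t. x(n := t) \<in> ?S} = {}" "x \<notin> trunc n ` K"
      using in_trunc_image_iff[OF compact_convexD(3)[OF K] that] mem by auto
    then show ?thesis
      using \<open>{t. x(n := t) \<in> K} = {}\<close> by simp
  next
    fix p q assume pq: "p \<le> q" "{t. x(n := t) \<in> K} = {p..q}"
    then have mem': "x(n := t) \<in> K \<longleftrightarrow> p \<le> t \<and> t \<le> q" for t by auto
    then have "x \<in> trunc n ` K"
      using in_trunc_image_iff[OF compact_convexD(3)[OF K] that] pq(1) by auto
    moreover have "{t. x(n := t) \<in> ?S} = {p..q + s}"
    proof (intro equalityI subsetI)
      fix t assume "t \<in> {t. x(n := t) \<in> ?S}"
      then obtain r where "r \<in> {0..1}" "p \<le> t - r * s" "t - r * s \<le> q"
        by (auto simp: mem mem')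
      moreover from this have "0 \<le> r * s" "r * s \<le> s"
        using \<open>s \<ge> 0\<close> by (auto intro: mult_left_le_one_le)
      ultimately show "t \<in> {p..q + s}" by auto
    next
      fix t assume t: "t \<in> {p..q + s}"
      show "t \<in> {t. x(n := t) \<in> ?S}"
      proof (cases "s = 0")
        case True
        with t show ?thesis by (simp add: mem' sweep_zero)
      next
        case False
        \<comment> \<open>The least shift that brings \<open>t\<close> back to at most
          \<open>q\<close>: the product of \<open>r\<close> and \<open>s\<close> is the excess of
          \<open>t\<close> over \<open>q\<close>.\<close>
        define r where "r = max 0 ((t - q) / s)"
        have "r * s = max 0 (t - q)"
          using False \<open>s \<ge> 0\<close> by (auto simp: r_def max_def field_simps)
        moreover have "r \<in> {0..1}"
          using False \<open>s \<ge> 0\<close> t by (auto simp: r_def field_simps)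
        ultimately show ?thesis
          using t pq(1) by (auto simp: mem mem' intro!: bexI[of _ r])
      qed
    qed
    ultimately show ?thesis
      using pq \<open>s \<ge> 0\<close> by (simp flip: ennreal_plus)
  qed
  have "emeasure (lam (Suc n)) ?S = (\<integral>\<^sup>+x. emeasure lborel {t. x(n := t) \<in> K} + ennreal s * indicator (trunc n ` K) x \<partial>lam n)"
    by (subst emeasure_lam_Suc) (auto intro!: nn_integral_lam_cong simp: slice)
  also have "\<dots> = emeasure (lam (Suc n)) K + ennreal s * emeasure (lam n) (trunc n ` K)"
    by (subst nn_integral_add) (auto simp: emeasure_lam_Suc nn_integral_cmult)
  finally have "ennreal (V (Suc n) ?S) = ennreal (V (Suc n) K) + ennreal s * ennreal (V n (trunc n ` K))"
    using compact_convexD(1)[OF K] compact_convexD(1)[OF S] compact_convexD(1)[OF P]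
    by (simp add: emeasure_lam_eq_measure)
  also have "\<dots> = ennreal (V (Suc n) K + s * V n (trunc n ` K))"
    using \<open>s \<ge> 0\<close> by (simp add: ennreal_mult)
  finally show ?thesis
    using \<open>s \<ge> 0\<close> by (subst (asm) ennreal_inj) auto
qed

text \<open>The inverse is the Sherman-Morrison formula.\<close>

lemma rank_one_GL:
  assumes a: "\<And>x y. a (x + y) = a x + a y" "\<And>c x. a (c *\<^sub>R x) = c * a x"
    and w: "w \<in> Rn n" "1 + a w \<noteq> (0::real)"
  shows "(\<lambda>x. x + a x *\<^sub>R w) \<in> GL n"
proof (rule GLI[where S = "\<lambda>x. x - (a x / (1 + a w)) *\<^sub>R w"])
  have aw: "a (x - c *\<^sub>R w) = a x - c * a w" for x c
    using a(1)[of x "(- c) *\<^sub>R w"] a(2)[of "- c" w] by (simp del: vec_apply)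
  fix x y :: vec and c :: real
  show "x + a x *\<^sub>R w - (a (x + a x *\<^sub>R w) / (1 + a w)) *\<^sub>R w = x"
    using w(2) by (auto simp: a fun_eq_iff divide_simps) (simp add: algebra_simps)
  show "x - (a x / (1 + a w)) *\<^sub>R w + a (x - (a x / (1 + a w)) *\<^sub>R w) *\<^sub>R w = x"
    using w(2) by (auto simp: aw fun_eq_iff divide_simps) (simp add: algebra_simps)
  show "x + y + a (x + y) *\<^sub>R w = x + a x *\<^sub>R w + (y + a y *\<^sub>R w)"
    by (simp add: a algebra_simps del: vec_apply)
  show "c *\<^sub>R x + a (c *\<^sub>R x) *\<^sub>R w = c *\<^sub>R (x + a x *\<^sub>R w)"
    by (simp add: a algebra_simps del: vec_apply)
qed (use w in auto)

lemma exists_GL_last: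
  assumes "u \<in> Rn (Suc n)" "u \<noteq> 0"
  obtains T where "T \<in> GL (Suc n)" "T (unit_vec n) = u"
proof -
  obtain j where j: "j \<le> n" "u j \<noteq> 0"
    using assms by (metis Rn_iff ext not_less_eq_eq zero_fun_apply)
  \<comment> \<open>A functional with value 1 on \<open>unit_vec n\<close> and a nonzero value on
    \<open>u\<close>. The first property makes the rank-one map send \<open>unit_vec n\<close> to
    \<open>u\<close>; the second makes it invertible, since 1 + a(u - unit_vec n) = a(u).\<close>
  define a where "a = (\<lambda>x::vec. if u n \<noteq> 0 then x n else x n + x j)"
  let ?w = "u - unit_vec n"
  have au: "1 + a ?w \<noteq> 0"
    using j by (cases "j = n") (auto simp: a_def unit_vec_def)
  have "(\<lambda>x. x + a x *\<^sub>R ?w) \<in> GL (Suc n)"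
    using au assms(1) by (intro rank_one_GL) (auto simp: a_def algebra_simps)
  moreover have "unit_vec n + a (unit_vec n) *\<^sub>R ?w = u"
  proof -
    have "a (unit_vec n) = 1"
      using j by (auto simp: a_def unit_vec_def)
    then show ?thesis by simp
  qed
  ultimately show ?thesis using that by blast
qed

lemma growth_last:
  assumes "compact_convex (Suc n) K" "s \<ge> 0"
  shows "growth (Suc n) K (s *\<^sub>R unit_vec n) = s * V n (trunc n ` K)"
  using V_sweep_last[OF assms] by (simp add: growth_def del: vec_apply)

lemma growth_zero [simp]: "growth n K 0 = 0"
  by (simp add: growth_def sweep_zero)

text \<open>Both facts hold for \<open>u = unit_vec n\<close> by slicing; a linear bijection moves any other direction there.\<close>

lemma
  assumes K: "compact_convex n K" and u: "u \<in> Rn n"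
  shows growth_scaleR: "s \<ge> 0 \<Longrightarrow> growth n K (s *\<^sub>R u) = s * growth n K u"
    and growth_mono: "compact_convex n K' \<Longrightarrow> K \<subseteq> K' \<Longrightarrow> growth n K u \<le> growth n K' u"
proof -
  show "growth n K (s *\<^sub>R u) = s * growth n K u" if "s \<ge> 0"
  proof (cases "u = 0")
    case False
    with u obtain m where n: "n = Suc m"
      by (cases n) (auto simp: Rn_iff fun_eq_iff)
    obtain T where T: "T \<in> GL n" "T (unit_vec m) = u"
      using exists_GL_last[of u m] u False n by blast
    define L where "L = inv_into (Rn n) T ` K"
    have L: "compact_convex n L"
      unfolding L_def by (intro compact_convex_GL K GL_inv T)
    have TL: "T ` L = K"
      unfolding L_def image_image
      using compact_convexD(3)[OF K] GL_inv_right[OF T(1)] by force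
    have *: "growth n K (r *\<^sub>R u) = absdet n T * (r * V m (trunc m ` L))" if "r \<ge> 0" for r
      using growth_GL[OF T(1) L, of "r *\<^sub>R unit_vec m"] growth_last[of m L r] L that n TL
      by (simp add: GL_scaleR[OF T(1)] T(2) subspace_scale[OF subspace_Rn] del: vec_apply)
    show ?thesis
      using *[OF that] *[of 1] by simp
  qed simp
  show "growth n K u \<le> growth n K' u" if K': "compact_convex n K'" "K \<subseteq> K'"
  proof (cases "u = 0")
    case False
    with u obtain m where n: "n = Suc m"
      by (cases n) (auto simp: Rn_iff fun_eq_iff)
    obtain T where T: "T \<in> GL n" "T (unit_vec m) = u"
      using exists_GL_last[of u m] u False n by blast
    define L where "L = (\<lambda>K. inv_into (Rn n) T ` K)"
    have *: "compact_convex n (L K)" "growth n K u = absdet n T * V m (trunc m ` L K)"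
      if K: "compact_convex n K" for K
    proof -
      show L: "compact_convex n (L K)"
        unfolding L_def by (intro compact_convex_GL that GL_inv T)
      have TL: "T ` L K = K"
        unfolding L_def image_image
        using compact_convexD(3)[OF K] GL_inv_right[OF T(1)] by force
      show "growth n K u = absdet n T * V m (trunc m ` L K)"
        using growth_GL[OF T(1) L, of "unit_vec m"] growth_last[of m "L K" 1] L n TL
        by (simp add: T(2) del: vec_apply)
    qed
    have "V m (trunc m ` L K) \<le> V m (trunc m ` L K')"
      using that *[OF K] *[OF K'(1)] unfolding L_def
      by (intro V_mono image_mono) (auto dest: compact_convex_trunc compact_convexD)
    then show ?thesis
      using * K K' absdet_nonneg[of n T] by (simp add: mult_left_mono)
  qed simp
qed

lemma growth_translate:
  assumes "compact_convex n K" "u \<in> Rn n" "y \<in> Rn n"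
  shows "growth n ((+) y ` K) u = growth n K u"
  using compact_convex_sweep[OF assms(1,2)] assms
  by (simp add: growth_def sweep_translate[symmetric] V_translate compact_convexD del: vec_apply)

text \<open>Dilating \<open>K\<close> together with the direction u/c multiplies all volumes by c^n;
  homogeneity in the direction takes one factor c back.\<close>

lemma growth_dilate:
  assumes "compact_convex n K" "u \<in> Rn n" "c > 0"
  shows "growth n ((*\<^sub>R) c ` K) u = c ^ (n - 1) * growth n K u"
proof (cases n)
  case 0
  with assms have "u = 0" by (auto simp: Rn_iff)
  then show ?thesis by simp
next
  case (Suc m)
  have u: "(1 / c) *\<^sub>R u \<in> Rn n" using assms(2) by (rule subspace_scale[OF subspace_Rn])
  have "growth n ((*\<^sub>R) c ` K) u = V n ((*\<^sub>R) c ` sweep K ((1 / c) *\<^sub>R u)) - V n ((*\<^sub>R) c ` K)"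
    using assms(3) by (simp add: growth_def sweep_scaleR del: vec_apply)
  also have "\<dots> = c ^ n * growth n K ((1 / c) *\<^sub>R u)"
    using assms compact_convex_sweep[OF assms(1) u]
    by (simp add: V_scaleR compact_convexD growth_def right_diff_distrib del: vec_apply)
  also have "\<dots> = c ^ (n - 1) * growth n K u"
    using growth_scaleR[OF assms(1,2), of "1 / c"] assms(3) Suc by simp
  finally show ?thesis .
qed

lemma V_sym_sweep:
  assumes "compact_convex n K" "u \<in> Rn n"
  shows "V n (sym_sweep K u) = V n K + 2 * growth n K u"
proof -
  have u: "2 *\<^sub>R u \<in> Rn n" "- u \<in> Rn n"
    using assms(2) by (auto intro: subspace_scale[OF subspace_Rn] subspace_neg[OF subspace_Rn])
  then have "V n (sym_sweep K u) = V n (sweep K (2 *\<^sub>R u))"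
    unfolding sym_sweep_eq
    by (intro V_translate compact_convexD(1)[OF compact_convex_sweep[OF assms(1)]])
  then show ?thesis
    using growth_scaleR[OF assms, of 2] by (simp add: growth_def)
qed

section \<open>Zonotopes\<close>

text \<open>As rewrite rules these would eta-expand vector sums under binders.\<close>
declare vec_apply [simp del]

section \<open>The inner product and the support function of a zonotope\<close>

lemma dot_commute: "dot n x y = dot n y x"
  by (simp add: dot_def mult.commute)

lemma dot_add_left: "dot n (x + y) z = dot n x z + dot n y z"
  and dot_scaleR_left: "dot n (c *\<^sub>R x) z = c * dot n x z"
  and dot_diff_left: "dot n (x - y) z = dot n x z - dot n y z"
  and dot_zero_left: "dot n 0 z = 0"
  by (simp_all add: dot_def vec_apply sum.distrib sum_distrib_left algebra_simps sum_subtractf)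

lemma dot_add_right: "dot n z (x + y) = dot n z x + dot n z y"
  and dot_scaleR_right: "dot n z (c *\<^sub>R x) = c * dot n z x"
  and dot_diff_right: "dot n z (x - y) = dot n z x - dot n z y"
  and dot_zero_right: "dot n z 0 = 0"
  unfolding dot_commute[of n z] by (fact dot_add_left dot_scaleR_left dot_diff_left dot_zero_left)+

lemmas dot_simps = dot_add_left dot_scaleR_left dot_diff_left dot_zero_left
  dot_add_right dot_scaleR_right dot_diff_right dot_zero_right

lemma dot_self: "dot n x x = (vnorm n x)\<^sup>2"
  by (simp add: dot_def L2_set_def sum_nonneg power2_eq_square)

lemma vnorm_diff_scaleR_sq:
  "(vnorm n (v - t *\<^sub>R d))\<^sup>2 = (vnorm n v)\<^sup>2 - 2 * t * dot n d v + t\<^sup>2 * (vnorm n d)\<^sup>2"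
  using dot_commute[of n v d]
  unfolding dot_self[symmetric] by (simp add: dot_simps power2_eq_square algebra_simps)

lemma abs_dot_le: "\<bar>dot n x y\<bar> \<le> vnorm n x * vnorm n y"
proof -
  have "\<bar>dot n x y\<bar> \<le> (\<Sum>i<n. \<bar>x i\<bar> * \<bar>y i\<bar>)"
    unfolding dot_def by (rule order.trans[OF sum_abs]) (simp add: abs_mult)
  also have "\<dots> \<le> vnorm n x * vnorm n y"
    by (rule L2_set_mult_ineq)
  finally show ?thesis .
qed

text \<open>\<open>K\<close> plus the zonotope generated by the list; \<open>msum {0} us\<close> is
  the zonotope itself.\<close>

primrec msum :: "vec set \<Rightarrow> vec list \<Rightarrow> vec set" where
  "msum K [] = K"
| "msum K (u # us) = sym_sweep (msum K us) u"

lemma compact_convex_msum: "compact_convex n K \<Longrightarrow> set us \<subseteq> Rn n \<Longrightarrow> compact_convex n (msum K us)"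
  by (induction us) (auto intro: compact_convex_sym_sweep)

lemma subset_msum: "K \<subseteq> msum K us"
  by (induction us) (use subset_sym_sweep in \<open>auto simp: subset_eq\<close>)

text \<open>Each segment [-u, u] adds twice the growth of the sum built so far, and this sum
  contains \<open>K\<close>, so monotonicity of growth applies.\<close>

lemma V_msum_ge:
  assumes "compact_convex n K" "set us \<subseteq> Rn n"
  shows "V n K + 2 * (\<Sum>u\<leftarrow>us. growth n K u) \<le> V n (msum K us)"
  using assms(2)
proof (induction us)
  case (Cons u us)
  then have "growth n K u \<le> growth n (msum K us) u"
    using assms(1) by (intro growth_mono compact_convex_msum subset_msum) auto
  then show ?case
    using Cons assms(1) V_sym_sweep[OF compact_convex_msum[OF assms(1)], of us u] by simp
qed simp

text \<open>The counterpart from above: every partial sum lies in the final one, hence in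
  \<open>L\<close>, whose growth bounds each increment.\<close>

lemma V_msum_le:
  assumes "compact_convex n K" "compact_convex n L" "set us \<subseteq> Rn n" "msum K us \<subseteq> L"
  shows "V n (msum K us) \<le> V n K + 2 * (\<Sum>u\<leftarrow>us. growth n L u)"
  using assms(3,4)
proof (induction us)
  case (Cons u us)
  have *: "msum K us \<subseteq> L"
    using Cons.prems(2) subset_sym_sweep[of "msum K us" u] by simp
  then have "growth n (msum K us) u \<le> growth n L u"
    using assms Cons.prems by (intro growth_mono compact_convex_msum) auto
  then show ?case
    using Cons * assms(1) V_sym_sweep[OF compact_convex_msum[OF assms(1)], of us u] by simp
qed simp

lemma msum_eq: "msum K us = {x + z | x z. x \<in> K \<and> z \<in> msum {0} us}"
proof (induction us)
  case (Cons u us)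
  show ?case
  proof (intro equalityI subsetI)
    fix y assume "y \<in> msum K (u # us)"
    then obtain x t where "x \<in> msum K us" "t \<in> {-1..1}" "y = x + t *\<^sub>R u"
      by (auto simp: sym_sweep_def)
    moreover from this obtain a z where "a \<in> K" "z \<in> msum {0} us" "x = a + z"
      using Cons by blast
    ultimately have "y = a + (z + t *\<^sub>R u)" "z + t *\<^sub>R u \<in> msum {0} (u # us)" "a \<in> K"
      by (auto simp: sym_sweep_def add.assoc)
    then show "y \<in> {x + z | x z. x \<in> K \<and> z \<in> msum {0} (u # us)}" by blast
  next
    fix y assume "y \<in> {x + z | x z. x \<in> K \<and> z \<in> msum {0} (u # us)}"
    then obtain a z t where "a \<in> K" "z \<in> msum {0} us" "t \<in> {-1..1}" "y = a + (z + t *\<^sub>R u)"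
      by (auto simp: sym_sweep_def)
    then have "a + z \<in> msum K us" "y = (a + z) + t *\<^sub>R u"
      using Cons by (blast, simp add: add.assoc)
    with \<open>t \<in> {-1..1}\<close> show "y \<in> msum K (u # us)"
      by (auto simp: sym_sweep_def)
  qed
qed simp

text \<open>Together with \<open>dot_zonotope_attained\<close> this identifies the sum of the |<u,
  v>| as the support function of the zonotope, so that inclusions between zonotopes and balls become
  inequalities between this sum and multiples of the norm.\<close>

lemma dot_zonotope_le: "z \<in> msum {0} us \<Longrightarrow> dot n z v \<le> (\<Sum>u\<leftarrow>us. \<bar>dot n u v\<bar>)"
proof (induction us arbitrary: z)
  case (Cons u us)
  then obtain x t where xt: "x \<in> msum {0} us" "t \<in> {-1..1}" "z = x + t *\<^sub>R u"
    by (auto simp: sym_sweep_def)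
  have "t * dot n u v \<le> \<bar>t\<bar> * \<bar>dot n u v\<bar>"
    by (simp add: abs_mult[symmetric])
  also have "\<dots> \<le> 1 * \<bar>dot n u v\<bar>"
    using xt(2) by (intro mult_right_mono) auto
  finally have "t * dot n u v \<le> \<bar>dot n u v\<bar>" by simp
  then show ?case
    using Cons.IH[OF xt(1)] by (simp add: xt(3) dot_simps)
qed (simp add: dot_simps)

lemma dot_zonotope_attained: "\<exists>z\<in>msum {0} us. dot n z v = (\<Sum>u\<leftarrow>us. \<bar>dot n u v\<bar>)"
proof (induction us)
  case (Cons u us)
  then obtain x where x: "x \<in> msum {0} us" "dot n x v = (\<Sum>u\<leftarrow>us. \<bar>dot n u v\<bar>)" by blast
  define t :: real where "t = (if dot n u v \<ge> 0 then 1 else -1)"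
  have "x + t *\<^sub>R u \<in> msum {0} (u # us)"
    using x by (auto simp: sym_sweep_def t_def intro!: image_eqI[of _ _ "(x, t)"])
  moreover have "dot n (x + t *\<^sub>R u) v = (\<Sum>u\<leftarrow>u # us. \<bar>dot n u v\<bar>)"
    using x by (auto simp: dot_simps t_def)
  ultimately show ?case by blast
qed (simp add: dot_simps)

lemma compact_convex_zero: "compact_convex n {0}"
  by (simp add: compact_convex_def)

text \<open>Testing the support function at v = z gives |z|^2 \<le> c |z|.\<close>

lemma zonotope_subset_ball:
  assumes "\<And>v. v \<in> Rn n \<Longrightarrow> (\<Sum>u\<leftarrow>us. \<bar>dot n u v\<bar>) \<le> c * vnorm n v" "set us \<subseteq> Rn n"
    and z: "z \<in> msum {0} us" and "c \<ge> 0"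
  shows "z \<in> Rn n" "vnorm n z \<le> c"
proof -
  show "z \<in> Rn n"
    using compact_convexD(3)[OF compact_convex_msum[OF compact_convex_zero assms(2)]] z by blast
  then have "(vnorm n z)\<^sup>2 \<le> c * vnorm n z"
    using dot_zonotope_le[OF z, of n z] assms(1)[of z] by (simp add: dot_self)
  then show "vnorm n z \<le> c"
    using L2_set_nonneg[of z "{..<n}"] \<open>c \<ge> 0\<close>
    by (cases "vnorm n z = 0") (auto simp: power2_eq_square)
qed

text \<open>Separation by the nearest point of the zonotope.\<close>

lemma ball_subset_zonotope:
  assumes le: "\<And>v. v \<in> Rn n \<Longrightarrow> c * vnorm n v \<le> (\<Sum>u\<leftarrow>us. \<bar>dot n u v\<bar>)" and us: "set us \<subseteq> Rn n"
    and y: "y \<in> Rn n" "vnorm n y \<le> c"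
  shows "y \<in> msum {0} us"
proof (rule ccontr)
  assume ny: "y \<notin> msum {0} us"
  note Z = compact_convexD[OF compact_convex_msum[OF compact_convex_zero us]]
  have "continuous_on (msum {0} us) (\<lambda>z. vnorm n (y - z))"
    using continuous_on_compose2[OF continuous_on_vnorm[of UNIV] continuous_on_vec_diff[OF continuous_on_const continuous_on_id]]
    by blast
  then obtain z0 where z0: "z0 \<in> msum {0} us" "\<And>z. z \<in> msum {0} us \<Longrightarrow> vnorm n (y - z0) \<le> vnorm n (y - z)"
    using continuous_attains_inf[OF Z(1)] subset_msum[of "{0}" us] by (metis empty_iff insert_subset)
  define v where "v = y - z0"
  have v: "v \<in> Rn n" "v \<noteq> 0"
    using y z0 Z ny unfolding v_def by (auto intro: subspace_diff[OF subspace_Rn])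
  obtain z where z: "z \<in> msum {0} us" "dot n z v = (\<Sum>u\<leftarrow>us. \<bar>dot n u v\<bar>)"
    using dot_zonotope_attained by blast
  \<comment> \<open>First-order optimality of \<open>z0\<close>: moving the fraction
    \<open>t\<close> of the way to \<open>z\<close> stays in the zonotope and cannot come closer to
    \<open>y\<close>.\<close>
  have small: "2 * dot n (z - z0) v \<le> t * (vnorm n (z - z0))\<^sup>2" if t: "0 < t" "t \<le> 1" for t
  proof -
    have "(1 - t) *\<^sub>R z0 + t *\<^sub>R z \<in> msum {0} us"
      using Z(2) z z0 t by (intro convexD) auto
    then have "vnorm n v \<le> vnorm n (y - ((1 - t) *\<^sub>R z0 + t *\<^sub>R z))"
      unfolding v_def by (rule z0)
    also have "y - ((1 - t) *\<^sub>R z0 + t *\<^sub>R z) = v - t *\<^sub>R (z - z0)"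
      by (simp add: v_def algebra_simps)
    finally have "(vnorm n v)\<^sup>2 \<le> (vnorm n (v - t *\<^sub>R (z - z0)))\<^sup>2"
      by (intro power_mono) (auto simp: L2_set_nonneg)
    then have "2 * t * dot n (z - z0) v \<le> t * (t * (vnorm n (z - z0))\<^sup>2)"
      unfolding vnorm_diff_scaleR_sq by (simp add: power2_eq_square algebra_simps)
    then have "t * (2 * dot n (z - z0) v) \<le> t * (t * (vnorm n (z - z0))\<^sup>2)" by (simp add: mult_ac)
    then show ?thesis
      using t by (subst (asm) mult_le_cancel_left_pos) auto
  qed
  have "dot n (z - z0) v \<le> 0"
  proof (rule ccontr)
    assume *: "\<not> ?thesis"
    define A where "A = (vnorm n (z - z0))\<^sup>2"
    have "A \<ge> 0" by (simp add: A_def)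
    \<comment> \<open>So small that \<open>t * A\<close> is at most the inner product;
      \<open>small\<close> would then bound twice a positive number by that number.\<close>
    define t where "t = min 1 (dot n (z - z0) v / (A + 1))"
    have "t > 0" "t \<le> 1" using * \<open>A \<ge> 0\<close> by (auto simp: t_def)
    then have "2 * dot n (z - z0) v \<le> t * A" using small unfolding A_def by blast
    also have "\<dots> \<le> dot n (z - z0) v / (A + 1) * A"
      using \<open>A \<ge> 0\<close> by (intro mult_right_mono) (auto simp: t_def)
    also have "\<dots> \<le> dot n (z - z0) v"
      using * \<open>A \<ge> 0\<close> by (simp add: divide_simps mult_less_0_iff)
    finally show False using * by simp
  qed
  \<comment> \<open>Thus \<open>z0\<close> maximizes the inner product with \<open>v\<close> as
    \<open>z\<close> does, while \<open>y\<close> lies strictly beyond \<open>z0\<close> in this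
    direction. The norm bound on \<open>y\<close> forbids that.\<close>
  then have "dot n z v \<le> dot n z0 v"
    by (simp add: dot_simps)
  also have "\<dots> = dot n y v - (vnorm n v)\<^sup>2"
    by (simp add: dot_self[symmetric] v_def dot_simps)
  also have "\<dots> < dot n y v"
    using vnorm_pos[OF v] by simp
  also have "\<dots> \<le> vnorm n y * vnorm n v"
    using abs_dot_le[of n y v] by simp
  also have "\<dots> \<le> c * vnorm n v"
    using y by (intro mult_right_mono) (auto simp: L2_set_nonneg)
  also have "\<dots> \<le> dot n z v"
    using le[OF v(1)] z by simp
  finally show False by simp
qed

section \<open>Integrals over the unit ball and their discretization\<close>

lemma vnorm_eqI: "dot n x x = dot n y y \<Longrightarrow> vnorm n x = vnorm n y"
  by (simp add: dot_self L2_set_nonneg)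

lemma dot_unit_vec: "i < n \<Longrightarrow> dot n (unit_vec i) x = x i" "i < n \<Longrightarrow> dot n x (unit_vec i) = x i"
  by (simp_all add: dot_def unit_vec_def if_distrib if_distribR cong: if_cong)

text \<open>The Householder reflection that swaps \<open>unit_vec m\<close> and \<open>\<xi>\<close>.\<close>

lemma exists_isometry_last:
  assumes "\<xi> \<in> Rn (Suc m)" "vnorm (Suc m) \<xi> = 1"
  obtains H where "H \<in> GL (Suc m)" "H (unit_vec m) = \<xi>"
    "\<And>x y. dot (Suc m) (H x) (H y) = dot (Suc m) x y"
proof -
  let ?n = "Suc m"
  define w where "w = \<xi> - unit_vec m"
  have w: "w \<in> Rn ?n"
    using assms unfolding w_def by (intro subspace_diff[OF subspace_Rn]) auto
  have \<xi>: "dot ?n \<xi> \<xi> = 1" "dot ?n (unit_vec m) (unit_vec m) = 1"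
    using assms(2) by (simp_all add: dot_self[of _ \<xi>] dot_unit_vec) (simp add: unit_vec_def)
  show ?thesis
  proof (cases "w = 0")
    case True
    then show ?thesis
      using that[of "\<lambda>x. x"] GLI[of ?n "\<lambda>x. x" "\<lambda>x. x"] by (auto simp: w_def)
  next
    case False
    define W where "W = dot ?n w w"
    have W: "W > 0" using vnorm_pos[OF w False] by (simp add: W_def dot_self)
    define a where "a = (\<lambda>x. - 2 * dot ?n x w / W)"
    have "(\<lambda>x. x + a x *\<^sub>R w) \<in> GL ?n"
    proof (rule rank_one_GL[OF _ _ w])
      show "a (x + y) = a x + a y" for x y
        by (simp add: a_def dot_simps algebra_simps add_divide_distrib diff_divide_distrib)
      show "a (c *\<^sub>R x) = c * a x" for c x
        by (simp add: a_def dot_simps)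
      show "1 + a w \<noteq> 0"
        using W by (simp add: a_def W_def)
    qed
    moreover have "unit_vec m + a (unit_vec m) *\<^sub>R w = \<xi>"
    proof -
      \<comment> \<open>Both vectors have length 1, so W = - 2 <unit_vec m, w>, which is what makes
        the reflection coefficient of \<open>unit_vec m\<close> equal to 1.\<close>
      have "W = 2 - 2 * dot ?n (unit_vec m) \<xi>"
        using \<xi> dot_commute[of ?n \<xi> "unit_vec m"] by (simp add: W_def w_def dot_simps)
      moreover have "dot ?n (unit_vec m) w = dot ?n (unit_vec m) \<xi> - 1"
        using \<xi> by (simp add: w_def dot_simps)
      ultimately have "a (unit_vec m) = 1"
        using W by (simp add: a_def divide_simps)
      then show ?thesis by (simp add: w_def)
    qed
    moreover have "dot ?n (x + a x *\<^sub>R w) (y + a y *\<^sub>R w) = dot ?n x y" for x y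
    proof -
      have "dot ?n (x + a x *\<^sub>R w) (y + a y *\<^sub>R w) =
          dot ?n x y + a y * dot ?n x w + a x * dot ?n y w + a x * a y * W"
        by (simp add: dot_simps W_def dot_commute[of ?n w y] algebra_simps)
      also have "\<dots> = dot ?n x y"
        using W by (simp add: a_def divide_simps power2_eq_square)
      finally show ?thesis .
    qed
    ultimately show ?thesis using that by blast
  qed
qed

lemma integral_lam_GL:
  assumes T: "T \<in> GL n" and [measurable]: "f \<in> borel_measurable borel" and "\<And>x. f x \<ge> (0::real)"
  shows "absdet n T * (\<integral>x. f (T (trunc n x)) \<partial>lam n) = (\<integral>x. f x \<partial>lam n)"
proof -
  note [measurable] = measurable_GL[OF T]
  have "(\<integral>x. f x \<partial>lam n) = enn2real (\<integral>\<^sup>+x. ennreal (f x) \<partial>lam n)"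
    using assms by (intro integral_eq_nn_integral) auto
  also have "\<dots> = enn2real (ennreal (absdet n T) * (\<integral>\<^sup>+x. ennreal (f (T (trunc n x))) \<partial>lam n))"
    by (subst nn_integral_lam_GL[OF T, of "\<lambda>x. ennreal (f x)"]) auto
  also have "\<dots> = absdet n T * enn2real (\<integral>\<^sup>+x. ennreal (f (T (trunc n x))) \<partial>lam n)"
    by (simp add: enn2real_mult absdet_nonneg)
  also have "enn2real (\<integral>\<^sup>+x. ennreal (f (T (trunc n x))) \<partial>lam n) = (\<integral>x. f (T (trunc n x)) \<partial>lam n)"
    using assms by (intro integral_eq_nn_integral[symmetric]) auto
  finally show ?thesis by simp
qed

lemma integral_lam_cong: "(\<And>x. x \<in> Rn n \<Longrightarrow> f x = g x) \<Longrightarrow> (\<integral>x. f x \<partial>lam n) = (\<integral>x. g x \<partial>lam n :: real)"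
  if "f \<in> borel_measurable borel" "g \<in> borel_measurable borel" for f g
  using that by (intro integral_cong_AE) (auto intro: eventually_mono[OF AE_lam_Rn])

lemma scaleR_GL: "c \<noteq> 0 \<Longrightarrow> (*\<^sub>R) c \<in> GL n"
  by (rule GLI[where S = "(*\<^sub>R) (1 / c)"])
     (auto simp: algebra_simps intro: subspace_scale[OF subspace_Rn])

lemma V_unit_ball: "V n (unit_ball n) = unit_ball_vol n"
  using emeasure_unit_ball[of n] by (simp add: measure_def less_imp_le)

lemma absdet_scaleR: "c > 0 \<Longrightarrow> absdet n ((*\<^sub>R) c) = c ^ n"
  by (simp add: absdet_def V_scaleR V_unit_ball)

definition ball_int :: "nat \<Rightarrow> (vec \<Rightarrow> real) \<Rightarrow> real" where
  "ball_int n g = (\<integral>x. indicator (unit_ball n) x * g x \<partial>lam n)"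

lemma integrable_ball:
  fixes g :: "vec \<Rightarrow> real" and C :: real
  assumes [measurable]: "g \<in> borel_measurable borel" and "\<And>x. x \<in> unit_ball n \<Longrightarrow> \<bar>g x\<bar> \<le> C"
  shows "integrable (lam n) (\<lambda>x. indicator (unit_ball n) x * g x)"
  by (rule integrableI_bounded_set[where A = "unit_ball n" and B = C])
     (use assms in \<open>auto simp: emeasure_unit_ball indicator_def\<close>)

lemma ball_int_eq_nn_integral:
  assumes "g \<in> borel_measurable borel" "\<And>x. g x \<ge> 0"
  shows "ball_int n g = enn2real (\<integral>\<^sup>+x. indicator (unit_ball n) x * ennreal (g x) \<partial>lam n)"
  unfolding ball_int_def using assms
  by (subst integral_eq_nn_integral) (auto simp: ennreal_mult' ennreal_indicator)

text \<open>Layer cake in the radius: the integrand is the integral of r^k over r from |x| to 1.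
  Exchanging the integrals leaves r^k times the volume of the ball of radius r, that is \<omega>_n
  r^(n+k), to be integrated over [0, 1].\<close>

lemma nn_integral_unit_ball_radial:
  "(\<integral>\<^sup>+x. indicator (unit_ball n) x * ennreal ((1 - vnorm n x ^ Suc k) / Suc k) \<partial>lam n) =
     ennreal (unit_ball_vol n / (n + Suc k))"
proof -
  interpret sigma_finite_measure "lam n" by (rule sigma_finite_lam)
  interpret P: pair_sigma_finite "lam n" lborel ..
  have FTC: "(\<integral>\<^sup>+r. ennreal (r ^ j) * indicator {a..1} r \<partial>lborel) = ennreal ((1 - a ^ Suc j) / Suc j)"
    if "0 \<le> a" "a \<le> 1" for a :: real and j
  proof -
    have "(\<integral>\<^sup>+r. ennreal (r ^ j) * indicator {a..1} r \<partial>lborel) = ennreal (1 ^ Suc j / Suc j - a ^ Suc j / Suc j)"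
    proof (rule nn_integral_FTC_Icc[where F = "\<lambda>r. r ^ Suc j / Suc j"])
      show "((\<lambda>r. r ^ Suc j / Suc j) has_real_derivative r ^ j) (at r)" for r :: real
        using DERIV_cdivide[OF DERIV_pow[of "Suc j" r], of "Suc j"] by (simp del: of_nat_Suc power_Suc)
    qed (use that in auto)
    then show ?thesis by (simp add: diff_divide_distrib)
  qed
  have pt: "indicator (unit_ball n) x * ennreal ((1 - vnorm n x ^ Suc k) / Suc k) =
      (\<integral>\<^sup>+r. ennreal (r ^ k) * (indicator {x. vnorm n x \<le> r} x * indicator {0..1} r) \<partial>lborel)"
    if "x \<in> Rn n" for x
  proof (cases "vnorm n x \<le> 1")
    case True
    have "(\<integral>\<^sup>+r. ennreal (r ^ k) * (indicator {x. vnorm n x \<le> r} x * indicator {0..1} r) \<partial>lborel) =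
          (\<integral>\<^sup>+r. ennreal (r ^ k) * indicator {vnorm n x..1} r \<partial>lborel)"
      by (rule nn_integral_cong)
         (auto simp: indicator_def dest: order.trans[OF L2_set_nonneg])
    then show ?thesis
      using FTC[OF L2_set_nonneg True] that True by (simp add: unit_ball_iff)
  next
    case False
    then have "(\<lambda>r. ennreal (r ^ k) * (indicator {x. vnorm n x \<le> r} x * indicator {0..1} r)) = (\<lambda>r. 0)"
      by (auto simp: indicator_def fun_eq_iff)
    then show ?thesis
      using False by (simp add: unit_ball_iff)
  qed
  have "(\<integral>\<^sup>+x. indicator (unit_ball n) x * ennreal ((1 - vnorm n x ^ Suc k) / Suc k) \<partial>lam n) =
      (\<integral>\<^sup>+x. (\<integral>\<^sup>+r. ennreal (r ^ k) * (indicator {x. vnorm n x \<le> r} x * indicator {0..1} r) \<partial>lborel) \<partial>lam n)"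
    by (rule nn_integral_lam_cong) (rule pt)
  also have "\<dots> = (\<integral>\<^sup>+r. (\<integral>\<^sup>+x. ennreal (r ^ k) * (indicator {x. vnorm n x \<le> r} x * indicator {0..1} r) \<partial>lam n) \<partial>lborel)"
    by (rule P.Fubini'[of "\<lambda>x r. ennreal (r ^ k) * (indicator {x. vnorm n x \<le> r} x * indicator {0..1} r)", symmetric])
       measurable
  also have "\<dots> = (\<integral>\<^sup>+r. ennreal (unit_ball_vol n) * (ennreal (r ^ (n + k)) * indicator {0..1} r) \<partial>lborel)"
  proof (rule nn_integral_cong_AE)
    \<comment> \<open>The volume formula for balls requires a positive radius, so r = 0 is discarded
      as a null set.\<close>
    have "AE r in lborel. r \<noteq> (0::real)"
      by (rule AE_lborel_singleton)
    then show "AE r in lborel. (\<integral>\<^sup>+x. ennreal (r ^ k) * (indicator {x. vnorm n x \<le> r} x * indicator {0..1} r) \<partial>lam n) =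
        ennreal (unit_ball_vol n) * (ennreal (r ^ (n + k)) * indicator {0..1} r)"
    proof eventually_elim
      case (elim r)
      show ?case
      proof (cases "r \<in> {0..1}")
        case True
        with elim have "r > 0" by auto
        have "{x\<in>space borel. vnorm n x \<le> r} \<in> sets borel" by measurable
        then have "(\<integral>\<^sup>+x. ennreal (r ^ k) * indicator {x. vnorm n x \<le> r} x \<partial>lam n) = ennreal (r ^ k) * emeasure (lam n) {x. vnorm n x \<le> r}"
          by (intro nn_integral_cmult_indicator) simp
        then show ?thesis
          using True \<open>r > 0\<close> by (simp add: emeasure_lam_ball ennreal_mult'[symmetric] power_add mult_ac)
      qed simp
    qed
  qed
  also have "\<dots> = ennreal (unit_ball_vol n) * ennreal (1 / (n + Suc k))"
    by (subst nn_integral_cmult) (auto simp: FTC)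
  also have "\<dots> = ennreal (unit_ball_vol n / (n + Suc k))"
    by (subst ennreal_mult'[symmetric]) (auto simp: less_imp_le)
  finally show ?thesis .
qed

text \<open>The radial formula with k = 0 gives the integral of 1 - |x|, to be subtracted from the
  volume of the ball.\<close>

lemma ball_int_vnorm: "ball_int n (vnorm n) = n * unit_ball_vol n / (n + 1)"
proof -
  have int: "integrable (lam n) (\<lambda>x. indicator (unit_ball n) x * vnorm n x)"
    by (rule integrable_ball[where C = 1]) (auto simp: unit_ball_iff L2_set_nonneg)
  have "(\<integral>x. indicator (unit_ball n) x * (1 - vnorm n x) \<partial>lam n) = unit_ball_vol n / (n + 1)"
  proof -
    have "(\<integral>x. indicator (unit_ball n) x * (1 - vnorm n x) \<partial>lam n) =
        enn2real (\<integral>\<^sup>+x. ennreal (indicator (unit_ball n) x * (1 - vnorm n x)) \<partial>lam n)"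
      by (rule integral_eq_nn_integral) (measurable, auto simp: indicator_def unit_ball_iff)
    also have "(\<integral>\<^sup>+x. ennreal (indicator (unit_ball n) x * (1 - vnorm n x)) \<partial>lam n) = ennreal (unit_ball_vol n / (n + 1))"
      using nn_integral_unit_ball_radial[of n 0] by (simp add: ennreal_mult' ennreal_indicator)
    finally show ?thesis by (simp add: less_imp_le)
  qed
  moreover have "(\<integral>x. indicator (unit_ball n) x * (1 - vnorm n x) \<partial>lam n) = unit_ball_vol n - ball_int n (vnorm n)"
  proof -
    have "(\<integral>x. indicator (unit_ball n) x * (1 - vnorm n x) \<partial>lam n) =
        (\<integral>x. indicator (unit_ball n) x - indicator (unit_ball n) x * vnorm n x \<partial>lam n)"
      by (simp add: right_diff_distrib)
    also have "\<dots> = unit_ball_vol n - ball_int n (vnorm n)"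
      using int by (subst Bochner_Integration.integral_diff) 
        (auto simp: ball_int_def V_unit_ball emeasure_unit_ball)
    finally show ?thesis .
  qed
  ultimately have "unit_ball_vol n - ball_int n (vnorm n) = unit_ball_vol n / (n + 1)"
    by linarith
  then show ?thesis by (simp add: field_simps)
qed

lemma vnorm_Suc_upd: "vnorm (Suc m) (x(m := t)) = sqrt ((vnorm m x)\<^sup>2 + t\<^sup>2)"
  by (simp add: L2_set_def sum_nonneg)

text \<open>Over a point x of the m-dimensional ball the last coordinate runs through [-c, c] with
  c^2 = 1 - |x|^2, and the integral of |t| there is c^2. The radial formula with k = 1 does the
  rest.\<close>

lemma ball_int_abs_last: "ball_int (Suc m) (\<lambda>x. \<bar>x m\<bar>) = 2 * unit_ball_vol m / (m + 2)"
proof -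
  have FTC: "(\<integral>\<^sup>+t. ennreal \<bar>t\<bar> * indicator {- c..c} t \<partial>lborel) = ennreal (c\<^sup>2)" if "c \<ge> 0" for c :: real
  proof -
    have "(\<integral>\<^sup>+t. ennreal \<bar>t\<bar> * indicator {- c..c} t \<partial>lborel) =
        (\<integral>\<^sup>+t. ennreal (- t) * indicator {- c..0} t + ennreal t * indicator {0..c} t \<partial>lborel)"
      by (rule nn_integral_cong) (auto simp: indicator_def)
    also have "\<dots> = (\<integral>\<^sup>+t. ennreal (- t) * indicator {- c..0} t \<partial>lborel) + (\<integral>\<^sup>+t. ennreal t * indicator {0..c} t \<partial>lborel)"
      by (rule nn_integral_add) auto
    also have "(\<integral>\<^sup>+t. ennreal (- t) * indicator {- c..0} t \<partial>lborel) = ennreal (- (0\<^sup>2 / 2) - (- ((- c)\<^sup>2 / 2)))"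
      by (rule nn_integral_FTC_Icc[where F = "\<lambda>t. - (t\<^sup>2 / 2)"]) (use that in \<open>auto intro!: derivative_eq_intros\<close>)
    also have "(\<integral>\<^sup>+t. ennreal t * indicator {0..c} t \<partial>lborel) = ennreal (c\<^sup>2 / 2 - 0\<^sup>2 / 2)"
      by (rule nn_integral_FTC_Icc[where F = "\<lambda>t. t\<^sup>2 / 2"]) (use that in \<open>auto intro!: derivative_eq_intros\<close>)
    finally show ?thesis by (simp flip: ennreal_plus)
  qed
  have pt: "(\<integral>\<^sup>+t. indicator (unit_ball (Suc m)) (x(m := t)) * ennreal \<bar>t\<bar> \<partial>lborel) =
      indicator (unit_ball m) x * ennreal (1 - (vnorm m x)\<^sup>2)" if "x \<in> Rn m" for x
  proof -
    have mem: "x(m := t) \<in> unit_ball (Suc m) \<longleftrightarrow> (vnorm m x)\<^sup>2 + t\<^sup>2 \<le> 1" for t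
      using that by (simp add: unit_ball_iff vnorm_Suc_upd Rn_iff)
    show ?thesis
    proof (cases "vnorm m x \<le> 1")
      case True
      define c where "c = sqrt (1 - (vnorm m x)\<^sup>2)"
      have v: "(vnorm m x)\<^sup>2 \<le> 1"
        using True by (simp add: power_le_one L2_set_nonneg)
      have "(vnorm m x)\<^sup>2 + t\<^sup>2 \<le> 1 \<longleftrightarrow> t \<in> {- c..c}" for t
      proof -
        have "(vnorm m x)\<^sup>2 + t\<^sup>2 \<le> 1 \<longleftrightarrow> sqrt (t\<^sup>2) \<le> c"
          unfolding c_def by (subst real_sqrt_le_iff) linarith
        then show ?thesis by auto
      qed
      then have "(\<integral>\<^sup>+t. indicator (unit_ball (Suc m)) (x(m := t)) * ennreal \<bar>t\<bar> \<partial>lborel) =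
          (\<integral>\<^sup>+t. ennreal \<bar>t\<bar> * indicator {- c..c} t \<partial>lborel)"
        by (intro nn_integral_cong) (simp add: indicator_def mem)
      then show ?thesis
        using FTC[of c] v True that by (simp add: c_def unit_ball_iff)
    next
      case False
      have "\<not> (vnorm m x)\<^sup>2 + t\<^sup>2 \<le> 1" for t
      proof -
        have "1 < (vnorm m x)\<^sup>2" using False by (simp add: one_less_power)
        then show ?thesis by (smt (verit) zero_le_power2)
      qed
      then have "\<not> x(m := t) \<in> unit_ball (Suc m)" for t
        using mem by blast
      then show ?thesis
        using False by (simp add: unit_ball_iff)
    qed
  qed
  have "(\<integral>\<^sup>+x. indicator (unit_ball (Suc m)) x * ennreal \<bar>x m\<bar> \<partial>lam (Suc m)) =
      (\<integral>\<^sup>+x. indicator (unit_ball m) x * ennreal (1 - (vnorm m x)\<^sup>2) \<partial>lam m)"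
    by (subst nn_integral_lam_Suc) (auto intro!: nn_integral_lam_cong simp: pt)
  also have "\<dots> = (\<integral>\<^sup>+x. ennreal 2 * (indicator (unit_ball m) x * ennreal ((1 - vnorm m x ^ Suc 1) / Suc 1)) \<partial>lam m)"
  proof (rule nn_integral_cong)
    fix x :: vec
    show "indicator (unit_ball m) x * ennreal (1 - (vnorm m x)\<^sup>2) =
        ennreal 2 * (indicator (unit_ball m) x * ennreal ((1 - vnorm m x ^ Suc 1) / Suc 1))"
    proof (cases "x \<in> unit_ball m")
      case True
      then have "(vnorm m x)\<^sup>2 \<le> 1" by (simp add: unit_ball_iff power_le_one L2_set_nonneg)
      moreover have "2 * ((1 - (vnorm m x)\<^sup>2) / 2) = 1 - (vnorm m x)\<^sup>2" by simp
      ultimately show ?thesis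
        using True ennreal_mult'[of 2 "(1 - (vnorm m x)\<^sup>2) / 2"] by (simp only:) (simp add: power2_eq_square)
    qed simp
  qed
  also have "\<dots> = ennreal 2 * (\<integral>\<^sup>+x. indicator (unit_ball m) x * ennreal ((1 - vnorm m x ^ Suc 1) / Suc 1) \<partial>lam m)"
    by (rule nn_integral_cmult) measurable
  also have "\<dots> = ennreal (2 * unit_ball_vol m / (m + 2))"
    using ennreal_mult'[of 2 "unit_ball_vol m / (m + 2)"]
    by (subst nn_integral_unit_ball_radial) (simp add: add.commute)
  finally show ?thesis
    by (subst ball_int_eq_nn_integral) (auto simp: less_imp_le)
qed

lemma measurable_dot [measurable]: "(\<lambda>x. dot n x y) \<in> borel_measurable borel"
  unfolding dot_def by measurable

text \<open>By rotation invariance \<open>y\<close> may be turned to the last axis, so the integral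
  is a multiple of |y|. In terms of support functions, the segments [-x, x] averaged over the ball
  form a Euclidean ball; this is the origin of the zonotopes.\<close>

lemma ball_int_abs_dot:
  assumes y: "y \<in> Rn (Suc m)"
  shows "ball_int (Suc m) (\<lambda>x. \<bar>dot (Suc m) x y\<bar>) = 2 * unit_ball_vol m / (m + 2) * vnorm (Suc m) y"
proof (cases "y = 0")
  case True
  then show ?thesis by (simp add: ball_int_def dot_simps)
next
  case False
  let ?n = "Suc m"
  define \<xi> where "\<xi> = (1 / vnorm ?n y) *\<^sub>R y"
  have pos: "vnorm ?n y > 0" using vnorm_pos[OF y False] .
  have \<xi>: "\<xi> \<in> Rn ?n" "vnorm ?n \<xi> = 1"
    using y pos by (auto simp: \<xi>_def vnorm_scaleR intro: subspace_scale[OF subspace_Rn])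
  have y_eq: "y = vnorm ?n y *\<^sub>R \<xi>"
    using pos by (simp add: \<xi>_def)
  obtain H where H: "H \<in> GL ?n" "H (unit_vec m) = \<xi>" "\<And>x y. dot ?n (H x) (H y) = dot ?n x y"
    using exists_isometry_last[OF \<xi>] by metis
  have iso: "vnorm ?n (H x) = vnorm ?n x" for x
    by (rule vnorm_eqI) (rule H)
  note [measurable] = measurable_GL[OF H(1)]
  have "ball_int ?n (\<lambda>x. \<bar>dot ?n x y\<bar>) = (\<integral>x. indicator (unit_ball ?n) (H (trunc ?n x)) * \<bar>dot ?n (H (trunc ?n x)) y\<bar> \<partial>lam ?n)"
    unfolding ball_int_def
    using integral_lam_GL[OF H(1), of "\<lambda>x. indicator (unit_ball ?n) x * \<bar>dot ?n x y\<bar>"] absdet_isometry[OF H(1) iso]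
    by simp
  also have "\<dots> = (\<integral>x. vnorm ?n y * (indicator (unit_ball ?n) x * \<bar>x m\<bar>) \<partial>lam ?n)"
  proof (rule integral_lam_cong)
    fix x assume x: "x \<in> Rn ?n"
    have "H x \<in> unit_ball ?n \<longleftrightarrow> x \<in> unit_ball ?n"
      using x GL_in_Rn[OF H(1) x] by (simp add: unit_ball_iff iso)
    moreover have "\<bar>dot ?n (H x) y\<bar> = vnorm ?n y * \<bar>x m\<bar>"
    proof -
      have "dot ?n (H x) y = vnorm ?n y * dot ?n (H x) (H (unit_vec m))"
        by (subst y_eq) (simp add: dot_simps H(2))
      then show ?thesis
        using pos by (simp add: H(3) dot_unit_vec abs_mult)
    qed
    ultimately show "indicator (unit_ball ?n) (H (trunc ?n x)) * \<bar>dot ?n (H (trunc ?n x)) y\<bar> =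
        vnorm ?n y * (indicator (unit_ball ?n) x * \<bar>x m\<bar>)"
      using x by (simp add: trunc_id indicator_def)
  qed measurable
  also have "\<dots> = vnorm ?n y * ball_int ?n (\<lambda>x. \<bar>x m\<bar>)"
    by (simp add: ball_int_def)
  finally show ?thesis
    by (simp add: ball_int_abs_last)
qed

text \<open>A Riemann sum on a cubic grid. Nodes and weights are fixed before the integrand, because
  one list of segments has to serve all directions \<open>v\<close> at once and also the function |A
  x|. Rounding down may leave the ball, hence the Lipschitz condition on all of
  \<open>Rn n\<close>.\<close>

lemma quadrature:
  assumes "\<eta> > 0"
  obtains X w where "finite X" "X \<subseteq> Rn n" "\<And>x. w x \<ge> (0::real)"
    "\<forall>g L. g \<in> borel_measurable borel \<longrightarrow> L \<ge> 0 \<longrightarrow>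
       (\<forall>x\<in>Rn n. \<forall>y\<in>Rn n. \<bar>g x - g y\<bar> \<le> L * vnorm n (x - y)) \<longrightarrow>
       \<bar>(\<Sum>x\<in>X. w x * g x) - ball_int n g\<bar> \<le> L * \<eta>"
proof -
  obtain N0 :: nat where N0: "n * unit_ball_vol n / \<eta> < N0"
    using reals_Archimedean2 by blast
  \<comment> \<open>A point moves by at most n/N under rounding, since the norm is at most the sum
    of the coordinate errors. \<open>N\<close> makes n/N times the volume of the ball at most
    \<open>\<eta>\<close>.\<close>
  define N where "N = Suc N0"
  have N: "real N > 0" "n / N * unit_ball_vol n \<le> \<eta>"
    using N0 assms by (simp_all add: N_def field_simps)
  define q :: "vec \<Rightarrow> vec" where "q = (\<lambda>x i. if i < n then real_of_int \<lfloor>real N * x i\<rfloor> / real N else 0)"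
  have [measurable]: "q \<in> borel_measurable borel"
  proof (rule borel_measurable_vecI)
    fix i
    show "(\<lambda>x. q x i) \<in> borel_measurable borel"
      by (cases "i < n") (simp_all add: q_def)
  qed
  have qR: "q x \<in> Rn n" for x
    by (simp add: q_def Rn_iff)
  have near: "vnorm n (x - q x) \<le> n / N" for x
  proof -
    have "\<bar>x i - q x i\<bar> \<le> 1 / N" if "i < n" for i
    proof -
      have "x i - q x i = (real N * x i - real_of_int \<lfloor>real N * x i\<rfloor>) / N"
        using N(1) that by (simp add: q_def diff_divide_distrib)
      moreover have "\<bar>real N * x i - real_of_int \<lfloor>real N * x i\<rfloor>\<bar> \<le> 1" by linarith
      ultimately show ?thesis
        using N(1) by (simp add: abs_divide divide_right_mono)
    qed
    then have "(\<Sum>i<n. \<bar>(x - q x) i\<bar>) \<le> (\<Sum>i<n. 1 / N)"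
      by (intro sum_mono) (simp add: vec_apply)
    then show ?thesis
      using L2_set_le_sum_abs[of "x - q x" "{..<n}"] by simp
  qed
  define X where "X = q ` unit_ball n"
  have "finite X"
  proof -
    define G where "G = (\<lambda>k::int. k / N) ` {- int N..int N}"
    have "finite G" by (simp add: G_def)
    have "X \<subseteq> trunc n ` (\<Pi>\<^sub>E i\<in>{..<n}. G)"
    proof
      fix v assume "v \<in> X"
      then obtain x where x: "x \<in> unit_ball n" "v = q x" by (auto simp: X_def)
      have "q x i \<in> G" if "i < n" for i
      proof -
        have "\<bar>x i\<bar> \<le> 1"
          using x abs_coord_le_vnorm[OF that, of x] by (simp add: unit_ball_iff)
        then have "\<bar>N * x i\<bar> \<le> N" using N by (simp add: abs_mult)
        then have "\<lfloor>N * x i\<rfloor> \<in> {- int N..int N}"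
          by (auto simp: le_floor_iff floor_le_iff abs_le_iff)
        then show ?thesis using that by (auto simp: G_def q_def)
      qed
      then have "restrict (q x) {..<n} \<in> (\<Pi>\<^sub>E i\<in>{..<n}. G)" by auto
      moreover have "trunc n (restrict (q x) {..<n}) = q x"
        by (auto simp: trunc_def q_def)
      ultimately show "v \<in> trunc n ` (\<Pi>\<^sub>E i\<in>{..<n}. G)"
        using x(2) by (metis image_eqI)
    qed
    then show ?thesis
      using \<open>finite G\<close> by (meson finite_PiE finite_imageI finite_lessThan finite_subset)
  qed
  \<comment> \<open>The weight of a node is the volume of the part of the ball that rounds to
    it.\<close>
  define w where "w = (\<lambda>v. V n {x \<in> unit_ball n. q x = v})"
  have main: "\<bar>(\<Sum>v\<in>X. w v * g v) - ball_int n g\<bar> \<le> L * \<eta>"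
    if [measurable]: "g \<in> borel_measurable borel" and "L \<ge> 0"
      and lip: "\<And>x y. x \<in> Rn n \<Longrightarrow> y \<in> Rn n \<Longrightarrow> \<bar>g x - g y\<bar> \<le> L * vnorm n (x - y)" for g L
  proof -
    have close: "\<bar>g (q x) - g x\<bar> \<le> L * (n / N)" if "x \<in> unit_ball n" for x
    proof -
      have "\<bar>g (q x) - g x\<bar> \<le> L * vnorm n (x - q x)"
        using lip[of x "q x"] qR[of x] that by (simp add: unit_ball_iff abs_minus_commute)
      also have "\<dots> \<le> L * (n / N)"
        using \<open>L \<ge> 0\<close> near by (intro mult_left_mono) auto
      finally show ?thesis .
    qed
    have bnd: "\<bar>g x\<bar> \<le> \<bar>g 0\<bar> + L" if "x \<in> unit_ball n" for x
    proof -
      have "\<bar>g x - g 0\<bar> \<le> L * vnorm n x"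
        using lip[of x 0] that by (simp add: unit_ball_iff)
      also have "\<dots> \<le> L * 1"
        using that \<open>L \<ge> 0\<close> by (intro mult_left_mono) (auto simp: unit_ball_iff)
      finally show ?thesis by linarith
    qed
    have int_g: "integrable (lam n) (\<lambda>x. indicator (unit_ball n) x * g x)"
      by (rule integrable_ball[OF _ bnd]) auto
    have int_q: "integrable (lam n) (\<lambda>x. indicator (unit_ball n) x * g (q x))"
      by (rule integrable_ball[where C = "\<bar>g 0\<bar> + L + L * (n / N)"]) (measurable, use close bnd in \<open>fastforce\<close>)
    have cell: "{x \<in> unit_ball n. q x = v} \<in> sets borel" for v
    proof -
      have "{x\<in>space borel. x \<in> unit_ball n \<and> q x = v} \<in> sets borel" by measurable
      then show ?thesis by simp
    qed
    have "(\<Sum>v\<in>X. w v * g v) = (\<Sum>v\<in>X. \<integral>x. indicator {x \<in> unit_ball n. q x = v} x * g v \<partial>lam n)"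
      unfolding w_def using cell by (intro sum.cong) auto
    also have "\<dots> = (\<integral>x. (\<Sum>v\<in>X. indicator {x \<in> unit_ball n. q x = v} x * g v) \<partial>lam n)"
    proof (rule Bochner_Integration.integral_sum[symmetric])
      fix v assume "v \<in> X"
      have "emeasure (lam n) {x \<in> unit_ball n. q x = v} \<le> emeasure (lam n) (unit_ball n)"
        by (intro emeasure_mono) auto
      then have "emeasure (lam n) {x \<in> unit_ball n. q x = v} < \<infinity>"
        using le_less_trans[OF _ emeasure_lam_compact[OF compact_unit_ball]] by blast
      then show "integrable (lam n) (\<lambda>x. indicator {x \<in> unit_ball n. q x = v} x * g v)"
        using cell by (intro integrable_mult_left) (auto simp: integrable_indicator_iff)
    qed
    also have "\<dots> = (\<integral>x. indicator (unit_ball n) x * g (q x) \<partial>lam n)"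
    proof (rule Bochner_Integration.integral_cong[OF refl])
      fix x
      show "(\<Sum>v\<in>X. indicator {x \<in> unit_ball n. q x = v} x * g v) = indicator (unit_ball n) x * g (q x)"
      proof (cases "x \<in> unit_ball n")
        case True
        then have "(\<Sum>v\<in>X. indicator {x \<in> unit_ball n. q x = v} x * g v) = (\<Sum>v\<in>X. if q x = v then g v else 0)"
          by (intro sum.cong) (auto simp: indicator_def)
        also have "\<dots> = g (q x)"
          using \<open>finite X\<close> True by (simp add: X_def)
        finally show ?thesis using True by simp
      qed (simp add: indicator_def)
    qed
    finally have "(\<Sum>v\<in>X. w v * g v) - ball_int n g =
        (\<integral>x. indicator (unit_ball n) x * g (q x) - indicator (unit_ball n) x * g x \<partial>lam n)"
      unfolding ball_int_def using int_g int_q by (subst Bochner_Integration.integral_diff) auto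
    then have "\<bar>(\<Sum>v\<in>X. w v * g v) - ball_int n g\<bar> \<le>
        (\<integral>x. \<bar>indicator (unit_ball n) x * g (q x) - indicator (unit_ball n) x * g x\<bar> \<partial>lam n)"
      by (simp add: integral_abs_bound)
    also have "\<dots> \<le> (\<integral>x. indicator (unit_ball n) x * (L * (n / N)) \<partial>lam n)"
    proof (rule integral_mono)
      show "integrable (lam n) (\<lambda>x. \<bar>indicator (unit_ball n) x * g (q x) - indicator (unit_ball n) x * g x\<bar>)"
        using int_g int_q by auto
      show "integrable (lam n) (\<lambda>x. indicator (unit_ball n) x * (L * (n / N)))"
        by (intro integrable_mult_left) (simp add: integrable_indicator_iff emeasure_unit_ball)
    qed (use close in \<open>auto simp: indicator_def\<close>)
    also have "\<dots> = L * (n / N * unit_ball_vol n)"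
      by (simp add: V_unit_ball)
    also have "\<dots> \<le> L * \<eta>"
      using N \<open>L \<ge> 0\<close> by (intro mult_left_mono)
    finally show ?thesis .
  qed
  show ?thesis
  proof (rule that[of X w])
    show "X \<subseteq> Rn n" "w x \<ge> 0" for x
      using qR by (auto simp: X_def w_def)
  qed (use \<open>finite X\<close> main in blast)+
qed

text \<open>
  The substitution turns the right-hand side into an integral of the norm over the image of the ball;
  among all sets of the same volume the centred ball minimizes it.
\<close>

lemma ball_int_vnorm_GL:
  assumes A: "A \<in> GL n" and "n \<ge> 1"
  shows "absdet n A powr (1 / n) * ball_int n (vnorm n) \<le> ball_int n (\<lambda>x. vnorm n (A (trunc n x)))"
proof -
  \<comment> \<open>The radius for which the centred ball has the same volume as the image of the
    unit ball under \<open>A\<close>.\<close>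
  define r where "r = absdet n A powr (1 / n)"
  have pos: "absdet n A > 0" by (rule absdet_pos[OF A])
  then have "r > 0" by (simp add: r_def)
  have rn: "r ^ n = absdet n A"
    using \<open>n \<ge> 1\<close> pos unfolding r_def by (subst powr_realpow[symmetric]) (simp_all add: powr_powr)
  define E where "E = A ` unit_ball n"
  define R where "R = (*\<^sub>R) r ` unit_ball n"
  note cE = compact_GL[OF A compact_unit_ball unit_ball_subset_Rn, folded E_def]
  note cR = compact_scaleR[OF compact_unit_ball, of r n, folded R_def]
  note [measurable] = compact_borel[OF cE] compact_borel[OF cR] measurable_GL[OF A]
  have EV: "V n E = V n R"
    unfolding E_def R_def using \<open>r > 0\<close> rn measure_lam_GL[OF A, of "unit_ball n"] unit_ball_subset_Rn
    by (simp add: V_scaleR)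
  have R_iff: "x \<in> R \<longleftrightarrow> vnorm n x \<le> r" if "x \<in> Rn n" for x
    using ball_subset_scaled_unit_ball[OF \<open>r > 0\<close>, of n] that by (auto simp: R_def)
  have int: "integrable (lam n) (\<lambda>x. indicator S x * vnorm n x)" if S: "compact S" for S
  proof -
    obtain c where "c > 0" "\<And>x. x \<in> S \<Longrightarrow> vnorm n x \<le> c"
      using compact_bounded_vnorm[OF S] by metis
    then show ?thesis
      using S emeasure_lam_compact[OF S, of n] compact_borel[OF S]
      by (intro integrableI_bounded_set[where A = S and B = c]) (auto simp: indicator_def L2_set_nonneg)
  qed
  have int': "integrable (lam n) (\<lambda>x. indicator S x :: real)" if "compact S" for S
    using that emeasure_lam_compact[OF that, of n] compact_borel[OF that]
    by (simp add: integrable_indicator_iff)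
  have eq1: "r ^ (n + 1) * ball_int n (vnorm n) = (\<integral>x. indicator R x * vnorm n x \<partial>lam n)"
  proof -
    have "(\<integral>x. indicator R x * vnorm n x \<partial>lam n) =
        absdet n ((*\<^sub>R) r) * (\<integral>x. indicator R (r *\<^sub>R trunc n x) * vnorm n (r *\<^sub>R trunc n x) \<partial>lam n)"
      using \<open>r > 0\<close> by (intro integral_lam_GL[symmetric] scaleR_GL) (auto simp: L2_set_nonneg)
    also have "(\<integral>x. indicator R (r *\<^sub>R trunc n x) * vnorm n (r *\<^sub>R trunc n x) \<partial>lam n) =
        (\<integral>x. r * (indicator (unit_ball n) x * vnorm n x) \<partial>lam n)"
    proof (rule integral_lam_cong)
      fix x assume x: "x \<in> Rn n"
      have "r *\<^sub>R x \<in> R \<longleftrightarrow> x \<in> unit_ball n"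
        using x \<open>r > 0\<close> by (auto simp: R_def)
      then show "indicator R (r *\<^sub>R trunc n x) * vnorm n (r *\<^sub>R trunc n x) = r * (indicator (unit_ball n) x * vnorm n x)"
        using x \<open>r > 0\<close> by (simp add: trunc_id vnorm_scaleR indicator_def)
    qed measurable
    finally show ?thesis
      using \<open>r > 0\<close> by (simp add: absdet_scaleR ball_int_def)
  qed
  have eq2: "absdet n A * ball_int n (\<lambda>x. vnorm n (A (trunc n x))) = (\<integral>x. indicator E x * vnorm n x \<partial>lam n)"
  proof -
    have "(\<integral>x. indicator E x * vnorm n x \<partial>lam n) =
        absdet n A * (\<integral>x. indicator E (A (trunc n x)) * vnorm n (A (trunc n x)) \<partial>lam n)"
      by (intro integral_lam_GL[symmetric] A) (auto simp: L2_set_nonneg)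
    also have "(\<integral>x. indicator E (A (trunc n x)) * vnorm n (A (trunc n x)) \<partial>lam n) =
        ball_int n (\<lambda>x. vnorm n (A (trunc n x)))"
      unfolding ball_int_def
    proof (rule integral_lam_cong)
      fix x assume x: "x \<in> Rn n"
      have "A x \<in> E \<longleftrightarrow> x \<in> unit_ball n"
        unfolding E_def by (rule inj_on_image_mem_iff[OF GL_inj[OF A] x unit_ball_subset_Rn])
      then show "indicator E (A (trunc n x)) * vnorm n (A (trunc n x)) = indicator (unit_ball n) x * vnorm n (A (trunc n x))"
        using x by (simp add: trunc_id indicator_def)
    qed measurable
    finally show ?thesis by simp
  qed
  have "(\<integral>x. indicator R x * vnorm n x \<partial>lam n) - (\<integral>x. indicator E x * vnorm n x \<partial>lam n) =
      (\<integral>x. indicator R x * vnorm n x - indicator E x * vnorm n x \<partial>lam n)"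
    using int cR cE by (intro Bochner_Integration.integral_diff[symmetric]) auto
  also have "\<dots> \<le> (\<integral>x. r * (indicator R x - indicator E x) \<partial>lam n)"
  proof (rule integral_mono_AE)
    \<comment> \<open>The norm is at most \<open>r\<close> on \<open>R\<close> outside
      \<open>E\<close> and exceeds \<open>r\<close> on \<open>E\<close> outside \<open>R\<close>;
      the sign of the difference of indicators makes both cases work.\<close>
    show "AE x in lam n. indicator R x * vnorm n x - indicator E x * vnorm n x \<le> r * (indicator R x - indicator E x)"
      by (rule eventually_mono[OF AE_lam_Rn]) (auto simp: indicator_def R_iff)
  qed (use int int' cR cE in auto)
  also have "\<dots> = r * (V n R - V n E)"
    using int' cR cE compact_borel by (simp add: Bochner_Integration.integral_diff)
  finally have "r ^ (n + 1) * ball_int n (vnorm n) \<le> absdet n A * ball_int n (\<lambda>x. vnorm n (A (trunc n x)))"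
    using EV eq1 eq2 by simp
  then have "absdet n A * (r * ball_int n (vnorm n)) \<le> absdet n A * ball_int n (\<lambda>x. vnorm n (A (trunc n x)))"
    by (simp add: rn[symmetric] mult_ac)
  then show ?thesis
    using pos unfolding r_def by (simp add: mult_le_cancel_left_pos)
qed

lemma vnorm_GL_le:
  assumes A: "A \<in> GL n"
  obtains L where "L \<ge> 0" "\<And>x. x \<in> Rn n \<Longrightarrow> vnorm n (A x) \<le> L * vnorm n x"
proof -
  obtain L where L: "L > 0" "\<And>x. x \<in> A ` unit_ball n \<Longrightarrow> vnorm n x \<le> L"
    using compact_bounded_vnorm[OF compact_GL[OF A compact_unit_ball unit_ball_subset_Rn]] by metis
  have "vnorm n (A x) \<le> L * vnorm n x" if x: "x \<in> Rn n" for x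
  proof (cases "x = 0")
    case False
    have pos: "vnorm n x > 0" by (rule vnorm_pos[OF x False])
    have "(1 / vnorm n x) *\<^sub>R x \<in> unit_ball n"
      using x pos by (auto simp: unit_ball_iff vnorm_scaleR intro: subspace_scale[OF subspace_Rn])
    then have "vnorm n (A ((1 / vnorm n x) *\<^sub>R x)) \<le> L"
      by (intro L) auto
    then show ?thesis
      using pos by (simp add: GL_scaleR[OF A x] vnorm_scaleR field_simps)
  qed (simp add: GL_zero[OF A])
  then show ?thesis using L that[of L] by auto
qed

lemma id_GL: "(\<lambda>x. x) \<in> GL n"
  by (rule GLI[where S = "\<lambda>x. x"]) auto

text \<open>The generators are the quadrature nodes x scaled by w(x)/J, where J is the integral of
  |<x, v>| over the ball for a unit vector \<open>v\<close>. The support function then discretizes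
  the norm. For the prescribed map \<open>A\<close> the same list discretizes the integral of |A x|
  divided by J, which \<open>ball_int_vnorm_GL\<close> bounds from below.\<close>

lemma zonotope_exists:
  assumes A: "A \<in> GL (Suc m)" and "\<eta> > 0"
  obtains us where "set us \<subseteq> Rn (Suc m)"
    "\<And>v. v \<in> Rn (Suc m) \<Longrightarrow> (1 - \<eta>) * vnorm (Suc m) v \<le> (\<Sum>u\<leftarrow>us. \<bar>dot (Suc m) u v\<bar>)"
    "\<And>v. v \<in> Rn (Suc m) \<Longrightarrow> (\<Sum>u\<leftarrow>us. \<bar>dot (Suc m) u v\<bar>) \<le> (1 + \<eta>) * vnorm (Suc m) v"
    "absdet (Suc m) A powr (1 / Suc m) * (Suc m * unit_ball_vol (Suc m) / (2 * unit_ball_vol m)) - \<eta>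
       \<le> (\<Sum>u\<leftarrow>us. vnorm (Suc m) (A u))"
proof -
  let ?n = "Suc m"
  define J where "J = 2 * unit_ball_vol m / (m + 2)"
  have J: "J > 0" by (simp add: J_def)
  obtain L where L: "L \<ge> 0" "\<And>x. x \<in> Rn ?n \<Longrightarrow> vnorm ?n (A x) \<le> L * vnorm ?n x"
    using vnorm_GL_le[OF A] by metis
  note [measurable] = measurable_GL[OF A]
  \<comment> \<open>One accuracy for two purposes: the integrand |<x, v>| has Lipschitz constant
    |v|, and |A x| has Lipschitz constant \<open>L\<close>. Dividing by \<open>L + 1\<close> covers
    both and avoids a zero denominator.\<close>
  define \<delta> where "\<delta> = \<eta> * J / (L + 1)"
  have \<delta>: "\<delta> > 0" "\<delta> \<le> \<eta> * J" "L * \<delta> \<le> \<eta> * J"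
  proof -
    have L1: "L + 1 > 0" using L(1) by linarith
    show "\<delta> > 0" unfolding \<delta>_def using J \<open>\<eta> > 0\<close> L1 by (intro divide_pos_pos mult_pos_pos)
    have "(L + 1) * \<delta> = \<eta> * J" unfolding \<delta>_def using L1 by (metis less_numeral_extra(3) nonzero_mult_div_cancel_left times_divide_eq_right)
    moreover have "(L + 1) * \<delta> = L * \<delta> + \<delta>" by (metis distrib_right mult_1)
    moreover have "0 \<le> L * \<delta>" using \<open>\<delta> > 0\<close> L(1) by (intro mult_nonneg_nonneg) auto
    ultimately show "\<delta> \<le> \<eta> * J" "L * \<delta> \<le> \<eta> * J"
      using \<open>\<delta> > 0\<close> by linarith+
  qed
  obtain X w where X: "finite X" "X \<subseteq> Rn ?n" "\<And>x. w x \<ge> (0::real)"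
    and quad: "\<forall>g L. g \<in> borel_measurable borel \<longrightarrow> L \<ge> 0 \<longrightarrow>
       (\<forall>x\<in>Rn ?n. \<forall>y\<in>Rn ?n. \<bar>g x - g y\<bar> \<le> L * vnorm ?n (x - y)) \<longrightarrow>
       \<bar>(\<Sum>x\<in>X. w x * g x) - ball_int ?n g\<bar> \<le> L * \<delta>"
    by (rule quadrature[OF \<delta>(1), of ?n]) (rule that)
  obtain xs where xs: "set xs = X" "distinct xs"
    using finite_distinct_list[OF X(1)] by blast
  define us where "us = map (\<lambda>x. (w x / J) *\<^sub>R x) xs"
  have sum_us: "(\<Sum>u\<leftarrow>us. g u) = (\<Sum>x\<in>X. g ((w x / J) *\<^sub>R x))" for g :: "vec \<Rightarrow> real"
    using xs by (simp add: us_def o_def sum_list_distinct_conv_sum_set)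
  have dots: "J * (\<Sum>u\<leftarrow>us. \<bar>dot ?n u v\<bar>) = (\<Sum>x\<in>X. w x * \<bar>dot ?n x v\<bar>)" for v
    using J X(3) by (simp add: sum_us dot_simps abs_mult sum_distrib_left)
  have close: "\<bar>J * (\<Sum>u\<leftarrow>us. \<bar>dot ?n u v\<bar>) - J * vnorm ?n v\<bar> \<le> J * (\<eta> * vnorm ?n v)" if v: "v \<in> Rn ?n" for v
  proof -
    have "\<bar>(\<Sum>x\<in>X. w x * \<bar>dot ?n x v\<bar>) - ball_int ?n (\<lambda>x. \<bar>dot ?n x v\<bar>)\<bar> \<le> vnorm ?n v * \<delta>"
    proof (rule quad[rule_format])
      show "\<bar>\<bar>dot ?n x v\<bar> - \<bar>dot ?n y v\<bar>\<bar> \<le> vnorm ?n v * vnorm ?n (x - y)" for x y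
        using abs_dot_le[of ?n "x - y" v] by (simp add: dot_simps mult.commute)
    qed (auto simp: L2_set_nonneg)
    also have "\<dots> \<le> vnorm ?n v * (\<eta> * J)"
      using \<delta> by (intro mult_left_mono) (auto simp: L2_set_nonneg)
    finally show ?thesis
      unfolding dots ball_int_abs_dot[OF v, folded J_def] by (simp only: mult_ac)
  qed
  have close': "\<bar>(\<Sum>u\<leftarrow>us. \<bar>dot ?n u v\<bar>) - vnorm ?n v\<bar> \<le> \<eta> * vnorm ?n v" if v: "v \<in> Rn ?n" for v
    using close[OF v] J by (simp add: abs_mult flip: right_diff_distrib)
  have "absdet ?n A powr (1 / ?n) * (?n * unit_ball_vol ?n / (2 * unit_ball_vol m)) - \<eta> \<le> (\<Sum>u\<leftarrow>us. vnorm ?n (A u))"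
  proof -
    have "J * (\<Sum>u\<leftarrow>us. vnorm ?n (A u)) = (\<Sum>x\<in>X. w x * vnorm ?n (A (trunc ?n x)))"
      using J X(2,3) unfolding sum_us sum_distrib_left
      by (intro sum.cong) (auto simp: trunc_id GL_scaleR[OF A] vnorm_scaleR subset_eq)
    moreover have "\<bar>(\<Sum>x\<in>X. w x * vnorm ?n (A (trunc ?n x))) - ball_int ?n (\<lambda>x. vnorm ?n (A (trunc ?n x)))\<bar> \<le> L * \<delta>"
    proof (rule quad[rule_format])
      fix x y assume xy: "x \<in> Rn ?n" "y \<in> Rn ?n"
      have "A (x - y) = A x - A y"
        using GL_add[OF A, of "x - y" y] xy by (simp add: subspace_diff[OF subspace_Rn] algebra_simps)
      then have "\<bar>vnorm ?n (A x) - vnorm ?n (A y)\<bar> \<le> vnorm ?n (A (x - y))"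
        using vnorm_diff_le[of "A x" ?n "A y"] by simp
      also have "\<dots> \<le> L * vnorm ?n (x - y)"
        using xy by (intro L subspace_diff[OF subspace_Rn])
      finally show "\<bar>vnorm ?n (A (trunc ?n x)) - vnorm ?n (A (trunc ?n y))\<bar> \<le> L * vnorm ?n (x - y)"
        using xy by (simp add: trunc_id)
    qed (use L in auto)
    moreover note ball_int_vnorm_GL[OF A]
    ultimately have "absdet ?n A powr (1 / ?n) * ball_int ?n (vnorm ?n) - \<eta> * J \<le> J * (\<Sum>u\<leftarrow>us. vnorm ?n (A u))"
      using \<delta>(3) by linarith
    \<comment> \<open>The denominators n + 1 of the norm integral and m + 2 of J coincide.\<close>
    moreover have "ball_int ?n (vnorm ?n) = J * (?n * unit_ball_vol ?n / (2 * unit_ball_vol m))"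
      by (simp add: ball_int_vnorm J_def add.commute)
    ultimately have "J * (absdet ?n A powr (1 / ?n) * (?n * unit_ball_vol ?n / (2 * unit_ball_vol m)) - \<eta>) \<le> J * (\<Sum>u\<leftarrow>us. vnorm ?n (A u))"
      by (simp add: algebra_simps)
    then show ?thesis
      using J by (subst (asm) mult_le_cancel_left_pos) auto
  qed
  moreover have "set us \<subseteq> Rn ?n"
    using xs X(2) by (auto simp: us_def intro: subspace_scale[OF subspace_Rn])
  moreover have "(1 - \<eta>) * vnorm ?n v \<le> (\<Sum>u\<leftarrow>us. \<bar>dot ?n u v\<bar>)"
    "(\<Sum>u\<leftarrow>us. \<bar>dot ?n u v\<bar>) \<le> (1 + \<eta>) * vnorm ?n v" if "v \<in> Rn ?n" for v
    using close'[OF that] by (auto simp: algebra_simps abs_le_iff)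
  ultimately show ?thesis using that by blast
qed

section \<open>Surface area\<close>

text \<open>Nonempty interior is expressed by an inscribed ball, the form in which the upper bound
  for parallel bodies uses it.\<close>

definition body :: "nat \<Rightarrow> vec set \<Rightarrow> bool" where
  "body n K \<longleftrightarrow> compact_convex n K \<and>
     (\<exists>x\<in>Rn n. \<exists>r>0. \<forall>b\<in>unit_ball n. x + r *\<^sub>R b \<in> K)"

lemma body_compact_convex: "body n K \<Longrightarrow> compact_convex n K"
  by (simp add: body_def)

lemma convex_body_imp_body:
  assumes "convex_body n K"
  shows "body n K"
  unfolding body_def
proof
  show "compact_convex n K"
    unfolding compact_convex_def
  proof (intro conjI)
    show "compact K" "K \<subseteq> Rn n"
      using assms by (auto simp: convex_body_def compactin_Euclidean_iff)
    show "convex K"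
    proof (rule convexI)
      fix x y u v assume *: "x \<in> K" "y \<in> K" "0 \<le> u" "0 \<le> v" "u + v = (1::real)"
      then have "(\<lambda>i. (1 - v) * x i + v * y i) \<in> K"
        using assms by (auto simp: convex_body_def)
      also have "(\<lambda>i. (1 - v) * x i + v * y i) = u *\<^sub>R x + v *\<^sub>R y"
        using * by (auto simp: fun_eq_iff vec_apply eq_diff_eq[symmetric])
      finally show "u *\<^sub>R x + v *\<^sub>R y \<in> K" .
    qed
  qed
  obtain x U where xU: "x \<in> U" "openin (Euclidean_space n) U" "U \<subseteq> K"
    using assms by (auto simp: convex_body_def interior_of_def)
  then obtain W where W: "openin (product_topology (\<lambda>i::nat. euclideanreal) UNIV) W" "U = W \<inter> Rn n"
    by (auto simp: Euclidean_space_def openin_subtopology)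
  have "x \<in> W" using xU(1) W(2) by blast
  from product_topology_open_contains_basis[OF W(1) this]
  obtain X where X: "x \<in> (\<Pi>\<^sub>E i\<in>UNIV. X i)" "\<forall>i. openin euclideanreal (X i)" "(\<Pi>\<^sub>E i\<in>UNIV. X i) \<subseteq> W"
    by blast
  have x: "x \<in> Rn n" using xU W by auto
  have "\<exists>e>0. \<forall>t. \<bar>t - x i\<bar> < e \<longrightarrow> t \<in> X i" for i
  proof -
    have "open (X i)" "x i \<in> X i"
      using X(1,2) by (simp_all only: open_openin PiE_iff) blast+
    then show ?thesis
      by (auto simp: open_dist dist_real_def)
  qed
  then obtain e where e: "\<And>i. e i > 0" "\<And>i t. \<bar>t - x i\<bar> < e i \<Longrightarrow> t \<in> X i"
    by metis
  \<comment> \<open>Only the coordinates below \<open>n\<close> vary, so a finite minimum of the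
    side lengths suffices. The entry 1 keeps the set nonempty for n = 0, and halving gives strict
    inequalities.\<close>
  define r where "r = Min (insert 1 (e ` {..<n})) / 2"
  have r: "r > 0" "\<And>i. i < n \<Longrightarrow> r < e i"
  proof -
    have "Min (insert 1 (e ` {..<n})) > 0"
      using e(1) by (subst Min_gr_iff) auto
    then show "r > 0" by (simp add: r_def)
    show "r < e i" if "i < n" for i
    proof -
      have "Min (insert 1 (e ` {..<n})) \<le> e i"
        using that by (intro Min_le) auto
      then show ?thesis using e(1)[of i] unfolding r_def by linarith
    qed
  qed
  have "x + r *\<^sub>R b \<in> K" if b: "b \<in> unit_ball n" for b
  proof -
    have "\<bar>(x + r *\<^sub>R b) i - x i\<bar> < e i" for i
    proof (cases "i < n")
      case True
      have "\<bar>b i\<bar> \<le> 1"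
        using b abs_coord_le_vnorm[OF True, of b] by (simp add: unit_ball_iff)
      then have "r * \<bar>b i\<bar> \<le> r * 1" using r(1) by (intro mult_left_mono) auto
      also have "\<dots> < e i" using r(2)[OF True] by simp
      finally show ?thesis using r(1) by (simp add: vec_apply abs_mult)
    next
      case False
      then show ?thesis using b e(1) by (simp add: vec_apply unit_ball_iff Rn_iff)
    qed
    then have "x + r *\<^sub>R b \<in> W" using e(2) by (intro subsetD[OF X(3)]) (simp add: PiE_iff)
    moreover have "x + r *\<^sub>R b \<in> Rn n"
      using x b by (auto simp: unit_ball_iff intro: subspace_add[OF subspace_Rn] subspace_scale[OF subspace_Rn])
    ultimately show ?thesis using xU W by auto
  qed
  then show "\<exists>x\<in>Rn n. \<exists>r>0. \<forall>b\<in>unit_ball n. x + r *\<^sub>R b \<in> K"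
    using x r(1) by blast
qed

lemma V_body_pos:
  assumes "body n K"
  shows "V n K > 0"
proof -
  obtain x r where xr: "x \<in> Rn n" "r > 0" "\<And>b. b \<in> unit_ball n \<Longrightarrow> x + r *\<^sub>R b \<in> K"
    using assms by (auto simp: body_def)
  have "0 < r ^ n * unit_ball_vol n" using xr by simp
  also have "\<dots> = V n ((+) x ` (*\<^sub>R) r ` unit_ball n)"
    using xr by (simp add: V_translate V_scaleR compact_scaleR V_unit_ball)
  also have "\<dots> \<le> V n K"
    using xr assms by (intro V_mono compact_translate compact_scaleR) (auto simp: body_def compact_convex_def)
  finally show ?thesis .
qed

lemma body_GL:
  assumes K: "body n K" and T: "T \<in> GL n"
  shows "body n (T ` K)"
  unfolding body_def
proof
  show "compact_convex n (T ` K)"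
    using K T by (intro compact_convex_GL body_compact_convex)
  obtain x r where xr: "x \<in> Rn n" "r > 0" "\<And>b. b \<in> unit_ball n \<Longrightarrow> x + r *\<^sub>R b \<in> K"
    using K by (auto simp: body_def)
  define S where "S = inv_into (Rn n) T"
  have S: "S \<in> GL n" unfolding S_def by (rule GL_inv[OF T])
  obtain L where L: "L \<ge> 0" "\<And>x. x \<in> Rn n \<Longrightarrow> vnorm n (S x) \<le> L * vnorm n x"
    using vnorm_GL_le[OF S] by metis
  \<comment> \<open>Since \<open>L\<close> bounds the inverse of \<open>T\<close>, a ball of radius
    r/(L + 1) is carried back into one of radius at most r.\<close>
  have "T x + (r / (L + 1)) *\<^sub>R b \<in> T ` K" if b: "b \<in> unit_ball n" for b
  proof -
    have bR: "b \<in> Rn n" using b by (simp add: unit_ball_iff)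
    have "vnorm n (S b) \<le> L * vnorm n b" by (rule L(2)[OF bR])
    also have "\<dots> \<le> L * 1" using b L(1) by (intro mult_left_mono) (auto simp: unit_ball_iff)
    finally have "(1 / (L + 1)) *\<^sub>R S b \<in> unit_ball n"
      using L(1) GL_in_Rn[OF S bR]
      by (auto simp: unit_ball_iff vnorm_scaleR field_simps intro: subspace_scale[OF subspace_Rn])
    then have "x + r *\<^sub>R (1 / (L + 1)) *\<^sub>R S b \<in> K" by (rule xr)
    moreover have "T (x + r *\<^sub>R (1 / (L + 1)) *\<^sub>R S b) = T x + (r / (L + 1)) *\<^sub>R b"
    proof -
      have 1: "c *\<^sub>R S b \<in> Rn n" for c
        using GL_in_Rn[OF S bR] by (rule subspace_scale[OF subspace_Rn])
      have "T (x + (r / (L + 1)) *\<^sub>R S b) = T x + (r / (L + 1)) *\<^sub>R T (S b)"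
        by (subst GL_add[OF T xr(1) 1], subst GL_scaleR[OF T GL_in_Rn[OF S bR]]) (rule refl)
      then show ?thesis
        using GL_inv_right[OF T bR] by (simp add: S_def)
    qed
    ultimately show ?thesis by (metis image_eqI)
  qed
  then show "\<exists>x\<in>Rn n. \<exists>r>0. \<forall>b\<in>unit_ball n. x + r *\<^sub>R b \<in> T ` K"
    using xr L(1) GL_in_Rn[OF T xr(1)] by (intro bexI[of _ "T x"] exI[of _ "r / (L + 1)"]) auto
qed

lemma body_trunc:
  assumes K: "body (Suc n) K"
  shows "body n (trunc n ` K)"
  unfolding body_def
proof
  show "compact_convex n (trunc n ` K)"
    using K by (intro compact_convex_trunc body_compact_convex)
  obtain x r where xr: "x \<in> Rn (Suc n)" "r > 0" "\<And>b. b \<in> unit_ball (Suc n) \<Longrightarrow> x + r *\<^sub>R b \<in> K"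
    using K by (auto simp: body_def)
  have "trunc n x + r *\<^sub>R b \<in> trunc n ` K" if b: "b \<in> unit_ball n" for b
  proof -
    have "vnorm (Suc n) b = vnorm n b"
      using b by (simp add: L2_set_def unit_ball_iff Rn_iff)
    then have "b \<in> unit_ball (Suc n)"
      using b by (auto simp: unit_ball_iff Rn_iff)
    then have "trunc n (x + r *\<^sub>R b) \<in> trunc n ` K" using xr(3) by blast
    then show ?thesis using b by (simp add: trunc_add trunc_scaleR trunc_id unit_ball_iff)
  qed
  then show "\<exists>x\<in>Rn n. \<exists>r>0. \<forall>b\<in>unit_ball n. x + r *\<^sub>R b \<in> trunc n ` K"
    using xr(2) trunc_in_Rn by blast
qed

section \<open>Parallel bodies between sums with zonotopes, and the limit of their difference
  quotients\<close>

lemma parallel_body_eq: "parallel_body n A \<epsilon> = {a + \<epsilon> *\<^sub>R b | a b. a \<in> A \<and> b \<in> unit_ball n}"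
  by (simp add: parallel_body_def plus_fun_def scaleR_fun_def)

lemma compact_parallel_body:
  assumes "compact_convex n A"
  shows "compact (parallel_body n A \<epsilon>)" "parallel_body n A \<epsilon> \<subseteq> Rn n"
proof -
  have "parallel_body n A \<epsilon> = (\<lambda>z. fst z + \<epsilon> *\<^sub>R snd z) ` (A \<times> unit_ball n)"
    unfolding parallel_body_eq by force
  then show "compact (parallel_body n A \<epsilon>)"
    using compact_convexD(1)[OF assms]
    by (auto intro!: compact_continuous_image compact_Times continuous_on_vec_add continuous_on_vec_scaleR
      continuous_on_const continuous_on_fst continuous_on_snd continuous_on_id)
  show "parallel_body n A \<epsilon> \<subseteq> Rn n"
    using compact_convexD(3)[OF assms] unfolding parallel_body_eq
    by (auto simp: unit_ball_iff intro!: subspace_add[OF subspace_Rn] subspace_scale[OF subspace_Rn])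
qed

lemma vol_eq_V: "compact_convex n K \<Longrightarrow> vol n K = V n K"
  by (intro vol_eq_lam) (auto dest: compact_convexD)

lemma vol_parallel_body: "compact_convex n K \<Longrightarrow> vol n (parallel_body n K \<epsilon>) = V n (parallel_body n K \<epsilon>)"
  using compact_parallel_body[of n K \<epsilon>] by (intro vol_eq_lam compact_borel)

lemma sum_list_abs_dot_scale:
  "c \<ge> 0 \<Longrightarrow> (\<Sum>u\<leftarrow>map ((*\<^sub>R) c) us. \<bar>dot n u v\<bar>) = c * (\<Sum>u\<leftarrow>us. \<bar>dot n u v\<bar>)"
  by (induction us) (simp_all add: dot_simps abs_mult algebra_simps)

lemma sum_list_growth_scale:
  assumes "compact_convex n K" "set us \<subseteq> Rn n" "c \<ge> 0"
  shows "(\<Sum>u\<leftarrow>map ((*\<^sub>R) c) us. growth n K u) = c * (\<Sum>u\<leftarrow>us. growth n K u)"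
  using assms(2) by (induction us) (simp_all add: growth_scaleR assms algebra_simps)

text \<open>Scaled by \<epsilon>/c, the zonotope lies in the ball of radius \<epsilon>; its sum with
  \<open>K\<close> therefore lies in the parallel body.\<close>

lemma V_parallel_body_ge:
  assumes K: "compact_convex n K" and us: "set us \<subseteq> Rn n" and "\<epsilon> > 0" "c > 0"
    and le: "\<And>v. v \<in> Rn n \<Longrightarrow> (\<Sum>u\<leftarrow>us. \<bar>dot n u v\<bar>) \<le> c * vnorm n v"
  shows "V n K + \<epsilon> / c * (2 * (\<Sum>u\<leftarrow>us. growth n K u)) \<le> V n (parallel_body n K \<epsilon>)"
proof -
  let ?us = "map ((*\<^sub>R) (\<epsilon> / c)) us"
  have us': "set ?us \<subseteq> Rn n"
    using us by (auto intro: subspace_scale[OF subspace_Rn])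
  have "msum K ?us \<subseteq> parallel_body n K \<epsilon>"
  proof
    fix y assume "y \<in> msum K ?us"
    then obtain x z where xz: "x \<in> K" "z \<in> msum {0} ?us" "y = x + z"
      by (subst (asm) msum_eq) blast
    have "(\<Sum>u\<leftarrow>?us. \<bar>dot n u v\<bar>) \<le> \<epsilon> * vnorm n v" if "v \<in> Rn n" for v
    proof -
      have "(\<Sum>u\<leftarrow>?us. \<bar>dot n u v\<bar>) = \<epsilon> / c * (\<Sum>u\<leftarrow>us. \<bar>dot n u v\<bar>)"
        using assms by (intro sum_list_abs_dot_scale) auto
      also have "\<dots> \<le> \<epsilon> / c * (c * vnorm n v)"
        using le[OF that] assms by (intro mult_left_mono) auto
      finally show ?thesis using assms by simp
    qed
    then have z: "z \<in> Rn n" "vnorm n z \<le> \<epsilon>"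
      using zonotope_subset_ball[OF _ us' xz(2), of \<epsilon>] assms by auto
    then have "(1 / \<epsilon>) *\<^sub>R z \<in> unit_ball n"
      using assms by (auto simp: unit_ball_iff vnorm_scaleR intro: subspace_scale[OF subspace_Rn])
    moreover have "y = x + \<epsilon> *\<^sub>R (1 / \<epsilon>) *\<^sub>R z" using xz(3) assms by simp
    ultimately show "y \<in> parallel_body n K \<epsilon>"
      unfolding parallel_body_eq using xz(1) by blast
  qed
  then have "V n (msum K ?us) \<le> V n (parallel_body n K \<epsilon>)"
    using compact_parallel_body[OF K] compact_convexD(1)[OF compact_convex_msum[OF K us']]
    by (intro V_mono)
  moreover have "V n K + 2 * (\<epsilon> / c * (\<Sum>u\<leftarrow>us. growth n K u)) \<le> V n (msum K ?us)"
    using V_msum_ge[OF K us'] sum_list_growth_scale[OF K us, of "\<epsilon> / c"] assms by simp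
  ultimately show ?thesis by (simp add: mult_ac)
qed

text \<open>Scaled by \<epsilon>/c, the zonotope contains the ball of radius \<epsilon> and lies in
  the ball of radius \<epsilon> d/c = s r. As \<open>K\<close> contains the ball of radius r about
  \<open>x0\<close>, its sum with the zonotope lies in K + s (K - x0), the dilate of
  \<open>K\<close> about \<open>x0\<close> by 1 + s, whose growth is that of \<open>K\<close> times
  (1 + s)^(n-1).\<close>

lemma V_parallel_body_le:
  assumes K: "compact_convex n K" and us: "set us \<subseteq> Rn n" and "\<epsilon> > 0" "0 < c" "0 < d"
    and x0: "x0 \<in> Rn n" "r > 0" "\<And>b. b \<in> unit_ball n \<Longrightarrow> x0 + r *\<^sub>R b \<in> K"
    and ge: "\<And>v. v \<in> Rn n \<Longrightarrow> c * vnorm n v \<le> (\<Sum>u\<leftarrow>us. \<bar>dot n u v\<bar>)"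
    and le: "\<And>v. v \<in> Rn n \<Longrightarrow> (\<Sum>u\<leftarrow>us. \<bar>dot n u v\<bar>) \<le> d * vnorm n v"
  shows "V n (parallel_body n K \<epsilon>) \<le>
    V n K + \<epsilon> / c * (2 * (\<Sum>u\<leftarrow>us. growth n K u)) * (1 + \<epsilon> * (d / (c * r))) ^ (n - 1)"
proof -
  let ?us = "map ((*\<^sub>R) (\<epsilon> / c)) us"
  define s where "s = \<epsilon> * (d / (c * r))"
  have s: "s > 0" "s * r = \<epsilon> * d / c" using assms by (simp_all add: s_def)
  have us': "set ?us \<subseteq> Rn n"
    using us by (auto intro: subspace_scale[OF subspace_Rn])
  have sums: "(\<Sum>u\<leftarrow>?us. \<bar>dot n u v\<bar>) = \<epsilon> / c * (\<Sum>u\<leftarrow>us. \<bar>dot n u v\<bar>)" for v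
    using assms by (intro sum_list_abs_dot_scale) auto
  have sub: "parallel_body n K \<epsilon> \<subseteq> msum K ?us"
  proof
    fix y assume "y \<in> parallel_body n K \<epsilon>"
    then obtain a b where ab: "a \<in> K" "b \<in> unit_ball n" "y = a + \<epsilon> *\<^sub>R b"
      unfolding parallel_body_eq by blast
    have "\<epsilon> *\<^sub>R b \<in> msum {0} ?us"
    proof (rule ball_subset_zonotope[where c = \<epsilon>])
      show "\<epsilon> * vnorm n v \<le> (\<Sum>u\<leftarrow>?us. \<bar>dot n u v\<bar>)" if "v \<in> Rn n" for v
      proof -
        have "\<epsilon> / c * (c * vnorm n v) \<le> \<epsilon> / c * (\<Sum>u\<leftarrow>us. \<bar>dot n u v\<bar>)"
          using ge[OF that] assms by (intro mult_left_mono) auto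
        then show ?thesis using assms by (simp only: sums) simp
      qed
      show "\<epsilon> *\<^sub>R b \<in> Rn n" "vnorm n (\<epsilon> *\<^sub>R b) \<le> \<epsilon>"
        using ab(2) assms by (auto simp: unit_ball_iff vnorm_scaleR intro: subspace_scale[OF subspace_Rn])
    qed (rule us')
    then show "y \<in> msum K ?us"
      using ab by (subst msum_eq) blast
  qed
  define L where "L = (+) (- (s *\<^sub>R x0)) ` (*\<^sub>R) (1 + s) ` K"
  have K': "compact_convex n ((*\<^sub>R) (1 + s) ` K)" by (rule compact_convex_scaleR[OF K])
  have t: "- (s *\<^sub>R x0) \<in> Rn n" using x0(1) by (intro subspace_neg[OF subspace_Rn] subspace_scale[OF subspace_Rn])
  have L: "compact_convex n L" unfolding L_def by (rule compact_convex_translate[OF K' t])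
  have "msum K ?us \<subseteq> L"
  proof
    fix y assume "y \<in> msum K ?us"
    then obtain x z where xz: "x \<in> K" "z \<in> msum {0} ?us" "y = x + z"
      by (subst (asm) msum_eq) blast
    have "(\<Sum>u\<leftarrow>?us. \<bar>dot n u v\<bar>) \<le> (\<epsilon> * d / c) * vnorm n v" if "v \<in> Rn n" for v
    proof -
      have "\<epsilon> / c * (\<Sum>u\<leftarrow>us. \<bar>dot n u v\<bar>) \<le> \<epsilon> / c * (d * vnorm n v)"
        using le[OF that] assms by (intro mult_left_mono) auto
      then show ?thesis by (simp only: sums) simp
    qed
    then have z: "z \<in> Rn n" "vnorm n z \<le> s * r"
      using zonotope_subset_ball[OF _ us' xz(2), of "\<epsilon> * d / c"] assms s by auto
    have sr: "s * r > 0" using s(1) x0(2) by simp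
    have "(1 / (s * r)) *\<^sub>R z \<in> unit_ball n"
      using z sr by (auto simp: unit_ball_iff vnorm_scaleR intro: subspace_scale[OF subspace_Rn])
    then have k: "x0 + r *\<^sub>R (1 / (s * r)) *\<^sub>R z \<in> K" by (rule x0(3))
    \<comment> \<open>The convex combination of x and x0 + z/s with weights 1 : s; dilating it about
      \<open>x0\<close> by 1 + s gives x + z.\<close>
    define w where "w = (1 / (1 + s)) *\<^sub>R x + (s / (1 + s)) *\<^sub>R (x0 + r *\<^sub>R (1 / (s * r)) *\<^sub>R z)"
    have "w \<in> K"
      unfolding w_def using s(1) k xz(1)
      by (intro convexD[OF compact_convexD(2)[OF K]]) (auto simp: field_simps)
    moreover have "y = - (s *\<^sub>R x0) + (1 + s) *\<^sub>R w"
    proof -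
      have "(1 + s) *\<^sub>R w = x + s *\<^sub>R x0 + (s * r) *\<^sub>R (1 / (s * r)) *\<^sub>R z"
        using s(1) by (simp add: w_def scaleR_add_right add.assoc)
      also have "(s * r) *\<^sub>R (1 / (s * r)) *\<^sub>R z = z"
        using sr by auto
      finally show ?thesis
        by (simp add: xz(3) algebra_simps)
    qed
    ultimately show "y \<in> L" unfolding L_def by blast
  qed
  from V_msum_le[OF K L us' this]
  have "V n (msum K ?us) \<le> V n K + 2 * (\<epsilon> / c * (\<Sum>u\<leftarrow>us. growth n L u))"
    using sum_list_growth_scale[OF L us, of "\<epsilon> / c"] assms by simp
  also have "(\<Sum>u\<leftarrow>us. growth n L u) = (1 + s) ^ (n - 1) * (\<Sum>u\<leftarrow>us. growth n K u)"
  proof -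
    have "growth n L u = (1 + s) ^ (n - 1) * growth n K u" if "u \<in> set us" for u
    proof -
      have u: "u \<in> Rn n" using that us by auto
      show ?thesis
        unfolding L_def growth_translate[OF K' u t]
        using s(1) by (intro growth_dilate[OF K u]) simp
    qed
    then have "map (growth n L) us = map (\<lambda>u. (1 + s) ^ (n - 1) * growth n K u) us" by simp
    then show ?thesis by (simp only: sum_list_const_mult)
  qed
  finally have "V n (msum K ?us) \<le> V n K + \<epsilon> / c * (2 * (\<Sum>u\<leftarrow>us. growth n K u)) * (1 + s) ^ (n - 1)"
    by (simp add: mult_ac)
  moreover have "V n (parallel_body n K \<epsilon>) \<le> V n (msum K ?us)"
    using compact_parallel_body[OF K] compact_convexD(1)[OF compact_convex_msum[OF K us']] sub
    by (intro V_mono)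
  ultimately show ?thesis by (simp add: s_def)
qed

abbreviation surface_quotient :: "nat \<Rightarrow> vec set \<Rightarrow> real \<Rightarrow> real" where
  "surface_quotient n K \<epsilon> \<equiv> (vol n (parallel_body n K \<epsilon>) - vol n K) / \<epsilon>"

lemma surface_quotient_ge:
  assumes K: "compact_convex n K" and us: "set us \<subseteq> Rn n" and "\<epsilon> > 0" "c > 0"
    and "\<And>v. v \<in> Rn n \<Longrightarrow> (\<Sum>u\<leftarrow>us. \<bar>dot n u v\<bar>) \<le> c * vnorm n v"
  shows "2 * (\<Sum>u\<leftarrow>us. growth n K u) / c \<le> surface_quotient n K \<epsilon>"
  using V_parallel_body_ge[OF assms] \<open>\<epsilon> > 0\<close>
  by (simp add: vol_eq_V[OF K] vol_parallel_body[OF K] pos_le_divide_eq mult_ac)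

lemma surface_quotient_upper_limit:
  assumes "body n K" and us: "set us \<subseteq> Rn n" and "0 < c" "0 < d"
    and "\<And>v. v \<in> Rn n \<Longrightarrow> c * vnorm n v \<le> (\<Sum>u\<leftarrow>us. \<bar>dot n u v\<bar>)"
    and "\<And>v. v \<in> Rn n \<Longrightarrow> (\<Sum>u\<leftarrow>us. \<bar>dot n u v\<bar>) \<le> d * vnorm n v"
  obtains h where "\<And>\<epsilon>. \<epsilon> > 0 \<Longrightarrow> surface_quotient n K \<epsilon> \<le> h \<epsilon>"
    "(h \<longlongrightarrow> 2 * (\<Sum>u\<leftarrow>us. growth n K u) / c) (at_right 0)"
proof -
  have K: "compact_convex n K" using assms by (simp add: body_def)
  obtain x r where xr: "x \<in> Rn n" "r > 0" "\<And>b. b \<in> unit_ball n \<Longrightarrow> x + r *\<^sub>R b \<in> K"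
    using assms(1) by (auto simp: body_def)
  let ?\<sigma> = "2 * (\<Sum>u\<leftarrow>us. growth n K u)"
  let ?h = "\<lambda>\<epsilon>. ?\<sigma> / c * (1 + \<epsilon> * (d / (c * r))) ^ (n - 1)"
  have "surface_quotient n K \<epsilon> \<le> ?h \<epsilon>" if "\<epsilon> > 0" for \<epsilon>
  proof -
    have "V n (parallel_body n K \<epsilon>) - V n K \<le> ?h \<epsilon> * \<epsilon>"
      using V_parallel_body_le[OF K us that assms(3,4) xr assms(5,6)] by (simp add: mult_ac)
    then show ?thesis
      using that by (simp add: vol_eq_V[OF K] vol_parallel_body[OF K] pos_divide_le_eq)
  qed
  moreover have "(?h \<longlongrightarrow> ?\<sigma> / c * (1 + 0 * (d / (c * r))) ^ (n - 1)) (at_right 0)"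
    by (intro tendsto_intros)
  ultimately show ?thesis using that[of ?h] by simp
qed

lemma eventually_at_right_zeroI:
  "(\<And>\<epsilon>. \<epsilon> > 0 \<Longrightarrow> P \<epsilon>) \<Longrightarrow> \<forall>\<^sub>F \<epsilon> in at_right (0::real). P \<epsilon>"
  by (rule eventually_mono[OF eventually_at_right_less])

text \<open>\<open>Lim\<close> has a usable value only once convergence is known. The quotient lies
  above \<sigma>(\<eta>)/(1 + \<eta>) for every \<epsilon> and, in the limit, below
  \<sigma>(\<eta>)/(1 - \<eta>); letting \<eta> tend to 0 closes the gap.\<close>

lemma surface_area_tendsto:
  assumes K: "body (Suc m) K"
  shows "(surface_quotient (Suc m) K \<longlongrightarrow> surface_area (Suc m) K) (at_right 0)"
proof -
  let ?n = "Suc m" and ?q = "surface_quotient (Suc m) K"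
  note cK = body_compact_convex[OF K]
  define P where "P = (\<lambda>\<eta> us. set us \<subseteq> Rn ?n \<and> (\<forall>v\<in>Rn ?n. (1 - \<eta>) * vnorm ?n v \<le> (\<Sum>u\<leftarrow>us. \<bar>dot ?n u v\<bar>)) \<and>
    (\<forall>v\<in>Rn ?n. (\<Sum>u\<leftarrow>us. \<bar>dot ?n u v\<bar>) \<le> (1 + \<eta>) * vnorm ?n v))"
  have "\<exists>us. P \<eta> us" if "\<eta> > 0" for \<eta>
    by (rule zonotope_exists[OF id_GL[of "Suc m"] that]) (auto simp: P_def)
  then obtain us where us: "\<And>\<eta>. \<eta> > 0 \<Longrightarrow> P \<eta> (us \<eta>)" by metis
  define \<sigma> where "\<sigma> = (\<lambda>\<eta>. 2 * (\<Sum>u\<leftarrow>us \<eta>. growth ?n K u))"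
  have \<sigma>0: "\<sigma> \<eta> \<ge> 0" if "\<eta> > 0" for \<eta>
    unfolding \<sigma>_def using us[OF that] cK by (auto simp: P_def intro!: sum_list_nonneg growth_nonneg)
  have lower: "\<sigma> \<eta> / (1 + \<eta>) \<le> ?q \<epsilon>" if "\<eta> > 0" "\<epsilon> > 0" for \<eta> \<epsilon>
    unfolding \<sigma>_def using us[OF that(1)] that by (intro surface_quotient_ge cK) (auto simp: P_def)
  have upper: "\<exists>h. (\<forall>\<epsilon>>0. ?q \<epsilon> \<le> h \<epsilon>) \<and> (h \<longlongrightarrow> \<sigma> \<eta> / (1 - \<eta>)) (at_right 0)" if "\<eta> > 0" "\<eta> < 1" for \<eta>
    unfolding \<sigma>_def
    by (rule surface_quotient_upper_limit[OF K, of "us \<eta>" "1 - \<eta>" "1 + \<eta>"])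
       (use us[OF that(1)] that in \<open>auto simp: P_def\<close>)
  \<comment> \<open>Lower and upper bounds from different zonotopes are comparable, because both
    refer to the same quotient.\<close>
  have cross: "\<sigma> \<eta> / (1 + \<eta>) \<le> \<sigma> \<eta>' / (1 - \<eta>')" if \<eta>: "\<eta> > 0" "\<eta>' > 0" "\<eta>' < 1" for \<eta> \<eta>'
  proof -
    obtain h where h: "\<And>\<epsilon>. \<epsilon> > 0 \<Longrightarrow> ?q \<epsilon> \<le> h \<epsilon>" "(h \<longlongrightarrow> \<sigma> \<eta>' / (1 - \<eta>')) (at_right 0)"
      using upper[OF \<eta>(2,3)] by blast
    show ?thesis
    proof (rule tendsto_lowerbound[OF h(2)])
      show "\<forall>\<^sub>F \<epsilon> in at_right 0. \<sigma> \<eta> / (1 + \<eta>) \<le> h \<epsilon>"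
        by (rule eventually_at_right_zeroI, rule order.trans[OF lower[OF \<eta>(1)] h(1)])
    qed simp
  qed
  \<comment> \<open>The candidate for the limit is the supremum of the lower bounds;
    \<open>cross\<close> keeps it below every upper bound.\<close>
  define S where "S = (SUP \<eta>\<in>{0<..}. \<sigma> \<eta> / (1 + \<eta>))"
  have S_ge: "\<sigma> \<eta> / (1 + \<eta>) \<le> S" if "\<eta> > 0" for \<eta>
    unfolding S_def using cross[of _ "1/2"] that by (intro cSUP_upper bdd_aboveI2) auto
  have S_le: "S \<le> \<sigma> \<eta> / (1 - \<eta>)" if "\<eta> > 0" "\<eta> < 1" for \<eta>
    unfolding S_def using cross that by (intro cSUP_least) auto
  have S_le_q: "S \<le> ?q \<epsilon>" if "\<epsilon> > 0" for \<epsilon>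
    unfolding S_def using lower that by (intro cSUP_least) auto
  have "S \<ge> 0" using order.trans[OF _ S_ge[of 1]] \<sigma>0[of 1] by simp
  have "(?q \<longlongrightarrow> S) (at_right 0)"
  proof (rule order_tendstoI)
    fix a assume "a < S"
    then show "\<forall>\<^sub>F \<epsilon> in at_right 0. a < ?q \<epsilon>"
      by (intro eventually_at_right_zeroI) (rule less_le_trans[OF _ S_le_q])
  next
    fix a assume a: "S < a"
    \<comment> \<open>As \<sigma>(\<eta>) is at most S (1 + \<eta>), the limiting upper bound is at
      most S (1 + \<eta>)/(1 - \<eta>), and a small \<eta> pushes this below
      \<open>a\<close>.\<close>
    have "((\<lambda>\<eta>. S * (1 + \<eta>) / (1 - \<eta>)) \<longlongrightarrow> S * (1 + 0) / (1 - 0)) (at_right 0)"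
      by (intro tendsto_intros) auto
    then have "\<forall>\<^sub>F \<eta> in at_right 0. S * (1 + \<eta>) / (1 - \<eta>) < a"
      using a by (intro order_tendstoD) auto
    moreover have "\<forall>\<^sub>F \<eta> in at_right (0::real). \<eta> \<in> {0<..<1}"
      by (rule eventually_at_right_real) simp
    ultimately have "\<forall>\<^sub>F \<eta> in at_right (0::real). S * (1 + \<eta>) / (1 - \<eta>) < a \<and> \<eta> \<in> {0<..<1}"
      by (rule eventually_conj)
    then obtain \<eta> where \<eta>: "S * (1 + \<eta>) / (1 - \<eta>) < a" "0 < \<eta>" "\<eta> < 1"
      using eventually_happens trivial_limit_at_right_real by fastforce
    have "\<sigma> \<eta> \<le> S * (1 + \<eta>)"
      using S_ge[OF \<eta>(2)] \<eta>(2) by (simp add: pos_divide_le_eq)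
    then have "\<sigma> \<eta> / (1 - \<eta>) < a"
      using \<eta> by (meson divide_right_mono diff_ge_0_iff_ge le_less_trans less_imp_le)
    moreover obtain h where h: "\<And>\<epsilon>. \<epsilon> > 0 \<Longrightarrow> ?q \<epsilon> \<le> h \<epsilon>" "(h \<longlongrightarrow> \<sigma> \<eta> / (1 - \<eta>)) (at_right 0)"
      using upper[OF \<eta>(2,3)] by blast
    ultimately have "\<forall>\<^sub>F \<epsilon> in at_right 0. h \<epsilon> < a"
      by (intro order_tendstoD(2)[OF h(2)])
    moreover have "\<forall>\<^sub>F \<epsilon> in at_right 0. ?q \<epsilon> \<le> h \<epsilon>"
      by (intro eventually_at_right_zeroI h(1))
    ultimately show "\<forall>\<^sub>F \<epsilon> in at_right 0. ?q \<epsilon> < a"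
      by eventually_elim linarith
  qed
  moreover from this have "surface_area ?n K = S"
    unfolding surface_area_def by (rule tendsto_Lim[OF trivial_limit_at_right_real])
  ultimately show ?thesis by (simp only:)
qed

lemma surface_area_ge:
  assumes K: "body (Suc m) K" and us: "set us \<subseteq> Rn (Suc m)" and "c > 0"
    and le: "\<And>v. v \<in> Rn (Suc m) \<Longrightarrow> (\<Sum>u\<leftarrow>us. \<bar>dot (Suc m) u v\<bar>) \<le> c * vnorm (Suc m) v"
  shows "2 * (\<Sum>u\<leftarrow>us. growth (Suc m) K u) / c \<le> surface_area (Suc m) K"
proof (rule tendsto_lowerbound[OF surface_area_tendsto[OF K]])
  show "\<forall>\<^sub>F \<epsilon> in at_right 0. 2 * (\<Sum>u\<leftarrow>us. growth (Suc m) K u) / c \<le> surface_quotient (Suc m) K \<epsilon>"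
    by (intro eventually_at_right_zeroI surface_quotient_ge[OF body_compact_convex[OF K] us _ \<open>c > 0\<close> le])
qed simp

lemma surface_area_le:
  assumes K: "body (Suc m) K" and us: "set us \<subseteq> Rn (Suc m)" and "0 < c" "0 < d"
    and "\<And>v. v \<in> Rn (Suc m) \<Longrightarrow> c * vnorm (Suc m) v \<le> (\<Sum>u\<leftarrow>us. \<bar>dot (Suc m) u v\<bar>)"
    and "\<And>v. v \<in> Rn (Suc m) \<Longrightarrow> (\<Sum>u\<leftarrow>us. \<bar>dot (Suc m) u v\<bar>) \<le> d * vnorm (Suc m) v"
  shows "surface_area (Suc m) K \<le> 2 * (\<Sum>u\<leftarrow>us. growth (Suc m) K u) / c"
proof (rule surface_quotient_upper_limit[OF assms])
  fix h assume h: "\<And>\<epsilon>. \<epsilon> > 0 \<Longrightarrow> surface_quotient (Suc m) K \<epsilon> \<le> h \<epsilon>"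
    "(h \<longlongrightarrow> 2 * (\<Sum>u\<leftarrow>us. growth (Suc m) K u) / c) (at_right 0)"
  show ?thesis
    by (rule tendsto_le[OF _ h(2) surface_area_tendsto[OF K]]) (simp, intro eventually_at_right_zeroI h(1))
qed

text \<open>The empty list of segments yields the lower bound 0.\<close>

lemma surface_area_nonneg: "body (Suc m) K \<Longrightarrow> surface_area (Suc m) K \<ge> 0"
  using surface_area_ge[of m K "[]" 1] by (simp add: L2_set_nonneg)

section \<open>The Brunn-Minkowski inequality\<close>

lemma ennreal_linear_combination:
  "0 \<le> a \<Longrightarrow> 0 \<le> x \<Longrightarrow> 0 \<le> b \<Longrightarrow> 0 \<le> y \<Longrightarrow>
    ennreal (a * x + b * y) = ennreal a * ennreal x + ennreal b * ennreal y"
  by (simp add: ennreal_mult)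

text \<open>Brunn-Minkowski on the line for intervals of any kind: the combinations fill the open
  interval between the weighted infima and the weighted suprema.\<close>

lemma emeasure_convex_combination_real:
  fixes I J M :: "real set"
  assumes I: "convex I" "bounded I" "I \<noteq> {}" and J: "convex J" "bounded J" "J \<noteq> {}"
    and t: "0 < t" "t < 1" and M: "M \<in> sets borel"
    and sub: "\<And>x y. x \<in> I \<Longrightarrow> y \<in> J \<Longrightarrow> (1 - t) * x + t * y \<in> M"
  shows "ennreal (1 - t) * emeasure lborel I + ennreal t * emeasure lborel J \<le> emeasure lborel M"
proof -
  note bnd = bounded_imp_bdd_below[OF I(2)] bounded_imp_bdd_above[OF I(2)]
    bounded_imp_bdd_below[OF J(2)] bounded_imp_bdd_above[OF J(2)]
  have len: "emeasure lborel S \<le> ennreal (Sup S - Inf S)" "Inf S \<le> Sup S"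
    if "bdd_below S" "bdd_above S" "S \<noteq> {}" for S :: "real set"
  proof -
    have "S \<subseteq> {Inf S..Sup S}"
      using that by (auto intro: cInf_lower cSup_upper)
    then have "emeasure lborel S \<le> emeasure lborel {Inf S..Sup S}"
      by (intro emeasure_mono) auto
    moreover show "Inf S \<le> Sup S"
      using that by (intro cInf_le_cSup)
    ultimately show "emeasure lborel S \<le> ennreal (Sup S - Inf S)" by simp
  qed
  define a where "a = (1 - t) * Inf I + t * Inf J"
  define b where "b = (1 - t) * Sup I + t * Sup J"
  have "{a<..<b} \<subseteq> M"
  proof
    fix w assume w: "w \<in> {a<..<b}"
    \<comment> \<open>Points of \<open>I\<close> and \<open>J\<close> near their ends give
      combinations \<open>l\<close> and \<open>u\<close> with l < w < u. Interpolating with the same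
      parameter inside \<open>I\<close> and inside \<open>J\<close> exhibits w as a
      combination.\<close>
    obtain x0 where x0: "x0 \<in> I" "x0 < Inf I + (w - a)"
      using cInf_lessD[OF I(3), of "Inf I + (w - a)"] w by auto
    obtain y0 where y0: "y0 \<in> J" "y0 < Inf J + (w - a)"
      using cInf_lessD[OF J(3), of "Inf J + (w - a)"] w by auto
    obtain x1 where x1: "x1 \<in> I" "Sup I - (b - w) < x1"
      using less_cSupD[OF I(3), of "Sup I - (b - w)"] w by auto
    obtain y1 where y1: "y1 \<in> J" "Sup J - (b - w) < y1"
      using less_cSupD[OF J(3), of "Sup J - (b - w)"] w by auto
    define l where "l = (1 - t) * x0 + t * y0"
    define u where "u = (1 - t) * x1 + t * y1"
    have "l < (1 - t) * (Inf I + (w - a)) + t * (Inf J + (w - a))"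
      unfolding l_def using x0 y0 t by (intro add_strict_mono mult_strict_left_mono) auto
    then have lw: "l < w" by (simp add: a_def algebra_simps)
    have "(1 - t) * (Sup I - (b - w)) + t * (Sup J - (b - w)) < u"
      unfolding u_def using x1 y1 t by (intro add_strict_mono mult_strict_left_mono) auto
    then have wu: "w < u" by (simp add: b_def algebra_simps)
    define \<theta> where "\<theta> = (w - l) / (u - l)"
    have \<theta>: "0 \<le> \<theta>" "\<theta> \<le> 1" "w = (1 - \<theta>) * l + \<theta> * u"
    proof -
      show "0 \<le> \<theta>" "\<theta> \<le> 1" using lw wu by (simp_all add: \<theta>_def)
      have "\<theta> * (u - l) = w - l" using lw wu by (simp add: \<theta>_def)
      then show "w = (1 - \<theta>) * l + \<theta> * u" by (simp add: algebra_simps)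
    qed
    have "(1 - \<theta>) * x0 + \<theta> * x1 \<in> I" "(1 - \<theta>) * y0 + \<theta> * y1 \<in> J"
      using convexD[OF I(1) x0(1) x1(1), of "1 - \<theta>" \<theta>] convexD[OF J(1) y0(1) y1(1), of "1 - \<theta>" \<theta>] \<theta>
      by simp_all
    from sub[OF this] show "w \<in> M"
      unfolding \<theta>(3) l_def u_def by (simp add: algebra_simps)
  qed
  then have "emeasure lborel {a<..<b} \<le> emeasure lborel M"
    using M by (intro emeasure_mono) auto
  moreover have ab: "a \<le> b"
    unfolding a_def b_def using len(2)[OF bnd(1,2) I(3)] len(2)[OF bnd(3,4) J(3)] t
    by (intro add_mono mult_left_mono) auto
  moreover have "ennreal (1 - t) * emeasure lborel I + ennreal t * emeasure lborel J \<le>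
      ennreal (1 - t) * ennreal (Sup I - Inf I) + ennreal t * ennreal (Sup J - Inf J)"
    using len(1)[OF bnd(1,2) I(3)] len(1)[OF bnd(3,4) J(3)] by (intro add_mono mult_left_mono) auto
  moreover have "\<dots> = ennreal (b - a)"
  proof -
    have "ennreal (1 - t) * ennreal (Sup I - Inf I) + ennreal t * ennreal (Sup J - Inf J) =
        ennreal ((1 - t) * (Sup I - Inf I) + t * (Sup J - Inf J))"
      using len(2)[OF bnd(1,2) I(3)] len(2)[OF bnd(3,4) J(3)] t
      by (intro ennreal_linear_combination[symmetric]) auto
    then show ?thesis by (simp add: a_def b_def algebra_simps)
  qed
  ultimately show ?thesis by (simp add: order.trans)
qed

text \<open>The layer cake formula for u/c, cut off at 1 because only the levels s in (0, 1) are
  integrated.\<close>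

lemma nn_integral_superlevel:
  fixes u :: "real \<Rightarrow> real"
  assumes [measurable]: "u \<in> borel_measurable borel" and "\<And>r. u r \<ge> 0" "c > 0"
  shows "(\<integral>\<^sup>+s. indicator {0<..<1} s * emeasure lborel {r. u r > c * s} \<partial>lborel) =
    (\<integral>\<^sup>+r. ennreal (min (u r / c) 1) \<partial>lborel)"
proof -
  have "(\<integral>\<^sup>+s. indicator {0<..<1} s * emeasure lborel {r. u r > c * s} \<partial>lborel) =
      (\<integral>\<^sup>+s. \<integral>\<^sup>+r. indicator {0<..<1} s * indicator {r. u r > c * s} r \<partial>lborel \<partial>lborel)"
  proof (rule nn_integral_cong)
    fix s
    have "{r\<in>space lborel. u r > c * s} \<in> sets lborel" by measurable
    then show "indicator {0<..<1} s * emeasure lborel {r. u r > c * s} =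
        (\<integral>\<^sup>+r. indicator {0<..<1} s * indicator {r. u r > c * s} r \<partial>lborel)"
      by (subst nn_integral_cmult_indicator) auto
  qed
  also have "\<dots> = (\<integral>\<^sup>+r. \<integral>\<^sup>+s. indicator {0<..<1} s * indicator {r. u r > c * s} r \<partial>lborel \<partial>lborel)"
    by (rule lborel_pair.Fubini'[of "\<lambda>r s. indicator {0<..<1} s * indicator {r. u r > c * s} r"]) measurable
  also have "\<dots> = (\<integral>\<^sup>+r. ennreal (min (u r / c) 1) \<partial>lborel)"
  proof (rule nn_integral_cong)
    fix r
    have "c * s < u r \<longleftrightarrow> s < u r / c" for s
      using \<open>c > 0\<close> by (simp add: pos_less_divide_eq mult.commute)
    then have "(\<lambda>s. indicator {0<..<1} s * indicator {r. u r > c * s} r) = (indicator {0<..<min (u r / c) 1} :: real \<Rightarrow> ennreal)"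
      by (intro ext) (auto simp: indicator_def)
    then show "(\<integral>\<^sup>+s. indicator {0<..<1} s * indicator {r. u r > c * s} r \<partial>lborel) = ennreal (min (u r / c) 1)"
      using assms(2)[of r] \<open>c > 0\<close> by simp
  qed
  finally show ?thesis .
qed

text \<open>The functions are first divided by their suprema \<alpha> and \<beta>. For every level s
  in (0, 1) both superlevel sets are then nonempty intervals, so the inequality on the line applies
  to them. Integrating over s gives (1 - t) F/\<alpha> + t G/\<beta> \<le> H/\<gamma>, and the
  weighted arithmetic-geometric mean inequality turns this into the product form.\<close>

lemma prekopa_leindler_quasiconcave:
  fixes f g h :: "real \<Rightarrow> real"
  assumes [measurable]: "f \<in> borel_measurable borel" "g \<in> borel_measurable borel" "h \<in> borel_measurable borel"
    and nonneg: "\<And>r. f r \<ge> 0" "\<And>r. g r \<ge> 0" "\<And>r. h r \<ge> 0"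
    and bdd: "bdd_above (range f)" "bdd_above (range g)"
    and conv: "\<And>s. s \<ge> 0 \<Longrightarrow> convex {r. f r > s}" "\<And>s. s \<ge> 0 \<Longrightarrow> convex {r. g r > s}"
    and bounded: "bounded {r. f r > 0}" "bounded {r. g r > 0}"
    and t: "0 < t" "t < 1"
    and le: "\<And>r r'. f r powr (1 - t) * g r' powr t \<le> h ((1 - t) * r + t * r')"
    and F: "(\<integral>\<^sup>+r. ennreal (f r) \<partial>lborel) = ennreal F" "F \<ge> 0"
    and G: "(\<integral>\<^sup>+r. ennreal (g r) \<partial>lborel) = ennreal G" "G \<ge> 0"
    and H: "(\<integral>\<^sup>+r. ennreal (h r) \<partial>lborel) = ennreal H" "H \<ge> 0"
  shows "F powr (1 - t) * G powr t \<le> H"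
proof (cases "F = 0 \<or> G = 0")
  case False
  then have FG: "F > 0" "G > 0" using F G by auto
  have ex_pos: "\<exists>r. u r > 0" if "(\<integral>\<^sup>+r. ennreal (u r) \<partial>lborel) = ennreal U" "U > 0" for u :: "real \<Rightarrow> real" and U
  proof (rule ccontr)
    assume "\<nexists>r. u r > 0"
    then have "\<And>r. ennreal (u r) = 0" by (simp add: ennreal_neg not_less)
    then have "(\<integral>\<^sup>+r. ennreal (u r) \<partial>lborel) = 0" by (simp only:) simp
    then show False using that by (simp only:) (simp add: ennreal_eq_0_iff)
  qed
  define \<alpha> where "\<alpha> = (SUP r. f r)"
  define \<beta> where "\<beta> = (SUP r. g r)"
  have \<alpha>: "f r \<le> \<alpha>" for r unfolding \<alpha>_def by (rule cSUP_upper) (use bdd in auto)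
  have \<beta>: "g r \<le> \<beta>" for r unfolding \<beta>_def by (rule cSUP_upper) (use bdd in auto)
  have "\<alpha> > 0" "\<beta> > 0"
    using ex_pos[OF F(1) FG(1)] ex_pos[OF G(1) FG(2)] \<alpha> \<beta> less_le_trans by blast+
  define \<gamma> where "\<gamma> = \<alpha> powr (1 - t) * \<beta> powr t"
  have "\<gamma> > 0" using \<open>\<alpha> > 0\<close> \<open>\<beta> > 0\<close> by (simp add: \<gamma>_def)
  have level: "ennreal (1 - t) * emeasure lborel {r. f r > \<alpha> * s} + ennreal t * emeasure lborel {r. g r > \<beta> * s}
      \<le> emeasure lborel {r. h r > \<gamma> * s}" if s: "0 < s" "s < 1" for s
  proof (rule emeasure_convex_combination_real)
    have "\<alpha> * s < \<alpha>" "\<beta> * s < \<beta>" using \<open>\<alpha> > 0\<close> \<open>\<beta> > 0\<close> s by simp_all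
    then have "\<exists>r. \<alpha> * s < f r" "\<exists>r. \<beta> * s < g r"
      unfolding \<alpha>_def \<beta>_def using bdd by (simp_all add: less_cSUP_iff)
    then show "{r. f r > \<alpha> * s} \<noteq> {}" "{r. g r > \<beta> * s} \<noteq> {}" by auto
    have nn: "0 \<le> \<alpha> * s" "0 \<le> \<beta> * s" using \<open>\<alpha> > 0\<close> \<open>\<beta> > 0\<close> s by simp_all
    show "convex {r. f r > \<alpha> * s}" "convex {r. g r > \<beta> * s}"
      using conv nn by blast+
    show "bounded {r. f r > \<alpha> * s}" "bounded {r. g r > \<beta> * s}"
      by (rule bounded_subset[OF bounded(1)] bounded_subset[OF bounded(2)]; use nn in auto)+
    have "{r\<in>space borel. h r > \<gamma> * s} \<in> sets borel" by measurable
    then show "{r. h r > \<gamma> * s} \<in> sets borel" by simp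
    show "(1 - t) * x + t * y \<in> {r. h r > \<gamma> * s}" if "x \<in> {r. f r > \<alpha> * s}" "y \<in> {r. g r > \<beta> * s}" for x y
    proof -
      have "\<gamma> * s = (\<alpha> * s) powr (1 - t) * (\<beta> * s) powr t"
      proof -
        have "s = s powr (1 - t) * s powr t" using s by (simp flip: powr_add)
        then show ?thesis
          using s \<open>\<alpha> > 0\<close> \<open>\<beta> > 0\<close> by (simp add: \<gamma>_def powr_mult)
      qed
      also have "\<dots> < f x powr (1 - t) * g y powr t"
      proof (rule mult_strict_mono)
        show "(\<alpha> * s) powr (1 - t) < f x powr (1 - t)" "(\<beta> * s) powr t < g y powr t"
          using that nn t by (auto intro!: powr_less_mono2)
        show "0 < f x powr (1 - t)" using that nn by auto
      qed simp
      also have "\<dots> \<le> h ((1 - t) * x + t * y)" by (rule le)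
      finally show ?thesis by simp
    qed
  qed (use t in auto)
  have meas [measurable]: "(\<lambda>s. emeasure lborel {r. u r > c * s}) \<in> borel_measurable lborel"
    if [measurable]: "u \<in> borel_measurable borel" for u :: "real \<Rightarrow> real" and c
  proof -
    have "emeasure lborel {r. u r > c * s} = (\<integral>\<^sup>+r. indicator {r. u r > c * s} r \<partial>lborel)" for s
    proof -
      have "{r\<in>space lborel. u r > c * s} \<in> sets lborel" by measurable
      then show ?thesis by simp
    qed
    then show ?thesis by simp
  qed
  have cake: "(\<integral>\<^sup>+s. indicator {0<..<1} s * emeasure lborel {r. u r > c * s} \<partial>lborel) = ennreal (U / c)"
    if [measurable]: "u \<in> borel_measurable borel" and "\<And>r. u r \<ge> 0" "c > 0" "\<And>r. u r \<le> c"
      "(\<integral>\<^sup>+r. ennreal (u r) \<partial>lborel) = ennreal U" "U \<ge> 0" for u :: "real \<Rightarrow> real" and c U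
  proof -
    have "(\<integral>\<^sup>+s. indicator {0<..<1} s * emeasure lborel {r. u r > c * s} \<partial>lborel) = (\<integral>\<^sup>+r. ennreal (min (u r / c) 1) \<partial>lborel)"
      using that by (intro nn_integral_superlevel)
    also have "\<dots> = (\<integral>\<^sup>+r. ennreal (1 / c) * ennreal (u r) \<partial>lborel)"
      using that by (intro nn_integral_cong) (simp add: ennreal_mult'[symmetric] min_def)
    also have "\<dots> = ennreal (1 / c) * ennreal U"
      using that by (subst nn_integral_cmult) auto
    finally show ?thesis
      using that by (simp add: ennreal_mult'[symmetric])
  qed
  have "ennreal ((1 - t) * (F / \<alpha>) + t * (G / \<beta>)) = ennreal (1 - t) * ennreal (F / \<alpha>) + ennreal t * ennreal (G / \<beta>)"
    using t FG \<open>\<alpha> > 0\<close> \<open>\<beta> > 0\<close> by (intro ennreal_linear_combination) auto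
  also have "\<dots> = (\<integral>\<^sup>+s. ennreal (1 - t) * (indicator {0<..<1} s * emeasure lborel {r. f r > \<alpha> * s}) +
      ennreal t * (indicator {0<..<1} s * emeasure lborel {r. g r > \<beta> * s}) \<partial>lborel)"
    using cake[OF assms(1) nonneg(1) \<open>\<alpha> > 0\<close> \<alpha> F] cake[OF assms(2) nonneg(2) \<open>\<beta> > 0\<close> \<beta> G]
    by (simp add: nn_integral_add nn_integral_cmult)
  also have "\<dots> \<le> (\<integral>\<^sup>+s. indicator {0<..<1} s * emeasure lborel {r. h r > \<gamma> * s} \<partial>lborel)"
    using level by (intro nn_integral_mono) (auto simp: indicator_def)
  also have "\<dots> = (\<integral>\<^sup>+r. ennreal (min (h r / \<gamma>) 1) \<partial>lborel)"
    using nonneg \<open>\<gamma> > 0\<close> by (intro nn_integral_superlevel) auto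
  also have "\<dots> \<le> (\<integral>\<^sup>+r. ennreal (1 / \<gamma>) * ennreal (h r) \<partial>lborel)"
    using \<open>\<gamma> > 0\<close> nonneg by (intro nn_integral_mono) (simp add: ennreal_mult'[symmetric] ennreal_leI)
  also have "\<dots> = ennreal (1 / \<gamma>) * ennreal H"
    using H by (subst nn_integral_cmult) auto
  also have "\<dots> = ennreal (H / \<gamma>)"
    using \<open>\<gamma> > 0\<close> by (simp add: ennreal_mult'[symmetric])
  finally have "(1 - t) * (F / \<alpha>) + t * (G / \<beta>) \<le> H / \<gamma>"
    using H \<open>\<gamma> > 0\<close> by (subst (asm) ennreal_le_iff) auto
  moreover have "(F / \<alpha>) powr (1 - t) * (G / \<beta>) powr t \<le> (1 - t) * (F / \<alpha>) + t * (G / \<beta>)"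
    using FG \<open>\<alpha> > 0\<close> \<open>\<beta> > 0\<close> t by (intro Youngs_inequality_0) auto
  moreover have "(F / \<alpha>) powr (1 - t) * (G / \<beta>) powr t = (F powr (1 - t) * G powr t) / \<gamma>"
    using FG \<open>\<alpha> > 0\<close> \<open>\<beta> > 0\<close> by (simp add: powr_divide \<gamma>_def)
  ultimately have "(F powr (1 - t) * G powr t) / \<gamma> \<le> H / \<gamma>" by linarith
  then show ?thesis
    using \<open>\<gamma> > 0\<close> by (simp add: divide_le_cancel)
qed (use H in auto)

definition fiber :: "nat \<Rightarrow> vec set \<Rightarrow> real \<Rightarrow> vec set" where
  "fiber n A r = {x \<in> Rn n. x(n := r) \<in> A}"

lemma compact_convex_fiber:
  assumes "compact_convex (Suc n) A"
  shows "compact_convex n (fiber n A r)"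
  unfolding compact_convex_def
proof (intro conjI)
  note A = compact_convexD[OF assms]
  show "fiber n A r \<subseteq> Rn n" by (auto simp: fiber_def)
  show "convex (fiber n A r)"
  proof (rule convexI)
    fix x y u v assume *: "x \<in> fiber n A r" "y \<in> fiber n A r" "0 \<le> u" "0 \<le> v" "u + v = (1::real)"
    then have "u *\<^sub>R x(n := r) + v *\<^sub>R y(n := r) \<in> A"
      by (intro convexD[OF A(2)]) (auto simp: fiber_def)
    moreover have "u *\<^sub>R x(n := r) + v *\<^sub>R y(n := r) = (u *\<^sub>R x + v *\<^sub>R y)(n := r)"
      using * by (auto simp: fun_eq_iff vec_apply distrib_right[symmetric])
    ultimately show "u *\<^sub>R x + v *\<^sub>R y \<in> fiber n A r"
      using * by (auto simp: fiber_def intro!: subspace_add[OF subspace_Rn] subspace_scale[OF subspace_Rn])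
  qed
  have "closed (Rn n \<inter> (\<lambda>x. x(n := r)) -` A)"
    using A by (intro closed_Int closed_Rn closed_vimage compact_imp_closed continuous_on_vec_upd continuous_on_id continuous_on_const)
  then have "compact (trunc n ` A \<inter> (Rn n \<inter> (\<lambda>x. x(n := r)) -` A))"
    using compact_convexD(1)[OF compact_convex_trunc[OF assms, of n]] by (intro compact_Int_closed)
  moreover have "trunc n ` A \<inter> (Rn n \<inter> (\<lambda>x. x(n := r)) -` A) = fiber n A r"
    using in_trunc_image_iff[OF A(3)] by (auto simp: fiber_def)
  ultimately show "compact (fiber n A r)" by simp
qed

lemma
  assumes A: "compact_convex (Suc n) A"
  shows measurable_V_fiber: "(\<lambda>r. V n (fiber n A r)) \<in> borel_measurable borel"
    and nn_integral_V_fiber: "(\<integral>\<^sup>+r. ennreal (V n (fiber n A r)) \<partial>lborel) = ennreal (V (Suc n) A)"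
proof -
  interpret sigma_finite_measure "lam n" by (rule sigma_finite_lam)
  interpret P: pair_sigma_finite "lam n" lborel ..
  note [measurable] = compact_convexD(4)[OF A]
  have eq: "(\<integral>\<^sup>+x. indicator A (x(n := r)) \<partial>lam n) = ennreal (V n (fiber n A r))" for r
  proof -
    have "(\<integral>\<^sup>+x. indicator A (x(n := r)) \<partial>lam n) = (\<integral>\<^sup>+x. indicator (fiber n A r) x \<partial>lam n)"
      by (rule nn_integral_lam_cong) (simp add: fiber_def indicator_def)
    then show ?thesis
      using compact_convexD[OF compact_convex_fiber[OF A, of r]] by (simp add: emeasure_lam_eq_measure)
  qed
  have m: "(\<lambda>r. \<integral>\<^sup>+x. indicator A (x(n := r)) \<partial>lam n) \<in> borel_measurable borel"
    by measurable
  have "V n (fiber n A r) = enn2real (\<integral>\<^sup>+x. indicator A (x(n := r)) \<partial>lam n)" for r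
    by (simp add: eq)
  then show "(\<lambda>r. V n (fiber n A r)) \<in> borel_measurable borel"
    using m by simp
  have "ennreal (V (Suc n) A) = (\<integral>\<^sup>+x. \<integral>\<^sup>+r. indicator A (x(n := r)) \<partial>lborel \<partial>lam n)"
    using nn_integral_lam_Suc[of "indicator A" n] compact_convexD[OF A] by (simp add: emeasure_lam_eq_measure)
  also have "\<dots> = (\<integral>\<^sup>+r. \<integral>\<^sup>+x. indicator A (x(n := r)) \<partial>lam n \<partial>lborel)"
    by (rule P.Fubini'[of "\<lambda>x r. indicator A (x(n := r))", symmetric]) measurable
  finally show "(\<integral>\<^sup>+r. ennreal (V n (fiber n A r)) \<partial>lborel) = ennreal (V (Suc n) A)"
    by (simp add: eq)
qed

text \<open>By the induction hypothesis the volumes of the sections at given heights satisfy the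
  pointwise condition of \<open>prekopa_leindler_quasiconcave\<close>, and their integrals are the
  volumes in question. Empty sections cause no trouble because \<open>0 powr x = 0\<close>.\<close>

theorem brunn_minkowski_multiplicative:
  assumes "compact_convex n A" "compact_convex n B" "compact_convex n C" "0 < t" "t < 1"
    and "\<And>x y. x \<in> A \<Longrightarrow> y \<in> B \<Longrightarrow> (1 - t) *\<^sub>R x + t *\<^sub>R y \<in> C"
  shows "V n A powr (1 - t) * V n B powr t \<le> V n C"
  using assms
proof (induction n arbitrary: A B C t)
  case 0
  \<comment> \<open>In dimension 0 the measure is the unit mass at the zero sequence.\<close>
  have V0: "V 0 X = indicator X 0" if "compact_convex 0 X" for X
  proof -
    have X: "X \<in> sets borel" using compact_convexD(4)[OF that] .
    have "emeasure (lam 0) X = (\<integral>\<^sup>+x. indicator X x \<partial>lam 0)" using X by simp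
    also have "\<dots> = indicator X 0" using X by (intro nn_integral_lam_0) simp
    finally show ?thesis by (simp add: measure_def indicator_def)
  qed
  have "0 \<in> A \<Longrightarrow> 0 \<in> B \<Longrightarrow> 0 \<in> C" using "0.prems"(6)[of 0 0] by simp
  then show ?case using "0.prems" by (auto simp: V0 indicator_def)
next
  case (Suc n)
  note A = Suc.prems(1) and B = Suc.prems(2) and C = Suc.prems(3) and t = Suc.prems(4,5)
  have fib: "V n (fiber n X r) powr (1 - s) * V n (fiber n Y r') powr s \<le> V n (fiber n Z ((1 - s) * r + s * r'))"
    if X: "compact_convex (Suc n) X" and Y: "compact_convex (Suc n) Y" and Z: "compact_convex (Suc n) Z"
      and s: "0 < s" "s < 1" and sub: "\<And>x y. x \<in> X \<Longrightarrow> y \<in> Y \<Longrightarrow> (1 - s) *\<^sub>R x + s *\<^sub>R y \<in> Z"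
    for X Y Z r r' s
  proof (rule Suc.IH[OF compact_convex_fiber[OF X] compact_convex_fiber[OF Y] compact_convex_fiber[OF Z] s])
    fix x y assume xy: "x \<in> fiber n X r" "y \<in> fiber n Y r'"
    then have "(1 - s) *\<^sub>R x(n := r) + s *\<^sub>R y(n := r') \<in> Z"
      by (intro sub) (auto simp: fiber_def)
    moreover have "(1 - s) *\<^sub>R x(n := r) + s *\<^sub>R y(n := r') = ((1 - s) *\<^sub>R x + s *\<^sub>R y)(n := (1 - s) * r + s * r')"
      by (auto simp: fun_eq_iff vec_apply)
    ultimately show "(1 - s) *\<^sub>R x + s *\<^sub>R y \<in> fiber n Z ((1 - s) * r + s * r')"
      using xy by (auto simp: fiber_def intro!: subspace_add[OF subspace_Rn] subspace_scale[OF subspace_Rn])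
  qed
  have bdd: "bdd_above (range (\<lambda>r. V n (fiber n X r)))" if X: "compact_convex (Suc n) X" for X
  proof (rule bdd_aboveI2)
    fix r
    have "fiber n X r \<subseteq> trunc n ` X"
      using in_trunc_image_iff[OF compact_convexD(3)[OF X]] by (auto simp: fiber_def)
    then show "V n (fiber n X r) \<le> V n (trunc n ` X)"
      using X by (intro V_mono compact_convexD(1)[of n] compact_convex_fiber compact_convex_trunc)
  qed
  \<comment> \<open>Taking all three bodies equal makes the section volume log-concave, so at an
    intermediate height it is at least the smaller of the two outer values.\<close>
  have conv: "convex {r. V n (fiber n X r) > s}" if X: "compact_convex (Suc n) X" and "s \<ge> 0" for X s
  proof (rule convexI)
    fix x y u v assume *: "x \<in> {r. V n (fiber n X r) > s}" "y \<in> {r. V n (fiber n X r) > s}" "0 \<le> u" "0 \<le> v" "u + v = (1::real)"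
    show "u *\<^sub>R x + v *\<^sub>R y \<in> {r. V n (fiber n X r) > s}"
    proof (cases "u = 0 \<or> v = 0")
      case False
      then have uv: "0 < v" "v < 1" "u = 1 - v" using * by auto
      define m where "m = min (V n (fiber n X x)) (V n (fiber n X y))"
      have m: "m > s" "m > 0" using * \<open>s \<ge> 0\<close> by (auto simp: m_def)
      have "m = m powr (1 - v) * m powr v" using m by (simp flip: powr_add)
      also have "\<dots> \<le> V n (fiber n X x) powr (1 - v) * V n (fiber n X y) powr v"
        using m uv by (intro mult_mono powr_mono2) (auto simp: m_def)
      also have "\<dots> \<le> V n (fiber n X ((1 - v) * x + v * y))"
        using uv by (intro fib[OF X X X] convexD[OF compact_convexD(2)[OF X]]) auto
      finally show ?thesis using m uv by simp
    qed (use * in auto)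
  qed
  have bounded: "bounded {r. V n (fiber n X r) > 0}" if X: "compact_convex (Suc n) X" for X
  proof (rule bounded_subset)
    have "compact ((\<lambda>x. x n) ` X)"
      using compact_convexD(1)[OF X] by (intro compact_continuous_image continuous_on_vec_coord continuous_on_id)
    then show "bounded ((\<lambda>x. x n) ` X)" by (rule compact_imp_bounded)
    show "{r. V n (fiber n X r) > 0} \<subseteq> (\<lambda>x. x n) ` X"
    proof
      fix r assume "r \<in> {r. V n (fiber n X r) > 0}"
      then have "fiber n X r \<noteq> {}" by auto
      then obtain x where "x(n := r) \<in> X" by (auto simp: fiber_def)
      then show "r \<in> (\<lambda>x. x n) ` X" by (force intro: rev_image_eqI)
    qed
  qed
  show ?case
    by (rule prekopa_leindler_quasiconcave[of "\<lambda>r. V n (fiber n A r)" "\<lambda>r. V n (fiber n B r)" "\<lambda>r. V n (fiber n C r)"])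
       (auto intro!: measurable_V_fiber A B C bdd conv bounded t fib Suc.prems(6) nn_integral_V_fiber)
qed

text \<open>Derived from the multiplicative form by rescaling \<open>A\<close> and \<open>B\<close>
  to volume 1.\<close>

theorem brunn_minkowski:
  assumes A: "compact_convex n A" and B: "compact_convex n B" and C: "compact_convex n C" and "n \<ge> 1"
    and "0 < l" "l < 1" "V n A > 0" "V n B > 0"
    and sub: "\<And>x y. x \<in> A \<Longrightarrow> y \<in> B \<Longrightarrow> (1 - l) *\<^sub>R x + l *\<^sub>R y \<in> C"
  shows "((1 - l) * root n (V n A) + l * root n (V n B)) ^ n \<le> V n C"
proof -
  define \<alpha> where "\<alpha> = root n (V n A)"
  define \<beta> where "\<beta> = root n (V n B)"
  define \<theta> where "\<theta> = (1 - l) * \<alpha> + l * \<beta>"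
  have pos: "\<alpha> > 0" "\<beta> > 0" using assms by (simp_all add: \<alpha>_def \<beta>_def)
  have pow: "\<alpha> ^ n = V n A" "\<beta> ^ n = V n B" using assms by (simp_all add: \<alpha>_def \<beta>_def)
  have "\<theta> > 0" using pos assms by (simp add: \<theta>_def add_pos_pos)
  \<comment> \<open>Chosen so that (1 - t) a/\<alpha> + t b/\<beta> = ((1 - l) a + l
    b)/\<theta>.\<close>
  define t where "t = l * \<beta> / \<theta>"
  have t1: "1 - t = (1 - l) * \<alpha> / \<theta>"
  proof -
    have "(1 - l) * \<alpha> = \<theta> - l * \<beta>" by (simp add: \<theta>_def)
    then show ?thesis using \<open>\<theta> > 0\<close> by (simp only: t_def diff_divide_distrib) simp
  qed
  have "0 < t" using pos assms \<open>\<theta> > 0\<close> by (simp add: t_def)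
  moreover have "0 < 1 - t" unfolding t1 using pos assms \<open>\<theta> > 0\<close> by simp
  ultimately have t: "0 < t" "t < 1" by auto
  have "V n ((*\<^sub>R) (1 / \<alpha>) ` A) powr (1 - t) * V n ((*\<^sub>R) (1 / \<beta>) ` B) powr t \<le> V n ((*\<^sub>R) (1 / \<theta>) ` C)"
  proof (rule brunn_minkowski_multiplicative)
    fix x y assume "x \<in> (*\<^sub>R) (1 / \<alpha>) ` A" "y \<in> (*\<^sub>R) (1 / \<beta>) ` B"
    then obtain a b where ab: "a \<in> A" "b \<in> B" "x = (1 / \<alpha>) *\<^sub>R a" "y = (1 / \<beta>) *\<^sub>R b" by auto
    have "(1 - t) *\<^sub>R x + t *\<^sub>R y = (1 / \<theta>) *\<^sub>R ((1 - l) *\<^sub>R a + l *\<^sub>R b)"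
      unfolding t1 unfolding t_def ab using pos by (simp add: scaleR_add_right)
    then show "(1 - t) *\<^sub>R x + t *\<^sub>R y \<in> (*\<^sub>R) (1 / \<theta>) ` C"
      using sub[OF ab(1,2)] by blast
  qed (use A B C t in \<open>auto intro!: compact_convex_scaleR\<close>)
  then have "1 \<le> V n C / \<theta> ^ n"
    using pos \<open>\<theta> > 0\<close> A B C assms by (simp add: V_scaleR compact_convexD power_divide pow)
  then have "\<theta> ^ n \<le> V n C" using \<open>\<theta> > 0\<close> by (simp add: pos_le_divide_eq)
  then show ?thesis by (simp add: \<theta>_def \<alpha>_def \<beta>_def)
qed

section \<open>Chord lengths of a convex body\<close>

definition chord :: "nat \<Rightarrow> vec set \<Rightarrow> vec \<Rightarrow> real" where
  "chord k D z = measure lborel {t. z(k := t) \<in> D}"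

lemma emeasure_slice_eq_chord:
  assumes "compact_convex m D"
  shows "emeasure lborel {t. z(k := t) \<in> D} = ennreal (chord k D z)"
  unfolding chord_def by (rule slice_interval[OF assms, of z k]) (auto simp: measure_def)

lemma measurable_chord [measurable]: 
  assumes [measurable]: "D \<in> sets borel"
  shows "chord k D \<in> borel_measurable borel"
  unfolding chord_def measure_def by measurable

lemma chord_nonneg: "chord k D z \<ge> 0"
  by (simp add: chord_def)

lemma nn_integral_chord:
  assumes "compact_convex (Suc k) D"
  shows "(\<integral>\<^sup>+z. ennreal (chord k D z) \<partial>lam k) = ennreal (V (Suc k) D)"
  using emeasure_lam_Suc[OF compact_convexD(4)[OF assms], of k] compact_convexD(1)[OF assms]
  by (simp add: emeasure_slice_eq_chord[OF assms] emeasure_lam_eq_measure)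

lemma chord_ge_of_interval:
  assumes "compact_convex m D" "p \<le> q" "{p..q} \<subseteq> {t. z(k := t) \<in> D}"
  shows "q - p \<le> chord k D z"
proof (rule slice_interval[OF assms(1), of z k])
  fix p' q' assume *: "p' \<le> q'" "{t. z(k := t) \<in> D} = {p'..q'}"
  then have "p' \<le> p" "q \<le> q'" using assms(2,3) by auto
  then show ?thesis using * by (simp add: chord_def)
qed (use assms in auto)

text \<open>The hull of a point of \<open>D\<close> over \<open>z\<close> and of the chord over
  \<open>z0\<close> lies in \<open>D\<close>; its chord over the point at fraction \<tau> has length
  \<tau> times the chord over \<open>z0\<close>.\<close>

lemma chord_convex_combination:
  assumes D: "compact_convex m D" and z: "z(k := t) \<in> D" and \<tau>: "0 \<le> \<tau>" "\<tau> \<le> 1" and pos: "chord k D z0 > 0"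
  shows "\<tau> * chord k D z0 \<le> chord k D ((1 - \<tau>) *\<^sub>R z + \<tau> *\<^sub>R z0)"
proof (rule slice_interval[OF D, of z0 k])
  assume "{t. z0(k := t) \<in> D} = {}"
  then show ?thesis using pos by (simp add: chord_def)
next
  fix p q assume pq: "p \<le> q" "{t. z0(k := t) \<in> D} = {p..q}"
  have "((1 - \<tau>) * t + \<tau> * q) - ((1 - \<tau>) * t + \<tau> * p) \<le> chord k D ((1 - \<tau>) *\<^sub>R z + \<tau> *\<^sub>R z0)"
  proof (rule chord_ge_of_interval[OF D])
    show "(1 - \<tau>) * t + \<tau> * p \<le> (1 - \<tau>) * t + \<tau> * q"
      using pq \<tau> by (simp add: mult_left_mono)
    show "{(1 - \<tau>) * t + \<tau> * p..(1 - \<tau>) * t + \<tau> * q} \<subseteq> {t. ((1 - \<tau>) *\<^sub>R z + \<tau> *\<^sub>R z0)(k := t) \<in> D}"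
    proof
      fix r assume r: "r \<in> {(1 - \<tau>) * t + \<tau> * p..(1 - \<tau>) * t + \<tau> * q}"
      obtain s where s: "s \<in> {p..q}" "r = (1 - \<tau>) * t + \<tau> * s"
      proof (cases "\<tau> = 0")
        case True
        then show ?thesis using that[of p] r pq by auto
      next
        case False
        then have "\<tau> > 0" using \<tau> by simp
        define s where "s = (r - (1 - \<tau>) * t) / \<tau>"
        have "\<tau> * s = r - (1 - \<tau>) * t" using \<open>\<tau> > 0\<close> by (simp add: s_def)
        moreover from this have "\<tau> * p \<le> \<tau> * s" "\<tau> * s \<le> \<tau> * q" using r by auto
        moreover from this have "p \<le> s" "s \<le> q"
          using \<open>\<tau> > 0\<close> mult_left_le_imp_le by blast+
        ultimately show ?thesis
          using that[of s] by auto
      qed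
      have "z0(k := s) \<in> D" using s pq by auto
      then have "(1 - \<tau>) *\<^sub>R z(k := t) + \<tau> *\<^sub>R z0(k := s) \<in> D"
        using z \<tau> by (intro convexD[OF compact_convexD(2)[OF D]]) auto
      also have "(1 - \<tau>) *\<^sub>R z(k := t) + \<tau> *\<^sub>R z0(k := s) = ((1 - \<tau>) *\<^sub>R z + \<tau> *\<^sub>R z0)(k := r)"
        by (auto simp: fun_eq_iff vec_apply s(2))
      finally show "r \<in> {t. ((1 - \<tau>) *\<^sub>R z + \<tau> *\<^sub>R z0)(k := t) \<in> D}" by (rule CollectI)
    qed
  qed
  then show ?thesis
    using pq by (simp add: chord_def algebra_simps)
qed

text \<open>The intersection of \<open>D\<close> with its translate by -s along axis
  \<open>k\<close>; as a function of \<open>s\<close>, its volume is the covariogram of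
  \<open>D\<close> in that direction.\<close>

definition overlap :: "nat \<Rightarrow> vec set \<Rightarrow> real \<Rightarrow> vec set" where
  "overlap k D s = {x \<in> D. x + s *\<^sub>R unit_vec k \<in> D}"

lemma compact_convex_overlap:
  assumes "compact_convex m D"
  shows "compact_convex m (overlap k D s)"
  unfolding compact_convex_def
proof (intro conjI)
  note D = compact_convexD[OF assms]
  have "closed ((\<lambda>x. x + s *\<^sub>R unit_vec k) -` D)"
    using D by (intro closed_vimage compact_imp_closed continuous_on_vec_add continuous_on_id continuous_on_const)
  then have "compact (D \<inter> (\<lambda>x. x + s *\<^sub>R unit_vec k) -` D)"
    using D by (intro compact_Int_closed)
  moreover have "D \<inter> (\<lambda>x. x + s *\<^sub>R unit_vec k) -` D = overlap k D s"
    by (auto simp: overlap_def)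
  ultimately show "compact (overlap k D s)" by simp
  show "overlap k D s \<subseteq> Rn m" using D by (auto simp: overlap_def)
  show "convex (overlap k D s)"
  proof (rule convexI)
    fix x y u v assume *: "x \<in> overlap k D s" "y \<in> overlap k D s" "0 \<le> u" "0 \<le> v" "u + v = (1::real)"
    then have "u *\<^sub>R x + v *\<^sub>R y \<in> D" "u *\<^sub>R (x + s *\<^sub>R unit_vec k) + v *\<^sub>R (y + s *\<^sub>R unit_vec k) \<in> D"
      by (auto simp: overlap_def intro!: convexD[OF D(2)])
    moreover have "u *\<^sub>R (x + s *\<^sub>R unit_vec k) + v *\<^sub>R (y + s *\<^sub>R unit_vec k) = (u *\<^sub>R x + v *\<^sub>R y) + ((u + v) * s) *\<^sub>R unit_vec k"
      by (simp add: algebra_simps)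
    ultimately show "u *\<^sub>R x + v *\<^sub>R y \<in> overlap k D s"
      using * by (simp add: overlap_def)
  qed
qed

lemma chord_overlap:
  assumes D: "compact_convex m D" and "s \<ge> 0"
  shows "chord k (overlap k D s) z = max 0 (chord k D z - s)"
proof -
  have upd: "z(k := t) + s *\<^sub>R unit_vec k = z(k := t + s)" for t
    by (auto simp: fun_eq_iff vec_apply unit_vec_def)
  have eq: "{t. z(k := t) \<in> overlap k D s} = {t. z(k := t) \<in> D \<and> z(k := t + s) \<in> D}"
    by (simp add: overlap_def upd)
  show ?thesis
  proof (rule slice_interval[OF D, of z k])
    assume "{t. z(k := t) \<in> D} = {}"
    then show ?thesis using \<open>s \<ge> 0\<close> by (simp add: chord_def eq)
  next
    fix p q assume pq: "p \<le> q" "{t. z(k := t) \<in> D} = {p..q}"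
    then have mem: "z(k := t) \<in> D \<longleftrightarrow> t \<in> {p..q}" for t by blast
    have "{t. z(k := t) \<in> overlap k D s} = {t. t \<in> {p..q} \<and> t + s \<in> {p..q}}"
      unfolding eq mem ..
    also have "\<dots> = {p..q - s}"
      using \<open>s \<ge> 0\<close> by auto
    finally have "{t. z(k := t) \<in> overlap k D s} = {p..q - s}" .
    then show ?thesis
      using pq by (cases "p \<le> q - s") (simp_all add: chord_def measure_def)
  qed
qed

text \<open>Wherever the chord has length at least \<open>h\<close>, passing to the overlap costs
  exactly \<open>h\<close>. By \<open>chord_convex_combination\<close> this holds on the projection
  of \<open>D\<close> shrunk towards \<open>z0\<close> by the factor 1 - h/chord. The bound has the
  correct first-order term in \<open>h\<close>.\<close>

lemma V_overlap_decrease: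
  assumes D: "compact_convex (Suc k) D" and z0: "z0 \<in> Rn k" "chord k D z0 > 0" and h: "0 \<le> h" "h < chord k D z0"
  shows "V (Suc k) (overlap k D h) + h * (1 - h / chord k D z0) ^ k * V k (trunc k ` D) \<le> V (Suc k) D"
proof -
  define \<tau> where "\<tau> = h / chord k D z0"
  have \<tau>: "0 \<le> \<tau>" "\<tau> < 1" "\<tau> * chord k D z0 = h" using h z0 by (simp_all add: \<tau>_def)
  have G: "compact_convex k (trunc k ` D)" by (rule compact_convex_trunc[OF D])
  define E where "E = (+) (\<tau> *\<^sub>R z0) ` (*\<^sub>R) (1 - \<tau>) ` trunc k ` D"
  have zR: "\<tau> *\<^sub>R z0 \<in> Rn k" using z0(1) by (rule subspace_scale[OF subspace_Rn])
  have E: "compact_convex k E"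
    unfolding E_def by (intro compact_convex_translate compact_convex_scaleR G zR)
  have VE: "V k E = (1 - \<tau>) ^ k * V k (trunc k ` D)"
    unfolding E_def using \<tau> compact_convexD(1)[OF G] zR by (simp add: V_translate V_scaleR compact_scaleR)
  note [measurable] = compact_convexD(4)[OF D] compact_convexD(4)[OF E] compact_convexD(4)[OF compact_convex_overlap[OF D]]
  have inE: "h \<le> chord k D z" if "z \<in> E" for z
  proof -
    obtain y where y: "y \<in> trunc k ` D" "z = \<tau> *\<^sub>R z0 + (1 - \<tau>) *\<^sub>R y"
      using \<open>z \<in> E\<close> unfolding E_def by blast
    then obtain t where "y(k := t) \<in> D"
      using in_trunc_image_iff[OF compact_convexD(3)[OF D], of y] compact_convexD(3)[OF G] by blast
    from chord_convex_combination[OF D this _ _ z0(2), of \<tau>] show ?thesis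
      using \<tau> y(2) by (simp add: add.commute)
  qed
  have "ennreal (V (Suc k) (overlap k D h) + h * V k E) = ennreal (V (Suc k) (overlap k D h)) + ennreal h * ennreal (V k E)"
    using h by (simp add: ennreal_mult)
  also have "\<dots> = (\<integral>\<^sup>+z. ennreal (chord k (overlap k D h) z) + ennreal h * indicator E z \<partial>lam k)"
    using nn_integral_chord[OF compact_convex_overlap[OF D, of k h]] compact_convexD(1)[OF E]
    by (subst nn_integral_add) (auto simp: nn_integral_cmult emeasure_lam_eq_measure)
  also have "\<dots> \<le> (\<integral>\<^sup>+z. ennreal (chord k D z) \<partial>lam k)"
  proof (rule nn_integral_mono)
    fix z
    show "ennreal (chord k (overlap k D h) z) + ennreal h * indicator E z \<le> ennreal (chord k D z)"
      using inE[of z] chord_nonneg[of k D z] h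
      by (cases "z \<in> E") (simp_all add: chord_overlap[OF D] ennreal_leI flip: ennreal_plus)
  qed
  also have "\<dots> = ennreal (V (Suc k) D)" by (rule nn_integral_chord[OF D])
  finally have "V (Suc k) (overlap k D h) + h * V k E \<le> V (Suc k) D"
    by (subst (asm) ennreal_le_iff) auto
  then show ?thesis by (simp add: VE \<tau>_def)
qed

text \<open>
  By Brunn-Minkowski the \<open>(k + 1)\<close>-th root of the covariogram \<open>s \<mapsto> V (overlap k D s)\<close> is concave, so it lies below its
  tangent at \<open>0\<close>, whose slope is governed by the projection of \<open>D\<close>.
\<close>

lemma V_overlap_le:
  assumes D: "compact_convex (Suc k) D" and pos: "V (Suc k) D > 0" and "s \<ge> 0"
  shows "V (Suc k) (overlap k D s) \<le>
    V (Suc k) D * (max 0 (1 - s * V k (trunc k ` D) / (Suc k * V (Suc k) D))) ^ Suc k"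
proof (cases "s = 0 \<or> V (Suc k) (overlap k D s) = 0")
  case True
  then show ?thesis
    using pos by (auto simp: overlap_def)
next
  case False
  let ?F = "\<lambda>s. V (Suc k) (overlap k D s)" and ?m = "Suc k"
  define F0 where "F0 = V (Suc k) D"
  define V0 where "V0 = V k (trunc k ` D)"
  have sF: "s > 0" "?F s > 0" using False \<open>s \<ge> 0\<close> by (auto simp: less_le)
  have "F0 > 0" using pos by (simp add: F0_def)
  have "\<exists>z0\<in>Rn k. chord k D z0 > 0"
  proof (rule ccontr)
    assume "\<not> ?thesis"
    then have "(\<integral>\<^sup>+z. ennreal (chord k D z) \<partial>lam k) = (\<integral>\<^sup>+z. 0 \<partial>lam k)"
      by (intro nn_integral_lam_cong) (auto simp: not_less ennreal_neg)
    then show False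
      using nn_integral_chord[OF D] pos by (simp add: ennreal_eq_0_iff)
  qed
  then obtain z0 where z0: "z0 \<in> Rn k" "chord k D z0 > 0" by blast
  define y where "y = root ?m (?F s) / root ?m F0"
  have y0: "y \<ge> 0" using sF \<open>F0 > 0\<close> by (simp add: y_def)
  have ypow: "?F s = F0 * y ^ ?m"
    using sF \<open>F0 > 0\<close> by (simp add: y_def power_divide real_root_pow_pos2 del: power_Suc)
  \<comment> \<open>Brunn-Minkowski between \<open>D\<close> and the overlap at shift
    \<open>s\<close> bounds the covariogram at \<open>l * s\<close> from below, and
    \<open>V_overlap_decrease\<close> bounds it from above. Their first-order terms in
    \<open>l\<close> are compared.\<close>
  have step: "s * V0 / F0 * (1 - l * s / chord k D z0) ^ k \<le> ?m * (1 - y)"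
    if l: "0 < l" "l < 1" "l * s < chord k D z0" for l
  proof -
    have "((1 - l) * root ?m F0 + l * root ?m (?F s)) ^ ?m \<le> ?F (l * s)"
      unfolding F0_def
    proof (rule brunn_minkowski[OF D compact_convex_overlap[OF D] compact_convex_overlap[OF D]])
      fix x w assume xw: "x \<in> D" "w \<in> overlap k D s"
      then have "(1 - l) *\<^sub>R x + l *\<^sub>R w \<in> D" "(1 - l) *\<^sub>R x + l *\<^sub>R (w + s *\<^sub>R unit_vec k) \<in> D"
        using l by (auto simp: overlap_def intro!: convexD[OF compact_convexD(2)[OF D]])
      then show "(1 - l) *\<^sub>R x + l *\<^sub>R w \<in> overlap k D (l * s)"
        by (simp add: overlap_def scaleR_add_right add.assoc)
    qed (use l pos sF in auto)
    also have "\<dots> \<le> F0 - l * s * (1 - l * s / chord k D z0) ^ k * V0"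
      using V_overlap_decrease[OF D z0, of "l * s"] l sF by (simp add: F0_def V0_def)
    also have "(1 - l) * root ?m F0 + l * root ?m (?F s) = root ?m F0 * (1 + l * (y - 1))"
      using \<open>F0 > 0\<close> by (simp add: y_def field_simps)
    also have "(root ?m F0 * (1 + l * (y - 1))) ^ ?m = F0 * (1 + l * (y - 1)) ^ ?m"
      using \<open>F0 > 0\<close> by (simp only: power_mult_distrib real_root_pow_pos2[OF zero_less_Suc less_imp_le])
    finally have "F0 * (1 + l * (y - 1)) ^ ?m \<le> F0 - l * s * (1 - l * s / chord k D z0) ^ k * V0" .
    \<comment> \<open>Bernoulli linearizes the power in \<open>l\<close>, after which
      \<open>l\<close> cancels.\<close>
    moreover have "1 + ?m * (l * (y - 1)) \<le> (1 + l * (y - 1)) ^ ?m"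
    proof (rule Bernoulli_inequality)
      have "l * (1 - y) \<le> l * 1" using l y0 by (intro mult_left_mono) auto
      then show "- 1 \<le> l * (y - 1)" using l by (simp add: algebra_simps)
    qed
    then have "F0 * (1 + ?m * (l * (y - 1))) \<le> F0 * (1 + l * (y - 1)) ^ ?m"
      using \<open>F0 > 0\<close> by (intro mult_left_mono) auto
    ultimately have "F0 * (1 + ?m * (l * (y - 1))) \<le> F0 - l * s * (1 - l * s / chord k D z0) ^ k * V0"
      by linarith
    then have "l * (s * V0 * (1 - l * s / chord k D z0) ^ k) \<le> l * (F0 * (?m * (1 - y)))"
      by (simp add: algebra_simps)
    then have "s * V0 * (1 - l * s / chord k D z0) ^ k \<le> F0 * (?m * (1 - y))"
      using l(1) by (subst (asm) mult_le_cancel_left_pos) auto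
    then show ?thesis
      using \<open>F0 > 0\<close> by (simp add: pos_divide_le_eq mult_ac)
  qed
  \<comment> \<open>As \<open>l\<close> tends to 0 the shrinking factor disappears, leaving the
    tangent bound for \<open>y\<close>.\<close>
  have lim: "((\<lambda>l. s * V0 / F0 * (1 - l * s / chord k D z0) ^ k) \<longlongrightarrow> s * V0 / F0 * (1 - 0 * s / chord k D z0) ^ k) (at_right 0)"
    by (intro tendsto_intros) (use z0 in auto)
  have "\<forall>\<^sub>F l in at_right (0::real). l \<in> {0<..<min 1 (chord k D z0 / s)}"
    using sF z0 by (intro eventually_at_right_real) auto
  then have "\<forall>\<^sub>F l in at_right (0::real). s * V0 / F0 * (1 - l * s / chord k D z0) ^ k \<le> ?m * (1 - y)"
    by (rule eventually_mono) (use step sF in \<open>auto simp: pos_less_divide_eq\<close>)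
  then have "s * V0 / F0 * (1 - 0 * s / chord k D z0) ^ k \<le> ?m * (1 - y)"
    by (intro tendsto_upperbound[OF lim]) auto
  then have "s * V0 / F0 / ?m \<le> 1 - y"
    by (subst pos_divide_le_eq) (simp_all add: mult.commute)
  moreover have "s * V0 / F0 / ?m = s * V0 / (?m * F0)"
    by (simp add: divide_divide_eq_left mult.commute)
  ultimately have "y \<le> 1 - s * V0 / (?m * F0)"
    by linarith
  then have "y ^ ?m \<le> (max 0 (1 - s * V0 / (?m * F0))) ^ ?m"
    using y0 by (intro power_mono) auto
  then show ?thesis
    using ypow \<open>F0 > 0\<close> unfolding F0_def V0_def by (simp add: mult_left_mono del: power_Suc)
qed

text \<open>A square a^2 is twice the integral of the positive part of a - s over s \<ge> 0, and
  integrating that positive part over the base gives the covariogram at \<open>s\<close>. The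
  tangent bound then yields 2 F0 c/(k + 2). With n = k + 2 this is the origin of the constant
  2(n-1)/n.\<close>

lemma nn_integral_chord_sq_le:
  assumes D: "body (Suc k) D"
  shows "(\<integral>\<^sup>+z. ennreal ((chord k D z)\<^sup>2) \<partial>lam k) \<le>
    ennreal (2 * Suc k / (k + 2) * (V (Suc k) D)\<^sup>2 / V k (trunc k ` D))"
proof -
  interpret sigma_finite_measure "lam k" by (rule sigma_finite_lam)
  interpret P: pair_sigma_finite "lam k" lborel ..
  note cD = body_compact_convex[OF D]
  note [measurable] = compact_convexD(4)[OF cD]
  let ?m = "Suc k"
  define F0 where "F0 = V (Suc k) D"
  define V0 where "V0 = V k (trunc k ` D)"
  have pos: "F0 > 0" "V0 > 0"
    unfolding F0_def V0_def by (intro V_body_pos D body_trunc)+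
  \<comment> \<open>The shift at which the bound of \<open>V_overlap_le\<close> reaches
    zero.\<close>
  define c where "c = ?m * F0 / V0"
  have "c > 0" using pos by (simp add: c_def)
  have inner: "(\<integral>\<^sup>+s. indicator {0..} s * ennreal (max 0 (a - s)) \<partial>lborel) = ennreal (a\<^sup>2 / 2)" if "a \<ge> 0" for a :: real
  proof -
    have "(\<integral>\<^sup>+s. indicator {0..} s * ennreal (max 0 (a - s)) \<partial>lborel) = (\<integral>\<^sup>+s. ennreal (a - s) * indicator {0..a} s \<partial>lborel)"
      by (rule nn_integral_cong) (auto simp: indicator_def max_def)
    also have "\<dots> = ennreal ((a * a - a\<^sup>2 / 2) - (a * 0 - 0\<^sup>2 / 2))"
      by (rule nn_integral_FTC_Icc[where F = "\<lambda>s. a * s - s\<^sup>2 / 2"])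
         (use that in \<open>auto intro!: derivative_eq_intros\<close>)
    finally show ?thesis by (simp add: power2_eq_square)
  qed
  have tent: "(\<integral>\<^sup>+s. indicator {0..} s * ennreal ((max 0 (1 - s / c)) ^ ?m) \<partial>lborel) = ennreal (c / (k + 2))"
  proof -
    have "(\<integral>\<^sup>+s. indicator {0..} s * ennreal ((max 0 (1 - s / c)) ^ ?m) \<partial>lborel) =
        (\<integral>\<^sup>+s. ennreal ((1 - s / c) ^ ?m) * indicator {0..c} s \<partial>lborel)"
    proof (rule nn_integral_cong)
      fix s
      show "indicator {0..} s * ennreal ((max 0 (1 - s / c)) ^ ?m) = ennreal ((1 - s / c) ^ ?m) * indicator {0..c} s"
      proof (cases "s \<le> c")
        case True
        then have "0 \<le> 1 - s / c" using \<open>c > 0\<close> by simp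
        then show ?thesis using True by (simp add: indicator_def max_def)
      next
        case False
        then have "1 - s / c \<le> 0" using \<open>c > 0\<close> by simp
        then show ?thesis using False by (simp add: indicator_def max_def)
      qed
    qed
    also have "\<dots> = ennreal (- (c / Suc ?m) * (1 - c / c) ^ Suc ?m - (- (c / Suc ?m) * (1 - 0 / c) ^ Suc ?m))"
    proof (rule nn_integral_FTC_Icc[where F = "\<lambda>s. - (c / Suc ?m) * (1 - s / c) ^ Suc ?m"])
      fix s :: real
      have "((\<lambda>s. 1 - s / c) has_real_derivative - (1 / c)) (at s)"
        using \<open>c > 0\<close> by (auto intro!: derivative_eq_intros)
      from DERIV_cmult[OF DERIV_power[OF this, of "Suc ?m"], of "- (c / Suc ?m)"]
      show "((\<lambda>s. - (c / Suc ?m) * (1 - s / c) ^ Suc ?m) has_real_derivative (1 - s / c) ^ ?m) (at s)"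
        using \<open>c > 0\<close> by (simp del: power_Suc of_nat_Suc)
    next
      show "0 \<le> (1 - s / c) ^ ?m" if "s \<in> {0..c}" for s
        using that \<open>c > 0\<close> by (intro zero_le_power) simp
    qed (use \<open>c > 0\<close> in auto)
    finally show ?thesis using \<open>c > 0\<close> by (simp add: add.commute)
  qed
  have "(\<integral>\<^sup>+z. ennreal ((chord k D z)\<^sup>2) \<partial>lam k) =
      (\<integral>\<^sup>+z. ennreal 2 * (\<integral>\<^sup>+s. indicator {0..} s * ennreal (max 0 (chord k D z - s)) \<partial>lborel) \<partial>lam k)"
  proof (rule nn_integral_cong)
    fix z
    have "2 * ((chord k D z)\<^sup>2 / 2) = (chord k D z)\<^sup>2" by simp
    then show "ennreal ((chord k D z)\<^sup>2) = ennreal 2 * (\<integral>\<^sup>+s. indicator {0..} s * ennreal (max 0 (chord k D z - s)) \<partial>lborel)"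
      using ennreal_mult'[of 2 "(chord k D z)\<^sup>2 / 2"] by (simp only: inner[OF chord_nonneg])
  qed
  also have "\<dots> = ennreal 2 * (\<integral>\<^sup>+z. \<integral>\<^sup>+s. indicator {0..} s * ennreal (max 0 (chord k D z - s)) \<partial>lborel \<partial>lam k)"
    by (rule nn_integral_cmult) measurable
  also have "(\<integral>\<^sup>+z. \<integral>\<^sup>+s. indicator {0..} s * ennreal (max 0 (chord k D z - s)) \<partial>lborel \<partial>lam k) =
      (\<integral>\<^sup>+s. \<integral>\<^sup>+z. indicator {0..} s * ennreal (max 0 (chord k D z - s)) \<partial>lam k \<partial>lborel)"
    by (rule P.Fubini'[of "\<lambda>z s. indicator {0..} s * ennreal (max 0 (chord k D z - s))", symmetric]) measurable
  also have "\<dots> \<le> (\<integral>\<^sup>+s. ennreal F0 * (indicator {0..} s * ennreal ((max 0 (1 - s / c)) ^ ?m)) \<partial>lborel)"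
  proof (rule nn_integral_mono)
    fix s :: real
    show "(\<integral>\<^sup>+z. indicator {0..} s * ennreal (max 0 (chord k D z - s)) \<partial>lam k) \<le>
        ennreal F0 * (indicator {0..} s * ennreal ((max 0 (1 - s / c)) ^ ?m))"
    proof (cases "s \<ge> 0")
      case True
      have "(\<integral>\<^sup>+z. ennreal (max 0 (chord k D z - s)) \<partial>lam k) = ennreal (V (Suc k) (overlap k D s))"
        using nn_integral_chord[OF compact_convex_overlap[OF cD, of k s]] True by (simp add: chord_overlap[OF cD])
      also have "\<dots> \<le> ennreal (F0 * (max 0 (1 - s / c)) ^ ?m)"
        using V_overlap_le[OF cD _ True] pos
        by (intro ennreal_leI) (simp add: F0_def V0_def c_def)
      also have "\<dots> = ennreal F0 * ennreal ((max 0 (1 - s / c)) ^ ?m)"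
        using pos by (intro ennreal_mult') simp
      finally show ?thesis using True by simp
    qed simp
  qed
  also have "\<dots> = ennreal F0 * ennreal (c / (k + 2))"
    unfolding tent[symmetric] by (rule nn_integral_cmult) simp
  also have "ennreal 2 * (ennreal F0 * ennreal (c / (k + 2))) = ennreal (2 * (F0 * (c / (k + 2))))"
    using pos \<open>c > 0\<close> by (simp only: ennreal_mult'[symmetric])
  also have "2 * (F0 * (c / (k + 2))) = 2 * Suc k / (k + 2) * F0\<^sup>2 / V0"
    by (simp add: c_def power2_eq_square algebra_simps)
  finally show ?thesis
    by (simp add: F0_def V0_def add.commute mult_left_mono)
qed

section \<open>Projections along two directions\<close>

text \<open>Exchanging the two last axes turns the projection along axis \<open>k\<close> into a
  truncation.\<close>

definition swap_coords :: "nat \<Rightarrow> vec \<Rightarrow> vec" where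
  "swap_coords k x = x(k := x (Suc k), Suc k := x k)"

lemma swap_coords_GL: "swap_coords k \<in> GL (Suc (Suc k))"
  by (rule GLI[where S = "swap_coords k"])
     (auto simp: swap_coords_def fun_eq_iff vec_apply Rn_iff)

lemma vnorm_swap_coords: "vnorm (Suc (Suc k)) (swap_coords k x) = vnorm (Suc (Suc k)) x"
  by (simp add: L2_set_def swap_coords_def add_ac)

lemma trunc_swap_coords: "trunc k (swap_coords k x) = trunc k x"
  by (auto simp: trunc_def swap_coords_def)

lemma trunc_trunc: "j \<le> k \<Longrightarrow> trunc j (trunc k x) = trunc j x"
  by (auto simp: trunc_def)

lemma swap_coords_unit_vec: "swap_coords k (unit_vec k) = unit_vec (Suc k)"
  by (auto simp: swap_coords_def unit_vec_def fun_eq_iff)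

text \<open>Over a point of the first \<open>k\<close> coordinates the body has a planar section. It
  lies in the rectangle spanned by its two shadows, which are chords of \<open>D\<close> and of
  \<open>E\<close>.\<close>

lemma V_le_nn_integral_chord_product:
  assumes K: "compact_convex (Suc (Suc k)) K"
  defines "D \<equiv> trunc (Suc k) ` K" and "E \<equiv> trunc (Suc k) ` swap_coords k ` K"
  shows "ennreal (V (Suc (Suc k)) K) \<le> (\<integral>\<^sup>+z. ennreal (chord k D z * chord k E z) \<partial>lam k)"
proof -
  have D: "compact_convex (Suc k) D" unfolding D_def by (rule compact_convex_trunc[OF K])
  have E: "compact_convex (Suc k) E"
    unfolding E_def by (rule compact_convex_trunc[OF compact_convex_GL[OF K swap_coords_GL]])
  note [measurable] = compact_convexD(4)[OF K] compact_convexD(4)[OF D] compact_convexD(4)[OF E]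
  have slice: "(\<integral>\<^sup>+t. indicator F (z(k := t)) \<partial>lborel) = ennreal (chord k F z)"
    if F: "compact_convex (Suc k) F" for F z
  proof -
    note [measurable] = compact_convexD(4)[OF F]
    have "{t\<in>space lborel. z(k := t) \<in> F} \<in> sets lborel" by measurable
    then have "(\<integral>\<^sup>+t. indicator {t. z(k := t) \<in> F} t \<partial>lborel) = emeasure lborel {t. z(k := t) \<in> F}"
      by simp
    then show ?thesis by (simp add: emeasure_slice_eq_chord[OF F] indicator_def)
  qed
  have "ennreal (V (Suc (Suc k)) K) = (\<integral>\<^sup>+x. \<integral>\<^sup>+t. indicator K (x(Suc k := t)) \<partial>lborel \<partial>lam (Suc k))"
    using nn_integral_lam_Suc[of "indicator K" "Suc k"] compact_convexD(1)[OF K]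
    by (simp add: emeasure_lam_eq_measure)
  also have "\<dots> = (\<integral>\<^sup>+z. \<integral>\<^sup>+s. \<integral>\<^sup>+t. indicator K (z(k := s, Suc k := t)) \<partial>lborel \<partial>lborel \<partial>lam k)"
    by (rule nn_integral_lam_Suc) measurable
  also have "\<dots> \<le> (\<integral>\<^sup>+z. \<integral>\<^sup>+s. \<integral>\<^sup>+t. indicator D (z(k := s)) * indicator E (z(k := t)) \<partial>lborel \<partial>lborel \<partial>lam k)"
  proof (rule nn_integral_lam_mono, rule nn_integral_mono, rule nn_integral_mono)
    fix z s t assume z: "z \<in> Rn k"
    show "indicator K (z(k := s, Suc k := t)) \<le> (indicator D (z(k := s)) * indicator E (z(k := t)) :: ennreal)"
    proof (cases "z(k := s, Suc k := t) \<in> K")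
      case True
      have "z(k := s) = trunc (Suc k) (z(k := s, Suc k := t))"
        "z(k := t) = trunc (Suc k) (swap_coords k (z(k := s, Suc k := t)))"
        using z by (auto simp: trunc_def swap_coords_def Rn_iff fun_eq_iff)
      then have "z(k := s) \<in> D" "z(k := t) \<in> E"
        unfolding D_def E_def using True by blast+
      then show ?thesis by (simp add: indicator_def)
    qed simp
  qed
  also have "\<dots> = (\<integral>\<^sup>+z. \<integral>\<^sup>+s. indicator D (z(k := s)) * ennreal (chord k E z) \<partial>lborel \<partial>lam k)"
    using slice[OF E] by (intro nn_integral_cong) (simp add: nn_integral_cmult)
  also have "\<dots> = (\<integral>\<^sup>+z. ennreal (chord k D z) * ennreal (chord k E z) \<partial>lam k)"
    using slice[OF D] by (intro nn_integral_cong) (simp add: nn_integral_multc)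
  finally show ?thesis
    by (simp add: ennreal_mult' chord_nonneg)
qed

text \<open>Let \<open>a\<close> and \<open>b\<close> be the volumes of \<open>D\<close> and
  \<open>E\<close>, and \<open>g\<close> that of their common projection. The growth of
  \<open>D\<close> along axis \<open>k\<close> is \<open>g\<close> and that of \<open>K\<close> is
  \<open>b\<close>, so the claim reads |K| g \<le> C a b. It follows from the chord product bound by
  splitting the product into squares.\<close>

lemma V_mult_growth_last_le:
  assumes K: "body (Suc (Suc k)) K"
  defines "D \<equiv> trunc (Suc k) ` K"
  shows "V (Suc (Suc k)) K * growth (Suc k) D (unit_vec k) \<le>
    2 * real (Suc k) / (real k + 2) * (V (Suc k) D * growth (Suc (Suc k)) K (unit_vec k))"
proof -
  let ?n = "Suc (Suc k)"
  define E where "E = trunc (Suc k) ` swap_coords k ` K"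
  have D: "body (Suc k) D" unfolding D_def by (rule body_trunc[OF K])
  have E: "body (Suc k) E" unfolding E_def by (rule body_trunc[OF body_GL[OF K swap_coords_GL]])
  have G: "trunc k ` D = trunc k ` K" "trunc k ` E = trunc k ` K"
    by (simp_all add: D_def E_def image_image trunc_trunc trunc_swap_coords)
  note cK = body_compact_convex[OF K] and cD = body_compact_convex[OF D] and cE = body_compact_convex[OF E]
  note [measurable] = compact_convexD(4)[OF cD] compact_convexD(4)[OF cE]
  define C where "C = 2 * real (Suc k) / (real k + 2)"
  define a where "a = V (Suc k) D"
  define b where "b = V (Suc k) E"
  define g where "g = V k (trunc k ` K)"
  have pos: "C > 0" "a > 0" "b > 0" "g > 0"
    using V_body_pos[OF D] V_body_pos[OF E] V_body_pos[OF body_trunc[OF D]]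
    by (simp_all add: C_def a_def b_def g_def G)
  have growth_D: "growth (Suc k) D (unit_vec k) = g"
    using growth_last[OF cD, of 1] by (simp add: g_def G)
  have growth_K: "growth ?n K (unit_vec k) = b"
  proof -
    have "b = growth ?n (swap_coords k ` K) (unit_vec (Suc k))"
      using growth_last[OF compact_convex_GL[OF cK swap_coords_GL], of 1] by (simp add: b_def E_def)
    also have "\<dots> = growth ?n (swap_coords k ` K) (swap_coords k (unit_vec k))"
      by (simp add: swap_coords_unit_vec)
    also have "\<dots> = growth ?n K (unit_vec k)"
      using growth_GL[OF swap_coords_GL cK, of "unit_vec k"]
        absdet_isometry[OF swap_coords_GL vnorm_swap_coords] by simp
    finally show ?thesis ..
  qed
  \<comment> \<open>The weight that balances the two squares: each contributes C a b/(2 g).\<close>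
  define c where "c = b / a"
  have "c > 0" using pos by (simp add: c_def)
  have amgm: "x * y \<le> c / 2 * x\<^sup>2 + 1 / (2 * c) * y\<^sup>2" for x y :: real
  proof -
    have "0 \<le> (c * x - y)\<^sup>2 / (2 * c)" using \<open>c > 0\<close> by simp
    also have "\<dots> = c / 2 * x\<^sup>2 + 1 / (2 * c) * y\<^sup>2 - x * y"
      using \<open>c > 0\<close> by (simp add: power2_eq_square field_simps)
    finally show ?thesis by simp
  qed
  have "ennreal (V ?n K) \<le> (\<integral>\<^sup>+z. ennreal (chord k D z * chord k E z) \<partial>lam k)"
    using V_le_nn_integral_chord_product[OF cK] by (simp add: D_def E_def)
  also have "\<dots> \<le> (\<integral>\<^sup>+z. ennreal (c / 2) * ennreal ((chord k D z)\<^sup>2) + ennreal (1 / (2 * c)) * ennreal ((chord k E z)\<^sup>2) \<partial>lam k)"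
  proof (rule nn_integral_mono)
    fix z
    have "ennreal (chord k D z * chord k E z) \<le> ennreal (c / 2 * (chord k D z)\<^sup>2 + 1 / (2 * c) * (chord k E z)\<^sup>2)"
      by (rule ennreal_leI[OF amgm])
    also have "\<dots> = ennreal (c / 2) * ennreal ((chord k D z)\<^sup>2) + ennreal (1 / (2 * c)) * ennreal ((chord k E z)\<^sup>2)"
      using \<open>c > 0\<close> by (intro ennreal_linear_combination) auto
    finally show "ennreal (chord k D z * chord k E z) \<le>
        ennreal (c / 2) * ennreal ((chord k D z)\<^sup>2) + ennreal (1 / (2 * c)) * ennreal ((chord k E z)\<^sup>2)" .
  qed
  also have "\<dots> = ennreal (c / 2) * (\<integral>\<^sup>+z. ennreal ((chord k D z)\<^sup>2) \<partial>lam k) +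
      ennreal (1 / (2 * c)) * (\<integral>\<^sup>+z. ennreal ((chord k E z)\<^sup>2) \<partial>lam k)"
    by (simp add: nn_integral_add nn_integral_cmult)
  also have "\<dots> \<le> ennreal (c / 2) * ennreal (C * a\<^sup>2 / g) + ennreal (1 / (2 * c)) * ennreal (C * b\<^sup>2 / g)"
    using nn_integral_chord_sq_le[OF D] nn_integral_chord_sq_le[OF E]
    by (intro add_mono mult_left_mono) (simp_all only: C_def a_def b_def g_def G zero_le of_nat_mult of_nat_numeral)
  also have "\<dots> = ennreal (c / 2 * (C * a\<^sup>2 / g) + 1 / (2 * c) * (C * b\<^sup>2 / g))"
    using \<open>c > 0\<close> pos by (intro ennreal_linear_combination[symmetric]) auto
  also have "c / 2 * (C * a\<^sup>2 / g) + 1 / (2 * c) * (C * b\<^sup>2 / g) = C * (a * b) / g"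
    using pos by (simp add: c_def power2_eq_square field_simps)
  finally have "V ?n K \<le> C * (a * b) / g"
    using pos by (subst (asm) ennreal_le_iff) auto
  then have "V ?n K * g \<le> C * (a * b)"
    using pos by (simp add: pos_le_divide_eq)
  then show ?thesis
    by (simp only: growth_D growth_K C_def a_def)
qed

text \<open>The direct sum of \<open>T\<close> and the identity on axis \<open>m\<close>, made to
  commute with truncation.\<close>

definition extend_last :: "nat \<Rightarrow> (vec \<Rightarrow> vec) \<Rightarrow> vec \<Rightarrow> vec" where
  "extend_last m T x = (T (trunc m x))(m := x m)"

lemma trunc_extend_last:
  assumes "T \<in> GL m"
  shows "trunc m (extend_last m T x) = T (trunc m x)"
  using GL_in_Rn[OF assms, of "trunc m x"] by (auto simp: extend_last_def trunc_def Rn_iff fun_eq_iff)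

lemma extend_last_GL:
  assumes T: "T \<in> GL m"
  shows "extend_last m T \<in> GL (Suc m)"
proof (rule GLI[where S = "extend_last m (inv_into (Rn m) T)"])
  note S = GL_inv[OF T]
  have in_Rn: "extend_last m T x \<in> Rn (Suc m)" if "T \<in> GL m" for T x
    using GL_in_Rn[OF that, of "trunc m x"] trunc_in_Rn[of m x] by (auto simp: extend_last_def Rn_iff)
  fix x y :: vec and a :: real assume x: "x \<in> Rn (Suc m)"
  have upd: "(trunc m x)(m := x m) = x"
    using x by (auto simp: trunc_def Rn_iff fun_eq_iff)
  show "extend_last m T x \<in> Rn (Suc m)" "extend_last m (inv_into (Rn m) T) x \<in> Rn (Suc m)"
    using in_Rn T S by auto
  show "extend_last m (inv_into (Rn m) T) (extend_last m T x) = x"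
    using upd unfolding extend_last_def[of m "inv_into (Rn m) T"] trunc_extend_last[OF T]
    by (simp add: GL_inv_left[OF T]) (simp add: extend_last_def)
  show "extend_last m T (extend_last m (inv_into (Rn m) T) x) = x"
    using upd unfolding extend_last_def[of m T] trunc_extend_last[OF S]
    by (simp add: GL_inv_right[OF T]) (simp add: extend_last_def)
  show "extend_last m T (a *\<^sub>R x) = a *\<^sub>R extend_last m T x"
    by (auto simp: extend_last_def trunc_scaleR GL_scaleR[OF T] fun_eq_iff vec_apply)
  show "extend_last m T (x + y) = extend_last m T x + extend_last m T y"
    by (auto simp: extend_last_def trunc_add GL_add[OF T] fun_eq_iff vec_apply)
qed

text \<open>A map \<open>T\<close> of the hyperplane moves \<open>unit_vec k\<close> to
  \<open>u\<close>, and its extension acts compatibly on \<open>K\<close>. Both sides of the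
  inequality are multiplied by the same two determinant factors.\<close>

lemma V_mult_growth_projection_le:
  assumes K: "body (Suc (Suc k)) K" and u: "u \<in> Rn (Suc k)"
  defines "D \<equiv> trunc (Suc k) ` K"
  shows "V (Suc (Suc k)) K * growth (Suc k) D u \<le>
    2 * real (Suc k) / (real k + 2) * (V (Suc k) D * growth (Suc (Suc k)) K u)"
proof (cases "u = 0")
  case False
  let ?n = "Suc (Suc k)"
  obtain T where T: "T \<in> GL (Suc k)" "T (unit_vec k) = u"
    using exists_GL_last[OF u False] by metis
  define T' where "T' = extend_last (Suc k) T"
  have T': "T' \<in> GL ?n" unfolding T'_def by (rule extend_last_GL[OF T(1)])
  define L where "L = inv_into (Rn ?n) T' ` K"
  have L: "body ?n L" unfolding L_def by (rule body_GL[OF K GL_inv[OF T']])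
  have T'L: "T' ` L = K"
    unfolding L_def image_image
    using compact_convexD(3)[OF body_compact_convex[OF K]] GL_inv_right[OF T'] by force
  define D0 where "D0 = trunc (Suc k) ` L"
  have D0: "body (Suc k) D0" unfolding D0_def by (rule body_trunc[OF L])
  have TD0: "T ` D0 = D"
    unfolding D0_def D_def T'L[symmetric] image_image T'_def trunc_extend_last[OF T(1)] ..
  have T'u: "T' (unit_vec k) = u"
  proof -
    have "trunc (Suc k) (unit_vec k) = unit_vec k" "unit_vec k (Suc k) = 0"
      by (auto simp: trunc_def unit_vec_def fun_eq_iff)
    then have "T' (unit_vec k) = u(Suc k := 0)"
      by (simp only: T'_def extend_last_def T(2))
    also have "\<dots> = u" using u by (auto simp: Rn_iff)
    finally show ?thesis .
  qed
  have eqs: "V ?n K = absdet ?n T' * V ?n L" "V (Suc k) D = absdet (Suc k) T * V (Suc k) D0"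
    "growth (Suc k) D u = absdet (Suc k) T * growth (Suc k) D0 (unit_vec k)"
    "growth ?n K u = absdet ?n T' * growth ?n L (unit_vec k)"
    using V_GL[OF T' body_compact_convex[OF L]] V_GL[OF T(1) body_compact_convex[OF D0]]
      growth_GL[OF T' body_compact_convex[OF L], of "unit_vec k"]
      growth_GL[OF T(1) body_compact_convex[OF D0], of "unit_vec k"]
    by (simp_all add: T'L TD0 T'u T(2))
  have "absdet ?n T' * absdet (Suc k) T * (V ?n L * growth (Suc k) D0 (unit_vec k)) \<le>
      absdet ?n T' * absdet (Suc k) T * (2 * real (Suc k) / (real k + 2) * (V (Suc k) D0 * growth ?n L (unit_vec k)))"
    using V_mult_growth_last_le[OF L] unfolding D0_def
    by (intro mult_left_mono mult_nonneg_nonneg absdet_nonneg)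
  then show ?thesis
    unfolding eqs by (simp only: mult_ac)
qed simp

lemma le_of_forall_pos_limit:
  fixes f :: "real \<Rightarrow> real"
  assumes "\<And>\<eta>. 0 < \<eta> \<Longrightarrow> \<eta> < 1 \<Longrightarrow> 0 \<le> f \<eta>" "isCont f 0"
  shows "0 \<le> f 0"
proof (rule tendsto_lowerbound)
  show "(f \<longlongrightarrow> f 0) (at_right 0)"
    using assms(2) unfolding isCont_def by (rule tendsto_mono[OF at_le[OF subset_UNIV]])
  have "\<forall>\<^sub>F \<eta> in at_right (0::real). \<eta> \<in> {0<..<1}"
    by (rule eventually_at_right_real) simp
  then show "\<forall>\<^sub>F \<eta> in at_right 0. 0 \<le> f \<eta>"
    by (rule eventually_mono) (use assms(1) in auto)
qed simp

text \<open>One list of segments in the hyperplane serves both surface areas. There it approximates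
  the ball, which bounds that of \<open>D\<close> from above; in the full space the flat zonotope
  still lies in a ball of radius 1 + \<eta>, which bounds that of \<open>K\<close> from below. The
  estimate for single directions is summed in between.\<close>

lemma V_mult_surface_area_projection_le:
  assumes K: "body (Suc (Suc k)) K"
  defines "D \<equiv> trunc (Suc k) ` K"
  shows "V (Suc (Suc k)) K * surface_area (Suc k) D \<le>
    2 * real (Suc k) / (real k + 2) * (V (Suc k) D * surface_area (Suc (Suc k)) K)"
proof -
  let ?n = "Suc (Suc k)"
  have D: "body (Suc k) D" unfolding D_def by (rule body_trunc[OF K])
  define v where "v = V ?n K"
  define c where "c = 2 * real (Suc k) / (real k + 2) * V (Suc k) D"
  have pos: "v > 0" "c > 0" using V_body_pos[OF K] V_body_pos[OF D] by (simp_all add: v_def c_def)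
  let ?f = "\<lambda>\<eta>. c * surface_area ?n K * (1 + \<eta>) - v * surface_area (Suc k) D * (1 - \<eta>)"
  have f: "0 \<le> ?f \<eta>" if \<eta>: "0 < \<eta>" "\<eta> < 1" for \<eta>
  proof -
    obtain us where us: "set us \<subseteq> Rn (Suc k)"
      "\<And>v. v \<in> Rn (Suc k) \<Longrightarrow> (1 - \<eta>) * vnorm (Suc k) v \<le> (\<Sum>u\<leftarrow>us. \<bar>dot (Suc k) u v\<bar>)"
      "\<And>v. v \<in> Rn (Suc k) \<Longrightarrow> (\<Sum>u\<leftarrow>us. \<bar>dot (Suc k) u v\<bar>) \<le> (1 + \<eta>) * vnorm (Suc k) v"
      by (rule zonotope_exists[OF id_GL[of "Suc k"] \<eta>(1)]) blast
    have us': "set us \<subseteq> Rn ?n" using us(1) by (auto simp: Rn_iff)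
    \<comment> \<open>The vectors of the list vanish in the last coordinate, so \<open>v\<close> may
      be truncated, which does not increase its norm.\<close>
    have le_n: "(\<Sum>u\<leftarrow>us. \<bar>dot ?n u v\<bar>) \<le> (1 + \<eta>) * vnorm ?n v" for v
    proof -
      have "dot ?n u v = dot (Suc k) u (trunc (Suc k) v)" if "u \<in> set us" for u
      proof -
        have "u (Suc k) = 0" using us(1) that by (auto simp: Rn_iff)
        then show ?thesis by (simp add: dot_def trunc_def)
      qed
      then have "(\<Sum>u\<leftarrow>us. \<bar>dot ?n u v\<bar>) = (\<Sum>u\<leftarrow>us. \<bar>dot (Suc k) u (trunc (Suc k) v)\<bar>)"
        by (intro arg_cong[of _ _ sum_list] map_cong) auto
      also have "\<dots> \<le> (1 + \<eta>) * vnorm (Suc k) (trunc (Suc k) v)"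
        by (intro us(3)) simp
      also have "\<dots> \<le> (1 + \<eta>) * vnorm ?n v"
        using \<eta> by (intro mult_left_mono) (simp_all add: L2_set_def trunc_def)
      finally show ?thesis .
    qed
    have 1: "surface_area (Suc k) D * (1 - \<eta>) \<le> 2 * (\<Sum>u\<leftarrow>us. growth (Suc k) D u)"
      using surface_area_le[OF D us(1) _ _ us(2,3)] \<eta> by (simp add: pos_le_divide_eq)
    have 2: "2 * (\<Sum>u\<leftarrow>us. growth ?n K u) \<le> surface_area ?n K * (1 + \<eta>)"
      using surface_area_ge[OF K us' _ le_n] \<eta> by (simp add: pos_divide_le_eq)
    have 3: "v * (\<Sum>u\<leftarrow>us. growth (Suc k) D u) \<le> c * (\<Sum>u\<leftarrow>us. growth ?n K u)"
    proof -
      have "v * growth (Suc k) D u \<le> c * growth ?n K u" if "u \<in> set us" for u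
        using V_mult_growth_projection_le[OF K, of u] us(1) that
        unfolding v_def c_def D_def by (simp only: mult.assoc) blast
      then have "(\<Sum>u\<leftarrow>us. v * growth (Suc k) D u) \<le> (\<Sum>u\<leftarrow>us. c * growth ?n K u)"
        by (rule sum_list_mono)
      then show ?thesis by (simp only: sum_list_const_mult)
    qed
    have "v * (surface_area (Suc k) D * (1 - \<eta>)) \<le> v * (2 * (\<Sum>u\<leftarrow>us. growth (Suc k) D u))"
      using 1 pos by (intro mult_left_mono) auto
    also have "\<dots> \<le> c * (2 * (\<Sum>u\<leftarrow>us. growth ?n K u))"
      using 3 by simp
    also have "\<dots> \<le> c * (surface_area ?n K * (1 + \<eta>))"
      using 2 pos by (intro mult_left_mono) auto
    finally show ?thesis by (simp add: mult.assoc)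
  qed
  have "isCont ?f 0" by (intro continuous_intros)
  from le_of_forall_pos_limit[of ?f, OF f this] have "0 \<le> ?f 0" by simp
  then show ?thesis
    by (simp add: v_def c_def mult.assoc)
qed

section \<open>Hyperplane projections\<close>

lemma dot_sum_left: "dot n (\<Sum>i\<in>I. c i *\<^sub>R b i) y = (\<Sum>i\<in>I. c i * dot n (b i) y)"
  by (induction I rule: infinite_finite_induct) (simp_all add: dot_simps)

text \<open>This stands in for the dimension count by which \<open>n\<close> orthonormal vectors
  span: Bessel's inequality for the standard basis vectors is forced to be an equality.\<close>

lemma orthonormal_expansion:
  assumes b: "\<And>i. i < n \<Longrightarrow> b i \<in> Rn n"
    and orth: "\<And>i j. i < n \<Longrightarrow> j < n \<Longrightarrow> dot n (b i) (b j) = (if i = j then 1 else 0)"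
    and x: "x \<in> Rn n"
  shows "(\<Sum>i<n. dot n x (b i) *\<^sub>R b i) = x"
proof -
  define r where "r = (\<lambda>j. unit_vec j - (\<Sum>i<n. b i j *\<^sub>R b i))"
  have sq: "(vnorm n (r j))\<^sup>2 = 1 - (\<Sum>i<n. (b i j)\<^sup>2)" if "j < n" for j
  proof -
    let ?s = "\<Sum>i<n. b i j *\<^sub>R b i"
    have 1: "dot n ?s (unit_vec j) = (\<Sum>i<n. (b i j)\<^sup>2)"
      using that by (simp add: dot_sum_left dot_unit_vec power2_eq_square)
    have 2: "dot n (b i) ?s = b i j" if "i < n" for i
    proof -
      have "dot n (b i) ?s = (\<Sum>l<n. b l j * dot n (b l) (b i))"
        by (simp add: dot_commute[of n "b i"] dot_sum_left)
      also have "\<dots> = (\<Sum>l<n. if l = i then b l j else 0)"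
        using that by (intro sum.cong) (auto simp: orth)
      finally show ?thesis using that by simp
    qed
    have 3: "dot n ?s ?s = (\<Sum>i<n. (b i j)\<^sup>2)"
      by (subst dot_sum_left) (simp add: 2 power2_eq_square)
    have 4: "dot n (unit_vec j) (unit_vec j) = 1"
      using that by (simp add: dot_unit_vec) (simp add: unit_vec_def)
    show ?thesis
      unfolding dot_self[symmetric] r_def
      using 1 3 4 dot_commute[of n ?s "unit_vec j"] by (simp add: dot_simps)
  qed
  text \<open>Summing over \<open>j\<close>, the total squared length of the residuals is \<open>n - n = 0\<close>.\<close>
  have "(\<Sum>j<n. (vnorm n (r j))\<^sup>2) = n - (\<Sum>j<n. \<Sum>i<n. (b i j)\<^sup>2)"
    by (simp add: sq sum_subtractf)
  also have "(\<Sum>j<n. \<Sum>i<n. (b i j)\<^sup>2) = (\<Sum>i<n. \<Sum>j<n. (b i j)\<^sup>2)"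
    by (rule sum.swap)
  also have "\<dots> = (\<Sum>i<n. dot n (b i) (b i))"
    by (simp add: dot_def power2_eq_square)
  also have "\<dots> = n"
    by (simp add: orth)
  finally have "(\<Sum>j<n. (vnorm n (r j))\<^sup>2) = 0" by simp
  then have "vnorm n (r j) = 0" if "j < n" for j
    using that by (subst (asm) sum_nonneg_eq_0_iff) auto
  moreover have "r j \<in> Rn n" if "j < n" for j
    unfolding r_def using b that
    by (intro subspace_diff[OF subspace_Rn] subspace_sum[OF subspace_Rn] subspace_scale[OF subspace_Rn]) auto
  ultimately have "r j = 0" if "j < n" for j
    using vnorm_pos[of "r j" n] that by fastforce
  then have e: "unit_vec j = (\<Sum>i<n. b i j *\<^sub>R b i)" if "j < n" for j
    using that by (simp add: r_def)
  have "x = (\<Sum>j<n. x j *\<^sub>R unit_vec j)"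
    using x trunc_id trunc_eq_sum by metis
  also have "\<dots> = (\<Sum>j<n. \<Sum>i<n. (x j * b i j) *\<^sub>R b i)"
    by (simp add: e scaleR_sum_right)
  also have "\<dots> = (\<Sum>i<n. \<Sum>j<n. (x j * b i j) *\<^sub>R b i)"
    by (rule sum.swap)
  also have "\<dots> = (\<Sum>i<n. dot n x (b i) *\<^sub>R b i)"
    by (simp add: dot_def scaleR_sum_left)
  finally show ?thesis ..
qed

definition coords :: "nat \<Rightarrow> (nat \<Rightarrow> vec) \<Rightarrow> vec \<Rightarrow> vec" where
  "coords n b x = (\<lambda>i. if i < n then dot n x (b i) else 0)"

lemma
  assumes b: "\<And>i. i < n \<Longrightarrow> b i \<in> Rn n"
    and orth: "\<And>i j. i < n \<Longrightarrow> j < n \<Longrightarrow> dot n (b i) (b j) = (if i = j then 1 else 0)"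
  shows coords_GL: "coords n b \<in> GL n"
    and vnorm_coords: "x \<in> Rn n \<Longrightarrow> vnorm n (coords n b x) = vnorm n x"
proof -
  let ?Q = "\<lambda>y. \<Sum>i<n. y i *\<^sub>R b i"
  have in_Rn: "coords n b x \<in> Rn n" for x
    by (simp add: coords_def Rn_iff)
  have QR: "?Q (coords n b x) = x" if "x \<in> Rn n" for x
  proof -
    have "?Q (coords n b x) = (\<Sum>i<n. dot n x (b i) *\<^sub>R b i)"
      by (intro sum.cong) (auto simp: coords_def)
    then show ?thesis
      using orthonormal_expansion[OF b orth that] by simp
  qed
  have dot_Q: "dot n (?Q y) (b j) = y j" if "j < n" for y j
  proof -
    have "dot n (?Q y) (b j) = (\<Sum>i<n. y i * dot n (b i) (b j))"
      by (rule dot_sum_left)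
    also have "\<dots> = (\<Sum>i<n. if i = j then y i else 0)"
      using that by (intro sum.cong) (auto simp: orth)
    finally show ?thesis using that by simp
  qed
  show "coords n b \<in> GL n"
  proof (rule GLI[where S = ?Q])
    show "coords n b x \<in> Rn n" for x by (rule in_Rn)
    show "?Q x \<in> Rn n" for x
      using b by (intro subspace_sum[OF subspace_Rn] subspace_scale[OF subspace_Rn]) auto
    show "?Q (coords n b x) = x" if "x \<in> Rn n" for x by (rule QR[OF that])
    show "coords n b (?Q x) = x" if "x \<in> Rn n" for x
      using that by (auto simp: coords_def dot_Q Rn_iff fun_eq_iff)
    show "coords n b (x + y) = coords n b x + coords n b y" for x y
      by (auto simp: coords_def dot_simps vec_apply fun_eq_iff)
    show "coords n b (a *\<^sub>R x) = a *\<^sub>R coords n b x" for a x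
      by (auto simp: coords_def dot_simps vec_apply fun_eq_iff)
  qed
  show "vnorm n (coords n b x) = vnorm n x" if x: "x \<in> Rn n"
  proof (rule vnorm_eqI)
    have "dot n x x = dot n (?Q (coords n b x)) x"
      using QR[OF x] by simp
    also have "\<dots> = (\<Sum>i<n. coords n b x i * dot n (b i) x)"
      by (rule dot_sum_left)
    also have "\<dots> = dot n (coords n b x) (coords n b x)"
      unfolding dot_def[of n "coords n b x" "coords n b x"]
      by (intro sum.cong) (simp_all add: coords_def dot_commute)
    finally show "dot n (coords n b x) (coords n b x) = dot n x x" ..
  qed
qed

text \<open>An isometry preserves the unit ball, hence commutes with forming parallel bodies, and it
  preserves volume.\<close>

lemma surface_area_isometry:
  assumes T: "T \<in> GL n" and iso: "\<And>x. x \<in> Rn n \<Longrightarrow> vnorm n (T x) = vnorm n x" and K: "compact_convex n K"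
  shows "surface_area n (T ` K) = surface_area n K"
proof -
  have B: "T b \<in> unit_ball n \<longleftrightarrow> b \<in> unit_ball n" if "b \<in> Rn n" for b
    using that by (simp add: unit_ball_iff iso GL_in_Rn[OF T])
  have "parallel_body n (T ` K) \<epsilon> = T ` parallel_body n K \<epsilon>" for \<epsilon>
  proof (intro equalityI subsetI)
    fix y assume "y \<in> parallel_body n (T ` K) \<epsilon>"
    then obtain a b where ab: "a \<in> K" "b \<in> unit_ball n" "y = T a + \<epsilon> *\<^sub>R b"
      unfolding parallel_body_eq by blast
    define b' where "b' = inv_into (Rn n) T b"
    have b': "b' \<in> Rn n" "T b' = b"
      using ab(2) GL_in_Rn[OF GL_inv[OF T]] GL_inv_right[OF T] by (auto simp: b'_def unit_ball_iff)
    have "y = T (a + \<epsilon> *\<^sub>R b')"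
      using ab b' compact_convexD(3)[OF K]
      by (subst GL_add[OF T]) (auto simp: GL_scaleR[OF T] intro: subspace_scale[OF subspace_Rn])
    moreover have "b' \<in> unit_ball n" using B[OF b'(1)] b'(2) ab(2) by simp
    ultimately show "y \<in> T ` parallel_body n K \<epsilon>"
      unfolding parallel_body_eq using ab(1) by blast
  next
    fix y assume "y \<in> T ` parallel_body n K \<epsilon>"
    then obtain a b where ab: "a \<in> K" "b \<in> unit_ball n" "y = T (a + \<epsilon> *\<^sub>R b)"
      unfolding parallel_body_eq by blast
    have b: "b \<in> Rn n" using ab(2) by (simp add: unit_ball_iff)
    have "y = T a + \<epsilon> *\<^sub>R T b"
      using ab b compact_convexD(3)[OF K]
      by (simp only:) (subst GL_add[OF T], auto simp: GL_scaleR[OF T] intro: subspace_scale[OF subspace_Rn])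
    then show "y \<in> parallel_body n (T ` K) \<epsilon>"
      unfolding parallel_body_eq using ab B[OF b] by blast
  qed
  moreover have "vol n (T ` A) = vol n A" if "compact A" "A \<subseteq> Rn n" for A
    using that compact_GL[OF T that] measure_lam_GL[OF T compact_borel[OF that(1)] that(2)] absdet_isometry[OF T iso] GL_in_Rn[OF T]
    by (subst (1 2) vol_eq_lam) (auto simp: compact_borel)
  ultimately have "surface_quotient n (T ` K) = surface_quotient n K"
    using compact_parallel_body[OF K] compact_convexD[OF K] by (simp add: fun_eq_iff)
  then show ?thesis unfolding surface_area_def by simp
qed

lemma exists_orthonormal_basis_perp:
  assumes "\<xi> \<in> unit_sphere (Suc m)"
  shows "\<exists>u. orthonormal_basis_perp (Suc m) \<xi> u"
proof -
  obtain H where H: "H \<in> GL (Suc m)" "H (unit_vec m) = \<xi>" "\<And>x y. dot (Suc m) (H x) (H y) = dot (Suc m) x y"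
    using exists_isometry_last[of \<xi> m] assms unfolding unit_sphere_def by blast
  have "orthonormal_basis_perp (Suc m) \<xi> (\<lambda>i. H (unit_vec i))"
    unfolding orthonormal_basis_perp_def H(2)[symmetric] H(3)
    using GL_in_Rn[OF H(1)] by (auto simp: dot_unit_vec) (auto simp: unit_vec_def)
  then show ?thesis by blast
qed

text \<open>\<open>perp_coords\<close> uses an unspecified basis of the hyperplane. Completing this
  very basis by \<open>\<xi>\<close> as last vector gives an isometry \<open>R\<close>, in whose
  coordinates the projection becomes truncation; the arbitrary choice is absorbed into
  \<open>R\<close>.\<close>

lemma exists_coords_perp:
  assumes \<xi>: "\<xi> \<in> unit_sphere (Suc m)"
  obtains R where "R \<in> GL (Suc m)" "\<And>x. x \<in> Rn (Suc m) \<Longrightarrow> vnorm (Suc m) (R x) = vnorm (Suc m) x"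
    "R \<xi> = unit_vec m"
    "\<And>K. K \<subseteq> Rn (Suc m) \<Longrightarrow> perp_coords (Suc m) \<xi> ` proj_perp (Suc m) \<xi> ` K = trunc m ` R ` K"
proof -
  let ?n = "Suc m"
  define u where "u = (SOME u. orthonormal_basis_perp ?n \<xi> u)"
  have u: "orthonormal_basis_perp ?n \<xi> u"
    unfolding u_def by (rule someI_ex[OF exists_orthonormal_basis_perp[OF \<xi>]])
  have \<xi>': "\<xi> \<in> Rn ?n" "dot ?n \<xi> \<xi> = 1"
    using \<xi> by (auto simp: unit_sphere_def dot_self)
  define b where "b = (\<lambda>i. if i < m then u i else \<xi>)"
  have b: "b i \<in> Rn ?n" if "i < ?n" for i
    using u \<xi>' by (auto simp: b_def orthonormal_basis_perp_def)
  have orth: "dot ?n (b i) (b j) = (if i = j then 1 else 0)" if "i < ?n" "j < ?n" for i j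
  proof -
    have "dot ?n (u l) \<xi> = 0" "dot ?n \<xi> (u l) = 0" if "l < m" for l
      using u that dot_commute[of ?n \<xi> "u l"] by (auto simp: orthonormal_basis_perp_def)
    moreover have "dot ?n (u i) (u j) = (if i = j then 1 else 0)" if "i < m" "j < m"
      using u that by (auto simp: orthonormal_basis_perp_def)
    ultimately show ?thesis
      using that \<xi>'(2) by (auto simp: b_def less_Suc_eq)
  qed
  show ?thesis
  proof (rule that[of "coords ?n b"])
    show "coords ?n b \<in> GL ?n" by (rule coords_GL[OF b orth])
    show "vnorm ?n (coords ?n b x) = vnorm ?n x" if "x \<in> Rn ?n" for x
      by (rule vnorm_coords[OF b orth that])
    show "coords ?n b \<xi> = unit_vec m"
    proof
      fix i
      have "\<xi> = b m" by (simp add: b_def)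
      then show "coords ?n b \<xi> i = unit_vec m i"
        using orth[of m i] by (auto simp: coords_def unit_vec_def)
    qed
    fix K :: "vec set"
    have "perp_coords ?n \<xi> (proj_perp ?n \<xi> x) = trunc m (coords ?n b x)" for x
    proof
      fix i
      show "perp_coords ?n \<xi> (proj_perp ?n \<xi> x) i = trunc m (coords ?n b x) i"
      proof (cases "i < m")
        case True
        have p: "proj_perp ?n \<xi> x = x - dot ?n x \<xi> *\<^sub>R \<xi>"
          by (simp add: proj_perp_def fun_eq_iff vec_apply)
        have "dot ?n \<xi> (u i) = 0"
          using u True dot_commute[of ?n \<xi> "u i"] by (simp add: orthonormal_basis_perp_def)
        then have "dot ?n (proj_perp ?n \<xi> x) (u i) = dot ?n x (u i)"
          unfolding p by (simp add: dot_simps)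
        then show ?thesis
          using True by (simp add: perp_coords_def u_def[symmetric] trunc_def coords_def b_def)
      qed (simp add: perp_coords_def Let_def trunc_def)
    qed
    then show "perp_coords ?n \<xi> ` proj_perp ?n \<xi> ` K = trunc m ` coords ?n b ` K"
      by (simp add: image_image)
  qed
qed

text \<open>After the rotation \<open>R\<close> that takes \<open>\<xi>\<close> to the last axis,
  the projection is a truncation. Its volume is the growth along the last unit vector, which
  \<open>R\<close> carries back to \<open>growth n K \<xi>\<close>.\<close>

lemma
  assumes K: "body (Suc (Suc k)) K" and \<xi>: "\<xi> \<in> unit_sphere (Suc (Suc k))"
  defines "n \<equiv> Suc (Suc k)"
  shows V_mult_surface_area_perp_le: "V n K * surface_area_perp n \<xi> (proj_perp n \<xi> ` K) \<le>
      2 * real (Suc k) / (real k + 2) * (growth n K \<xi> * surface_area n K)"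
    and surface_area_perp_nonneg: "surface_area_perp n \<xi> (proj_perp n \<xi> ` K) \<ge> 0"
proof -
  note cK = body_compact_convex[OF K]
  obtain R where R: "R \<in> GL n" "\<And>x. x \<in> Rn n \<Longrightarrow> vnorm n (R x) = vnorm n x" "R \<xi> = unit_vec (Suc k)"
    "\<And>K. K \<subseteq> Rn n \<Longrightarrow> perp_coords n \<xi> ` proj_perp n \<xi> ` K = trunc (Suc k) ` R ` K"
    using exists_coords_perp[OF \<xi>] unfolding n_def by metis
  have RK: "body n (R ` K)" using body_GL[OF K] R(1) by (simp add: n_def)
  have det: "absdet n R = 1" by (rule absdet_isometry[OF R(1,2)])
  have S: "surface_area_perp n \<xi> (proj_perp n \<xi> ` K) = surface_area (Suc k) (trunc (Suc k) ` R ` K)"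
    using R(4)[of K] compact_convexD(3)[OF cK] by (simp add: surface_area_perp_def n_def)
  have D: "body (Suc k) (trunc (Suc k) ` R ` K)"
    using RK unfolding n_def by (rule body_trunc)
  show "surface_area_perp n \<xi> (proj_perp n \<xi> ` K) \<ge> 0"
    unfolding S by (rule surface_area_nonneg[OF D])
  have "V (Suc k) (trunc (Suc k) ` R ` K) = growth n (R ` K) (R \<xi>)"
    using growth_last[of "Suc k" "R ` K" 1] body_compact_convex[OF RK] by (simp add: R(3) n_def)
  also have "\<dots> = growth n K \<xi>"
    using growth_GL[OF R(1), of K \<xi>] cK \<xi> det by (simp add: n_def unit_sphere_def)
  finally have 1: "V (Suc k) (trunc (Suc k) ` R ` K) = growth n K \<xi>" .
  have 2: "V n (R ` K) = V n K" using V_GL[OF R(1), of K] cK det by (simp add: n_def)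
  have 3: "surface_area n (R ` K) = surface_area n K"
    using surface_area_isometry[OF R(1,2)] cK by (simp add: n_def)
  show "V n K * surface_area_perp n \<xi> (proj_perp n \<xi> ` K) \<le>
      2 * real (Suc k) / (real k + 2) * (growth n K \<xi> * surface_area n K)"
    using V_mult_surface_area_projection_le[of k "R ` K"] RK unfolding S n_def[symmetric] 1 2 3 by blast
qed

section \<open>The minimal surface area parameter\<close>

lemma absdet_inv:
  assumes T: "T \<in> GL n"
  shows "absdet n (inv_into (Rn n) T) * absdet n T = 1"
proof -
  let ?B = "unit_ball n"
  have "inv_into (Rn n) T ` T ` ?B = ?B"
    using GL_inv_left[OF T] unit_ball_subset_Rn[of n] by (force simp: image_image)
  moreover have "T ` ?B \<in> sets borel" "T ` ?B \<subseteq> Rn n"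
    using borel_GL[OF T _ unit_ball_subset_Rn] GL_in_Rn[OF T] unit_ball_subset_Rn[of n] by auto
  ultimately have "V n ?B = absdet n (inv_into (Rn n) T) * V n (T ` ?B)"
    using measure_lam_GL[OF GL_inv[OF T], of "T ` ?B"] by simp
  then have "V n ?B = absdet n (inv_into (Rn n) T) * absdet n T * V n ?B"
    using measure_lam_GL[OF T _ unit_ball_subset_Rn] by simp
  then show ?thesis by (simp add: V_unit_ball)
qed

text \<open>With \<open>A\<close> the inverse of \<open>T\<close> and \<delta> the determinant
  factor of \<open>T\<close>, the growth of the image along u is \<delta> times that of
  \<open>K\<close> along \<open>A u\<close>, hence at least \<delta> M |A u|. The zonotope built for
  this \<open>A\<close> makes the sum of the |A u| nearly \<delta>^(-1/n) n \<omega>_n/(2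
  \<omega>_{n-1}) or larger, and the exponents combine to 1 - 1/n.\<close>

lemma surface_area_GL_ge:
  assumes K: "body (Suc m) K" and T: "T \<in> GL (Suc m)" and "M \<ge> 0"
    and M: "\<And>\<xi>. \<xi> \<in> unit_sphere (Suc m) \<Longrightarrow> M \<le> growth (Suc m) K \<xi>"
  shows "absdet (Suc m) T powr (m / Suc m) * M * (Suc m * unit_ball_vol (Suc m) / unit_ball_vol m)
    \<le> surface_area (Suc m) (T ` K)"
proof -
  let ?n = "Suc m"
  note cK = body_compact_convex[OF K]
  define A where "A = inv_into (Rn ?n) T"
  have A: "A \<in> GL ?n" unfolding A_def by (rule GL_inv[OF T])
  define \<delta> where "\<delta> = absdet ?n T"
  have "\<delta> > 0" unfolding \<delta>_def by (rule absdet_pos[OF T])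
  have detA: "absdet ?n A = 1 / \<delta>"
    using absdet_inv[OF T] \<open>\<delta> > 0\<close> by (simp add: A_def \<delta>_def field_simps)
  have TK: "body ?n (T ` K)" by (rule body_GL[OF K T])
  have growth_ge: "M * vnorm ?n v \<le> growth ?n K v" if v: "v \<in> Rn ?n" for v
  proof (cases "v = 0")
    case False
    have pos: "vnorm ?n v > 0" by (rule vnorm_pos[OF v False])
    define \<xi> where "\<xi> = (1 / vnorm ?n v) *\<^sub>R v"
    have \<xi>: "\<xi> \<in> Rn ?n" unfolding \<xi>_def using v by (rule subspace_scale[OF subspace_Rn])
    then have "\<xi> \<in> unit_sphere ?n" using pos by (simp add: unit_sphere_def \<xi>_def vnorm_scaleR)
    then have "M * vnorm ?n v \<le> vnorm ?n v * growth ?n K \<xi>"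
      using M[of \<xi>] pos by (simp add: mult.commute)
    also have "\<dots> = growth ?n K (vnorm ?n v *\<^sub>R \<xi>)"
      using growth_scaleR[OF cK \<xi>] pos by simp
    also have "vnorm ?n v *\<^sub>R \<xi> = v" using pos by (simp add: \<xi>_def)
    finally show ?thesis .
  qed simp
  define c where "c = (1 / \<delta>) powr (1 / ?n) * (?n * unit_ball_vol ?n / (2 * unit_ball_vol m))"
  let ?f = "\<lambda>\<eta>. surface_area ?n (T ` K) * (1 + \<eta>) - 2 * \<delta> * M * (c - \<eta>)"
  have f: "0 \<le> ?f \<eta>" if \<eta>: "0 < \<eta>" "\<eta> < 1" for \<eta>
  proof -
    obtain us where us: "set us \<subseteq> Rn ?n"
      "\<And>v. v \<in> Rn ?n \<Longrightarrow> (\<Sum>u\<leftarrow>us. \<bar>dot ?n u v\<bar>) \<le> (1 + \<eta>) * vnorm ?n v"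
      "c - \<eta> \<le> (\<Sum>u\<leftarrow>us. vnorm ?n (A u))"
      unfolding c_def detA[symmetric] by (rule zonotope_exists[OF A \<eta>(1)]) blast
    have "\<delta> * M * vnorm ?n (A u) \<le> growth ?n (T ` K) u" if "u \<in> set us" for u
    proof -
      have u: "u \<in> Rn ?n" using us(1) that by blast
      have "\<delta> * (M * vnorm ?n (A u)) \<le> \<delta> * growth ?n K (A u)"
        using \<open>\<delta> > 0\<close> growth_ge[OF GL_in_Rn[OF A u]] by (intro mult_left_mono) auto
      also have "\<dots> = growth ?n (T ` K) (T (A u))"
        using growth_GL[OF T cK GL_in_Rn[OF A u]] by (simp add: \<delta>_def)
      also have "T (A u) = u" unfolding A_def by (rule GL_inv_right[OF T u])
      finally show ?thesis by simp
    qed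
    then have "(\<Sum>u\<leftarrow>us. \<delta> * M * vnorm ?n (A u)) \<le> (\<Sum>u\<leftarrow>us. growth ?n (T ` K) u)"
      by (rule sum_list_mono)
    moreover have "\<delta> * M * (c - \<eta>) \<le> \<delta> * M * (\<Sum>u\<leftarrow>us. vnorm ?n (A u))"
      using us(3) \<open>\<delta> > 0\<close> \<open>M \<ge> 0\<close> by (intro mult_left_mono) auto
    moreover have "2 * (\<Sum>u\<leftarrow>us. growth ?n (T ` K) u) \<le> surface_area ?n (T ` K) * (1 + \<eta>)"
      using surface_area_ge[OF TK us(1) _ us(2)] \<eta> by (simp add: pos_divide_le_eq)
    ultimately show ?thesis by (simp add: sum_list_const_mult)
  qed
  have "isCont ?f 0" by (intro continuous_intros)
  from le_of_forall_pos_limit[of ?f, OF f this] have "2 * \<delta> * M * c \<le> surface_area ?n (T ` K)" by simp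
  moreover have "2 * \<delta> * M * c = \<delta> powr (m / ?n) * M * (?n * unit_ball_vol ?n / unit_ball_vol m)"
  proof -
    have "\<delta> * (1 / \<delta>) powr (1 / ?n) = \<delta> powr 1 * \<delta> powr (- (1 / ?n))"
      using \<open>\<delta> > 0\<close> by (simp add: powr_divide powr_minus_divide)
    also have "\<dots> = \<delta> powr (1 + - (1 / ?n))" by (rule powr_add[symmetric])
    also have "1 + - (1 / ?n) = m / ?n" by (simp add: field_simps)
    finally show ?thesis by (simp add: c_def)
  qed
  ultimately show ?thesis by (simp add: \<delta>_def)
qed

text \<open>By log-convexity Gamma(x + 1/2) is at most the geometric mean of Gamma(x) and Gamma(x +
  1) = x Gamma(x), that is sqrt(x) Gamma(x). With x = m/2 + 1 the two volumes involve Gamma(x) and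
  Gamma(x + 1/2).\<close>

lemma unit_ball_vol_ratio_le: "unit_ball_vol (real m) \<le> sqrt (Suc m) * unit_ball_vol (Suc m)"
proof -
  define x where "x = (real m + 2) / 2"
  have x: "x > 0" by (simp add: x_def)
  have "ln (Gamma (x + 1 / 2)) \<le> (1 - 1 / 2) * ln (Gamma x) + 1 / 2 * ln (Gamma (x + 1))"
  proof -
    have "x / 2 + (1 + x) / 2 = x + 1 / 2" by (simp add: field_simps)
    then show ?thesis
      using convex_onD[OF log_convex_Gamma_real, of "1/2" x "x + 1"] x by (simp add: algebra_simps)
  qed
  also have "Gamma (x + 1) = x * Gamma x" using x Gamma_plus1[of x] nonpos_Ints_nonpos[of x] by linarith
  also have "(1 - 1 / 2) * ln (Gamma x) + 1 / 2 * ln (x * Gamma x) = ln (sqrt x * Gamma x)"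
    using x Gamma_real_pos[of x] by (simp add: ln_mult ln_sqrt add_divide_distrib)
  finally have G: "Gamma (x + 1 / 2) \<le> sqrt x * Gamma x"
    using x by (subst (asm) ln_le_cancel_iff) (auto intro: Gamma_real_pos)
  have pos: "Gamma x > 0" "Gamma (x + 1 / 2) > 0" using x by (auto intro: Gamma_real_pos)
  have v: "unit_ball_vol (real m) = pi powr (m / 2) / Gamma x"
    "unit_ball_vol (Suc m) = pi powr (m / 2) * sqrt pi / Gamma (x + 1 / 2)"
    by (simp_all add: unit_ball_vol_def x_def add_divide_distrib powr_add powr_half_sqrt add_ac)
  have "1 * Gamma (x + 1 / 2) \<le> sqrt (Suc m) * sqrt pi * Gamma x"
  proof -
    have "x \<le> Suc m * pi"
    proof -
      have "x \<le> real (Suc m) * 1" by (simp add: x_def)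
      also have "\<dots> \<le> Suc m * pi" using pi_ge_two by (intro mult_left_mono) auto
      finally show ?thesis .
    qed
    then have "sqrt x \<le> sqrt (Suc m) * sqrt pi"
      by (simp add: real_sqrt_mult[symmetric] del: of_nat_Suc)
    then have "sqrt x * Gamma x \<le> sqrt (Suc m) * sqrt pi * Gamma x"
      using pos by (intro mult_right_mono) auto
    then show ?thesis using G by simp
  qed
  then have "1 / Gamma x \<le> sqrt (Suc m) * (sqrt pi / Gamma (x + 1 / 2))"
    using pos by (simp add: field_simps)
  then have "pi powr (m / 2) * (1 / Gamma x) \<le> pi powr (m / 2) * (sqrt (Suc m) * (sqrt pi / Gamma (x + 1 / 2)))"
    by (intro mult_left_mono) auto
  then show ?thesis unfolding v by (simp add: mult_ac)
qed

text \<open>The bound for the surface area of the image and the normalizing power of its volume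
  carry the same power of the determinant, so the quotient is bounded below uniformly in
  \<open>T\<close>.\<close>

lemma min_surface_param_ge:
  assumes K: "body (Suc m) K" and "M \<ge> 0"
    and M: "\<And>\<xi>. \<xi> \<in> unit_sphere (Suc m) \<Longrightarrow> M \<le> growth (Suc m) K \<xi>"
  shows "M * (Suc m * unit_ball_vol (Suc m) / unit_ball_vol m) / V (Suc m) K powr (m / Suc m)
    \<le> min_surface_param (Suc m) K"
  unfolding min_surface_param_def
proof (rule cINF_greatest)
  let ?n = "Suc m"
  show "GL ?n \<noteq> {}" using id_GL by blast
  fix T assume T: "T \<in> GL ?n"
  note cK = body_compact_convex[OF K]
  have TK: "compact_convex ?n (T ` K)" by (rule compact_convex_GL[OF cK T])
  have e: "(real ?n - 1) / real ?n = m / ?n" by simp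
  have pos: "absdet ?n T > 0" "V ?n K > 0" using absdet_pos[OF T] V_body_pos[OF K] by auto
  have v: "vol ?n (T ` K) powr ((real ?n - 1) / real ?n) = absdet ?n T powr (m / ?n) * V ?n K powr (m / ?n)"
    using pos unfolding e by (simp add: vol_eq_V[OF TK] V_GL[OF T cK] powr_mult)
  have "M * (Suc m * unit_ball_vol (Suc m) / unit_ball_vol m) / V ?n K powr (m / ?n) =
      absdet ?n T powr (m / ?n) * M * (Suc m * unit_ball_vol (Suc m) / unit_ball_vol m) /
        (absdet ?n T powr (m / ?n) * V ?n K powr (m / ?n))"
    using pos by (simp del: of_nat_Suc)
  also have "\<dots> \<le> surface_area ?n (T ` K) / (absdet ?n T powr (m / ?n) * V ?n K powr (m / ?n))"
    using surface_area_GL_ge[OF K T \<open>M \<ge> 0\<close> M] by (intro divide_right_mono) auto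
  finally show "M * (Suc m * unit_ball_vol (Suc m) / unit_ball_vol m) / V ?n K powr (m / ?n)
      \<le> surface_area ?n (T ` K) / vol ?n (T ` K) powr ((real ?n - 1) / real ?n)"
    unfolding v .
qed

text \<open>The exponents (n-1)/n and 1/n of \<omega>_n add up to 1. The right-hand side is the
  product of the constants from the projection estimate and from the bound on the minimal
  projection.\<close>

lemma two_b_const_eq:
  "2 * b_const (Suc m) / (Suc m * unit_ball_vol (Suc m) powr (1 / Suc m)) =
     2 * m / Suc m * (unit_ball_vol m / (Suc m * unit_ball_vol (Suc m)))"
proof -
  let ?n = "real (Suc m)" and ?w = "unit_ball_vol (Suc m)"
  have "?w powr ((?n - 1) / ?n) * ?w powr (1 / ?n) = ?w powr ((?n - 1) / ?n + 1 / ?n)"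
    by (rule powr_add[symmetric])
  also have "(?n - 1) / ?n + 1 / ?n = 1" by (simp add: field_simps)
  finally have w: "?w powr ((?n - 1) / ?n) * ?w powr (1 / ?n) = ?w" by simp
  have "2 * b_const (Suc m) / (?n * ?w powr (1 / ?n)) =
      2 * (?n - 1) * unit_ball_vol (?n - 1) / (?n * ?n * (?w powr ((?n - 1) / ?n) * ?w powr (1 / ?n)))"
    unfolding b_const_def by (simp add: mult_ac del: of_nat_Suc)
  also have "\<dots> = 2 * (?n - 1) * unit_ball_vol (?n - 1) / (?n * ?n * ?w)"
    by (simp only: w)
  finally show ?thesis by (simp add: mult_ac)
qed

theorem theorem1p1:
  shows "\<exists>c1::real. c1 > 0 \<and> (\<forall>n::nat. n \<ge> 2 \<longrightarrow> (\<forall>K. convex_body n K \<longrightarrow>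
    vol n K powr (1 / real n) *
      (INF \<xi>\<in>unit_sphere n. surface_area_perp n \<xi> (proj_perp n \<xi> ` K))
    \<le> 2 * b_const n * min_surface_param n K / (real n * unit_ball_vol (real n) powr (1 / real n))
      * surface_area n K
    \<and> 2 * b_const n * min_surface_param n K / (real n * unit_ball_vol (real n) powr (1 / real n))
      * surface_area n K
    \<le> c1 * min_surface_param n K / sqrt (real n) * surface_area n K))"
\<comment> \<open>The constant 2 bounds \<open>C\<close> = 2(n-1)/n, while \<open>W\<close> is at
  most 1/sqrt(n).\<close>
proof (intro exI[of _ 2] conjI allI impI)
  show "(0::real) < 2" by simp
  fix n K assume "n \<ge> 2" and "convex_body n K"
  then have K: "body n K" by (intro convex_body_imp_body)
  obtain k where n: "n = Suc (Suc k)"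
    using \<open>n \<ge> 2\<close> by (metis Suc_le_D numeral_2_eq_2 Suc_le_mono)
  note Kn = K[unfolded n]
  note cK = body_compact_convex[OF K]
  define S where "S = surface_area n K"
  define P where "P = (INF \<xi>\<in>unit_sphere n. surface_area_perp n \<xi> (proj_perp n \<xi> ` K))"
  define M where "M = (INF \<xi>\<in>unit_sphere n. growth n K \<xi>)"
  define v where "v = V n K"
  define d where "d = min_surface_param n K"
  define C where "C = 2 * real (Suc k) / (real k + 2)"
  define W where "W = unit_ball_vol (Suc k) / (n * unit_ball_vol n)"
  have "v > 0" "S \<ge> 0" "C > 0" "W > 0"
    using V_body_pos[OF K] surface_area_nonneg[OF Kn] n by (simp_all add: v_def S_def C_def W_def)
  have sphere: "unit_sphere n \<noteq> {}"
  proof -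
    have "(vnorm n (unit_vec 0))\<^sup>2 = 1\<^sup>2"
      using n by (simp add: dot_self[symmetric] dot_unit_vec) (simp add: unit_vec_def)
    then have "vnorm n (unit_vec 0) = 1"
      by (rule power2_eq_imp_eq) (simp_all add: L2_set_nonneg)
    then have "unit_vec 0 \<in> unit_sphere n" using n by (simp add: unit_sphere_def)
    then show ?thesis by blast
  qed
  have growth0: "0 \<le> growth n K \<xi>" if "\<xi> \<in> unit_sphere n" for \<xi>
    using growth_nonneg[OF cK] that by (simp add: unit_sphere_def)
  have "M \<ge> 0" unfolding M_def using growth0 sphere by (intro cINF_greatest)
  have M_le: "M \<le> growth n K \<xi>" if "\<xi> \<in> unit_sphere n" for \<xi>
    unfolding M_def using growth0 that by (intro cINF_lower bdd_belowI2) auto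
  have P_le: "v * P \<le> C * S * growth n K \<xi>" if \<xi>: "\<xi> \<in> unit_sphere n" for \<xi>
  proof -
    have "P \<le> surface_area_perp n \<xi> (proj_perp n \<xi> ` K)"
      unfolding P_def using surface_area_perp_nonneg[OF Kn] \<xi> by (intro cINF_lower bdd_belowI2) (auto simp: n)
    then have "v * P \<le> v * surface_area_perp n \<xi> (proj_perp n \<xi> ` K)"
      using \<open>v > 0\<close> by (intro mult_left_mono) auto
    also have "\<dots> \<le> C * (growth n K \<xi> * S)"
      using V_mult_surface_area_perp_le[OF Kn] \<xi> unfolding v_def C_def S_def n by blast
    finally show ?thesis by (simp add: mult_ac)
  qed
  \<comment> \<open>\<open>P_le\<close> holds in every direction, so the growth may be replaced by
    its infimum. Dividing by \<open>C * S\<close> needs it nonzero; otherwise the bound does not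
    depend on the direction.\<close>
  have A: "v * P \<le> C * S * M"
  proof (cases "C * S = 0")
    case True
    then show ?thesis using P_le sphere by fastforce
  next
    case False
    then have CS: "C * S > 0" using \<open>C > 0\<close> \<open>S \<ge> 0\<close> by (simp add: less_le)
    have "v * P / (C * S) \<le> M"
      unfolding M_def using P_le CS by (intro cINF_greatest sphere) (simp add: pos_divide_le_eq mult.commute)
    then show ?thesis using CS by (simp add: pos_divide_le_eq mult.commute)
  qed
  have B: "M / (W * v powr (Suc k / n)) \<le> d"
    using min_surface_param_ge[OF Kn \<open>M \<ge> 0\<close>] M_le unfolding W_def d_def v_def n by (simp add: mult_ac)
  define r where "r = v powr (Suc k / n)"
  define q where "q = v powr (1 / n)"
  have "r > 0" "q > 0" using \<open>v > 0\<close> by (simp_all add: r_def q_def)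
  have vqr: "v = q * r"
  proof -
    have "q * r = v powr (1 / n + Suc k / n)" unfolding q_def r_def by (rule powr_add[symmetric])
    also have "1 / n + Suc k / n = 1" by (simp add: n field_simps)
    finally show ?thesis using \<open>v > 0\<close> by simp
  qed
  have M_d: "M \<le> d * (W * r)"
    using B \<open>W > 0\<close> \<open>r > 0\<close> unfolding r_def[symmetric] by (simp add: pos_divide_le_eq)
  have "d \<ge> 0"
  proof -
    have "0 \<le> M / (W * r)" using \<open>M \<ge> 0\<close> \<open>W > 0\<close> \<open>r > 0\<close> by simp
    then show ?thesis using B unfolding r_def by linarith
  qed
  have b: "2 * b_const n * d / (n * unit_ball_vol n powr (1 / n)) = C * W * d"
  proof -
    have "C = 2 * real (Suc k) / real n" by (simp add: C_def n add.commute)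
    then have "2 * b_const n / (n * unit_ball_vol n powr (1 / n)) = C * W"
      using two_b_const_eq[of "Suc k"] unfolding n[symmetric] W_def by simp
    then show ?thesis by (simp only: times_divide_eq_left[symmetric])
  qed
  \<comment> \<open>Writing |K| as the product of |K|^(1/n) and |K|^((n-1)/n), the second factor
    cancels against the same power in the bound for \<open>M\<close>.\<close>
  have "r * (q * P) \<le> C * S * M"
    using A vqr by (simp add: mult_ac)
  also have "\<dots> \<le> C * S * (d * (W * r))"
    using M_d \<open>C > 0\<close> \<open>S \<ge> 0\<close> by (intro mult_left_mono) auto
  also have "\<dots> = r * (C * W * d * S)" by (simp add: mult_ac)
  finally have main: "q * P \<le> C * W * d * S"
    using \<open>r > 0\<close> by (subst (asm) mult_le_cancel_left_pos) auto
  show "vol n K powr (1 / real n) * (INF \<xi>\<in>unit_sphere n. surface_area_perp n \<xi> (proj_perp n \<xi> ` K))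
    \<le> 2 * b_const n * min_surface_param n K / (real n * unit_ball_vol (real n) powr (1 / real n)) * surface_area n K"
    using main unfolding d_def[symmetric] b S_def[symmetric] P_def[symmetric] vol_eq_V[OF cK] v_def[symmetric] q_def[symmetric] .
  have CW: "C * W \<le> 2 / sqrt n"
  proof -
    have "unit_ball_vol (Suc k) \<le> sqrt n * unit_ball_vol n"
      using unit_ball_vol_ratio_le[of "Suc k"] by (simp add: n)
    then have "W \<le> sqrt n * unit_ball_vol n / (n * unit_ball_vol n)"
      unfolding W_def by (intro divide_right_mono) auto
    also have "\<dots> = sqrt n / n" by simp
    also have "\<dots> = 1 / sqrt n" by (simp add: sqrt_divide_self_eq inverse_eq_divide)
    finally have "W \<le> 1 / sqrt n" .
    moreover have "C \<le> 2" unfolding C_def by (subst pos_divide_le_eq) auto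
    ultimately have "C * W \<le> 2 * (1 / sqrt n)"
      using \<open>W > 0\<close> by (intro mult_mono) auto
    then show ?thesis by simp
  qed
  have "C * W * d * S \<le> 2 / sqrt n * d * S"
    using CW \<open>d \<ge> 0\<close> \<open>S \<ge> 0\<close> by (intro mult_right_mono) auto
  then show "2 * b_const n * min_surface_param n K / (real n * unit_ball_vol (real n) powr (1 / real n)) * surface_area n K
    \<le> 2 * min_surface_param n K / sqrt (real n) * surface_area n K"
    unfolding d_def[symmetric] b S_def[symmetric] by simp
qed

end
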